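(* Let $N\in\mathbb{N}$ and $M\in 2\mathbb{N}_0$ with $M<N$, and let $r\in\frac{M-N}{2}+\mathbb{Z}$. Then the Fourier coefficient $\chi(M,N,r;\tau)$ of $\phi_{M,N}(z;\tau)$ (with respect to $\zeta=e^{2\pi i z}$, in the range $0<\operatorname{Im}(z)<\operatorname{Im}(\tau)$) is a mixed partial theta function.
   Context: Notation: $\mathbb{H}$ is the upper half plane, $\tau\in\mathbb{H}$, $z\in\mathbb{C}$, $q=e^{2\pi i\tau}$, $\zeta=e^{2\pi i z}$, rational powers being $q^a=e^{2\pi i a\tau}$, $\zeta^a=e^{2\pi i a z}$; $(a)_\infty=\prod_{j\ge 0}(1-aq^j)$. The Jacobi theta function is $\vartheta(z;\tau)=-i\zeta^{-1/2}q^{1/8}(q)_\infty(\zeta)_\infty(\zeta^{-1}q)_\infty$. For $N\in\mathbb{N}$, $M\in\mathbb{N}_0$ set $$\phi_{M,N}(z;\tau)=\frac{\vartheta(z+\frac12;\tau)^M}{\vartheta(z;\tau)^N}.$$ For $0<\operatorname{Im}(z)<\operatorname{Im}(\tau)$ its Fourier coefficients are defined by $\phi_{M,N}(z;\tau)=\sum_{r\in\frac{M-N}{2}+\mathbb{Z}}\chi(M,N,r;\tau)\zeta^r$. An almost holomorphic modular form of weight $k$ on a congruence subgroup is a function on $\mathbb{H}$ transforming like a modular form of weight $k$ that is a polynomial in $1/\operatorname{Im}(\tau)$ with holomorphic coefficients; a quasimodular form is the constant term (in $1/\operatorname{Im}(\tau)$) of an almost holomorphic modular form. Here poles at the cusps,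 integral or half-integral (possibly negative) weight, and a multiplier system are allowed. A partial theta function is a sum over half a lattice whose extension to the full lattice is a theta function; here this means a series $\sum_{n\ge 0}\epsilon^n(n+a)^k q^{c(n+a)^2}$ with $\epsilon\in\{\pm1\}$, $a\in\mathbb{Q}$, $c\in\mathbb{Q}_{>0}$, $k\in\mathbb{N}_0$. A mixed partial theta function is a finite linear combination of products of a quasimodular form with a partial theta function; a function is also called a mixed partial theta function if it equals one up to multiplication by a rational power of $q$. *)

theory Defs
  imports "HOL-Complex_Analysis.Complex_Analysis" "HOL-Algebra.Group" "HOL-Number_Theory.Cong"
begin

definition upper_half_plane :: "complex set" where
  "upper_half_plane = {\<tau>. Im \<tau> > 0}"

(* Rational powers: q^a = e2pi a \<tau> and \<zeta>^a = e2pi a z. *)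
definition e2pi :: "real \<Rightarrow> complex \<Rightarrow> complex" where
  "e2pi a w = exp (2 * of_real pi * \<i> * of_real a * w)"

definition qpoch_inf :: "complex \<Rightarrow> complex \<Rightarrow> complex" where
  "qpoch_inf a q = (\<Prod>j. 1 - a * q ^ j)"

definition jacobi_theta :: "complex \<Rightarrow> complex \<Rightarrow> complex" where
  "jacobi_theta z \<tau> =
     (let q = e2pi 1 \<tau>; \<zeta> = e2pi 1 z in
       - \<i> * e2pi (- 1 / 2) z * e2pi (1 / 8) \<tau>
         * qpoch_inf q q * qpoch_inf \<zeta> q * qpoch_inf (inverse \<zeta> * q) q)"

definition phi :: "nat \<Rightarrow> nat \<Rightarrow> complex \<Rightarrow> complex \<Rightarrow> complex" where
  "phi M N z \<tau> = jacobi_theta (z + 1 / 2) \<tau> ^ M / jacobi_theta z \<tau> ^ N"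

definition exponents :: "nat \<Rightarrow> nat \<Rightarrow> real set" where
  "exponents M N = {(real M - real N) / 2 + of_int n | n :: int. True}"

(* c is the family of coefficients of the expansion of phi M N in powers of \<zeta>, valid in
   0 < Im z < Im \<tau>; c is normalised to vanish off the index set so that it is unique. *)
definition is_fourier_expansion ::
    "nat \<Rightarrow> nat \<Rightarrow> complex \<Rightarrow> (real \<Rightarrow> complex) \<Rightarrow> bool" where
  "is_fourier_expansion M N \<tau> c \<longleftrightarrow>
     (\<forall>r. r \<notin> exponents M N \<longrightarrow> c r = 0) \<and>
     (\<forall>z. 0 < Im z \<and> Im z < Im \<tau> \<longrightarrow>
        ((\<lambda>r. c r * e2pi r z) has_sum phi M N z \<tau>) (exponents M N))"

definition chi :: "nat \<Rightarrow> nat \<Rightarrow> real \<Rightarrow> complex \<Rightarrow> complex" where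
  "chi M N r \<tau> = (THE c. is_fourier_expansion M N \<tau> c) r"

definition SL2Z :: "(int ^ 2 ^ 2) monoid" where
  "SL2Z = \<lparr>carrier = {A. det A = 1}, mult = (**), one = mat 1\<rparr>"

definition congruence_subgroup :: "(int ^ 2 ^ 2) set \<Rightarrow> bool" where
  "congruence_subgroup \<Gamma> \<longleftrightarrow>
     subgroup \<Gamma> SL2Z \<and>
     (\<exists>n::nat. n \<ge> 1 \<and>
        (\<forall>A \<in> carrier SL2Z. (\<forall>i j. [A $ i $ j = mat 1 $ i $ j] (mod int n)) \<longrightarrow> A \<in> \<Gamma>))"

definition mob :: "int ^ 2 ^ 2 \<Rightarrow> complex \<Rightarrow> complex" where
  "mob A \<tau> = (of_int (A $ 1 $ 1) * \<tau> + of_int (A $ 1 $ 2)) /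
             (of_int (A $ 2 $ 1) * \<tau> + of_int (A $ 2 $ 2))"

(* (c\<tau> + d)^k for real k, with the principal branch (argument in (-pi, pi]). *)
definition aut_factor :: "real \<Rightarrow> int ^ 2 ^ 2 \<Rightarrow> complex \<Rightarrow> complex" where
  "aut_factor k A \<tau> = (of_int (A $ 2 $ 1) * \<tau> + of_int (A $ 2 $ 2)) powr of_real k"

definition multiplier_system ::
    "real \<Rightarrow> (int ^ 2 ^ 2) set \<Rightarrow> (int ^ 2 ^ 2 \<Rightarrow> complex) \<Rightarrow> bool" where
  "multiplier_system k \<Gamma> v \<longleftrightarrow>
     (\<forall>A \<in> \<Gamma>. norm (v A) = 1) \<and>
     (\<forall>A \<in> \<Gamma>. \<forall>B \<in> \<Gamma>. \<forall>\<tau> \<in> upper_half_plane.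
        v (A ** B) * aut_factor k (A ** B) \<tau>
          = v A * v B * aut_factor k A (mob B \<tau>) * aut_factor k B \<tau>)"

(* Poles at the cusps are allowed, essential singularities are not: at every cusp
   F grows at most exponentially in Im \<tau>. *)
definition meromorphic_at_cusps :: "real \<Rightarrow> (complex \<Rightarrow> complex) \<Rightarrow> bool" where
  "meromorphic_at_cusps k F \<longleftrightarrow>
     (\<forall>A \<in> carrier SL2Z. \<exists>B C :: real. \<forall>\<tau>. Im \<tau> \<ge> 1 \<longrightarrow>
        norm (F (mob A \<tau>) / aut_factor k A \<tau>) \<le> C * exp (B * Im \<tau>))"

(* F = h_0 + h_1 / Im \<tau> + ... + h_p / (Im \<tau>)^p on the upper half plane, h_j holomorphic;
   the h_j are determined by F. *)
definition inverse_Im_expansion ::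
    "nat \<Rightarrow> (nat \<Rightarrow> complex \<Rightarrow> complex) \<Rightarrow> (complex \<Rightarrow> complex) \<Rightarrow> bool" where
  "inverse_Im_expansion p h F \<longleftrightarrow>
     (\<forall>j \<le> p. h j holomorphic_on upper_half_plane) \<and>
     (\<forall>\<tau> \<in> upper_half_plane. F \<tau> = (\<Sum>j\<le>p. h j \<tau> / of_real (Im \<tau>) ^ j))"

definition almost_holomorphic_modular_form ::
    "real \<Rightarrow> (int ^ 2 ^ 2) set \<Rightarrow> (complex \<Rightarrow> complex) \<Rightarrow> bool" where
  "almost_holomorphic_modular_form k \<Gamma> F \<longleftrightarrow>
     2 * k \<in> \<int> \<and> congruence_subgroup \<Gamma> \<and>
     (\<exists>v. multiplier_system k \<Gamma> v \<and>
        (\<forall>A \<in> \<Gamma>. \<forall>\<tau> \<in> upper_half_plane. F (mob A \<tau>) = v A * aut_factor k A \<tau> * F \<tau>)) \<and>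
     meromorphic_at_cusps k F \<and>
     (\<exists>p h. inverse_Im_expansion p h F)"

definition quasimodular_form :: "(complex \<Rightarrow> complex) \<Rightarrow> bool" where
  "quasimodular_form f \<longleftrightarrow>
     (\<exists>k \<Gamma> F p h. almost_holomorphic_modular_form k \<Gamma> F \<and> inverse_Im_expansion p h F \<and>
        (\<forall>\<tau> \<in> upper_half_plane. f \<tau> = h 0 \<tau>))"

definition partial_theta_series :: "real \<Rightarrow> real \<Rightarrow> real \<Rightarrow> nat \<Rightarrow> complex \<Rightarrow> complex" where
  "partial_theta_series \<epsilon> a c k \<tau> =
     (\<Sum>n. of_real (\<epsilon> ^ n * (real n + a) ^ k) * e2pi (c * (real n + a)\<^sup>2) \<tau>)"

definition partial_theta_function :: "(complex \<Rightarrow> complex) \<Rightarrow> bool" where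
  "partial_theta_function P \<longleftrightarrow>
     (\<exists>\<epsilon> a c k. \<epsilon> \<in> {1, - 1} \<and> a \<in> \<rat> \<and> c \<in> \<rat> \<and> c > 0 \<and>
        (\<forall>\<tau> \<in> upper_half_plane. P \<tau> = partial_theta_series \<epsilon> a c k \<tau>))"

(* The factor q^s accounts for the convention that equality is only required up to
   multiplication by a rational power of q. *)
definition mixed_partial_theta_function :: "(complex \<Rightarrow> complex) \<Rightarrow> bool" where
  "mixed_partial_theta_function f \<longleftrightarrow>
     (\<exists>s \<in> \<rat>. \<exists>(m::nat) (\<alpha> :: nat \<Rightarrow> complex) g P.
        (\<forall>i<m. quasimodular_form (g i) \<and> partial_theta_function (P i)) \<and>
        (\<forall>\<tau> \<in> upper_half_plane. f \<tau> = e2pi s \<tau> * (\<Sum>i<m. \<alpha> i * g i \<tau> * P i \<tau>)))"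

end

theory Submission
  imports Defs "HOL-Real_Asymp.Real_Asymp"
begin

text \<open>Write \<open>L = N - M > 0\<close>, \<open>q = exp (2\<pi>i\<tau>)\<close>, \<open>\<zeta> = exp (2\<pi>iz)\<close>. As a function of \<open>z\<close>, the quotient \<open>\<phi>\<close> has its
poles exactly at the lattice points, all of order \<open>N\<close>, it is periodic up to sign under \<open>z \<mapsto> z + 1\<close>, and
\<open>\<phi>(z + \<tau>) = (-1)^N q^(L/2) \<zeta>^L \<phi>(z)\<close>. The Fourier coefficients in the strip below the real line are therefore
shifts of those in the strip above it, and the residue theorem on a rectangle around the pole at \<open>0\<close> compares
the two (\<open>chi_recurrence\<close>):
\<open>\<chi>(r) = (-1)^N q^(L/2 + r) \<chi>(r + L) - 2\<pi>i Res (\<phi> \<zeta>^(-r))\<close>.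

Because \<open>L > 0\<close>, iterating this brings in powers of \<open>q\<close> with quadratically growing exponents, the remainder tends
to \<open>0\<close>, and \<open>\<chi>(r)\<close> becomes the series of \<open>- (-1)^(Nn) q^(nr + n^2 L/2) 2\<pi>i Res (\<phi> \<zeta>^(-(r + nL)))\<close> over \<open>n \<ge> 0\<close>
(\<open>chi_sums\<close>). Completing the square gives \<open>nr + n^2 L/2 = (L/2)(n + r/L)^2 - r^2/(2L)\<close>. The residue is a polynomial
in \<open>r + nL\<close> whose coefficients are, up to constants, the Laurent coefficients of \<open>\<phi>\<close> at \<open>z = 0\<close>
(\<open>phi_residue_eq\<close>). So \<open>\<chi>(r)\<close> is \<open>q^(-r^2/(2L))\<close> times a sum of \<open>N\<close> products of a Laurent coefficient with a
partial theta series, and it remains to see that the Laurent coefficients are quasimodular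
(\<open>laurent_coeff_quasimodular\<close>).

\<open>\<phi>\<close> transforms like a Jacobi form of weight and index \<open>(M - N)/2\<close> on the matrices with even lower left entry. The
factor \<open>exp (\<pi>(M - N) z^2/(2 Im \<tau>))\<close> absorbs the index, so that the Taylor coefficients of \<open>z^N \<phi>\<close> times this
factor are modular. They are polynomials in \<open>1/Im \<tau>\<close>, and their constant terms are the Taylor coefficients
of \<open>z^N \<phi>\<close> itself. A common multiplier system for all of them is read off from the coefficient of index \<open>0\<close>, which
has no zeros. The growth at a cusp follows from the transformation under all of \<open>SL(2,Z)\<close> and the Cauchy
inequality on a fixed circle.

The modular transformation of \<open>\<theta>\<close> is obtained directly from its product. The function
\<open>|\<theta>(z)| exp (-\<pi> (Im z)^2/Im \<tau>)\<close> is invariant under the lattice; hence \<open>\<theta>(z/(c\<tau> + d); A\<tau>)\<close>, corrected by a Gaussian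
factor, divided by \<open>\<theta>(z; \<tau>)\<close> is entire and bounded, that is, a constant \<open>C\<close> (\<open>theta_transform\<close>). The matrix \<open>A\<close>
permutes the three non-trivial half periods, and the product of the invariant absolute values there is
\<open>|\<theta>'(0)|/\<pi>\<close> by an identity of Euler; comparing both sides gives \<open>|C|^2 = |c\<tau> + d|\<close> (\<open>norm_theta_factor\<close>). As a
function of \<open>\<tau>\<close>, \<open>C (c\<tau> + d)^(-1/2)\<close> is then holomorphic of modulus \<open>1\<close>, so it is a constant.\<close>

(* From here on the symbol $ only denotes entries of vectors and matrices. *)
no_notation fps_nth (infixl "$" 75)

section \<open>Rational powers of q and \<zeta>\<close>

lemma e2pi_0 [simp]: "e2pi 0 w = 1" "e2pi a 0 = 1"
  by (simp_all add: e2pi_def)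

lemma e2pi_nonzero [simp]: "e2pi a w \<noteq> 0"
  by (simp add: e2pi_def)

lemma e2pi_add_left: "e2pi (a + b) w = e2pi a w * e2pi b w"
  by (simp add: e2pi_def exp_add algebra_simps)

lemma e2pi_add_right: "e2pi a (v + w) = e2pi a v * e2pi a w"
  by (simp add: e2pi_def exp_add algebra_simps)

lemma e2pi_minus_left: "e2pi (- a) w = inverse (e2pi a w)"
  by (simp add: e2pi_def exp_minus)

lemma e2pi_minus_right: "e2pi a (- w) = inverse (e2pi a w)"
  by (simp add: e2pi_def exp_minus)

lemma e2pi_power: "e2pi a w ^ n = e2pi (real n * a) w"
  by (simp add: e2pi_def algebra_simps flip: exp_of_nat_mult)

lemma e2pi_of_int: "e2pi (of_int n) (of_int k) = 1"
proof -
  have "exp ((2 * of_int (n * k) * of_real pi) * \<i>) = 1"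
    unfolding exp_eq_1 by (auto intro!: exI[of _ "n * k"])
  then show ?thesis
    by (simp add: e2pi_def mult_ac)
qed

lemma e2pi_1_eq_1_iff: "e2pi 1 w = 1 \<longleftrightarrow> w \<in> \<int>"
proof -
  have "e2pi 1 w = 1 \<longleftrightarrow> (\<exists>n::int. 2 * pi * Im w = 0 \<and> 2 * pi * Re w = real_of_int (2 * n) * pi)"
    unfolding e2pi_def exp_eq_1 by simp
  also have "\<dots> \<longleftrightarrow> (\<exists>n::int. w = of_int n)"
    by (auto simp: complex_eq_iff)
  finally show ?thesis by (auto simp: Ints_def)
qed

lemma norm_e2pi: "norm (e2pi a w) = exp (- (2 * pi * a * Im w))"
  by (simp add: e2pi_def)

lemma e2pi_holomorphic [holomorphic_intros]:
  assumes "f holomorphic_on S"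
  shows "(\<lambda>w. e2pi a (f w)) holomorphic_on S"
  unfolding e2pi_def by (intro holomorphic_intros assms)

lemma e2pi_continuous [continuous_intros]:
  assumes "continuous_on S f"
  shows "continuous_on S (\<lambda>w. e2pi a (f w))"
  unfolding e2pi_def by (intro continuous_intros assms)

lemma norm_nome: "\<tau> \<in> upper_half_plane \<Longrightarrow> norm (e2pi 1 \<tau>) < 1"
  by (simp add: norm_e2pi upper_half_plane_def)

section \<open>Infinite q-products\<close>

lemma qpoch_convergent:
  fixes a q :: complex
  assumes "norm q < 1"
  shows "convergent_prod (\<lambda>j. 1 - a * q ^ j)"
proof -
  have "summable (\<lambda>j. norm a * norm q ^ j)"
    using assms by (intro summable_mult summable_geometric) auto
  moreover have "norm ((1 - a * q ^ j) - 1) = norm a * norm q ^ j" for j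
    by (simp add: norm_mult norm_power)
  ultimately have "summable (\<lambda>j. norm ((1 - a * q ^ j) - 1))"
    by (simp only:)
  then show ?thesis
    by (intro abs_convergent_prod_imp_convergent_prod) (simp add: abs_convergent_prod_conv_summable)
qed

lemma qpoch_limit:
  assumes "norm q < 1"
  shows "(\<lambda>n. \<Prod>j<n. 1 - a * q ^ j) \<longlonglongrightarrow> qpoch_inf a q"
proof (rule LIMSEQ_imp_Suc)
  have "(\<lambda>n. \<Prod>j\<le>n. 1 - a * q ^ j) \<longlonglongrightarrow> qpoch_inf a q"
    unfolding qpoch_inf_def by (rule convergent_prod_LIMSEQ[OF qpoch_convergent[OF assms]])
  then show "(\<lambda>n. \<Prod>j<Suc n. 1 - a * q ^ j) \<longlonglongrightarrow> qpoch_inf a q"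
    by (simp add: lessThan_Suc_atMost)
qed

text \<open>The convergence is uniform in both variables jointly. Continuity in \<open>(a, q)\<close> and holomorphy along any holomorphic
curve \<open>x \<mapsto> (f x, g x)\<close> both follow from this single fact.\<close>

lemma qpoch_uniform_limit:
  assumes K: "compact K" "K \<subseteq> UNIV \<times> ball 0 1"
  shows "uniform_limit K (\<lambda>n (a, q). \<Prod>j<n. 1 - a * q ^ j) (\<lambda>(a, q). qpoch_inf a q) sequentially"
proof (cases "K = {}")
  case False
  have cp: "compact ((\<lambda>x. norm (fst x)) ` K)" "compact ((\<lambda>x. norm (snd x)) ` K)"
    by (intro compact_continuous_image continuous_intros K)+
  obtain x1 where x1: "x1 \<in> K" "\<And>x. x \<in> K \<Longrightarrow> norm (snd x) \<le> norm (snd x1)"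
    using compact_attains_sup[OF cp(2)] False by auto
  obtain x2 where x2: "x2 \<in> K" "\<And>x. x \<in> K \<Longrightarrow> norm (fst x) \<le> norm (fst x2)"
    using compact_attains_sup[OF cp(1)] False by auto
  define R \<rho> where "R = norm (fst x2)" and "\<rho> = norm (snd x1)"
  have \<rho>: "0 \<le> \<rho>" "\<rho> < 1" using subsetD[OF K(2) x1(1)] by (auto simp: \<rho>_def mem_Times_iff)
  have R: "0 \<le> R" by (simp add: R_def)
  have le: "norm (- (a * q ^ j)) \<le> R * \<rho> ^ j" if "(a, q) \<in> K" for a q j
    using x1(2)[OF that] x2(2)[OF that] R \<rho>
    by (auto simp: norm_mult norm_power R_def \<rho>_def intro!: mult_mono power_mono)
  have "uniformly_convergent_on K (\<lambda>N x. \<Prod>n<N. 1 + - (fst x * snd x ^ n))"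
  proof (rule uniformly_convergent_on_prod)
    show "uniformly_convergent_on K (\<lambda>N x. \<Sum>n<N. norm (- (fst x * snd x ^ n)))"
    proof (rule Weierstrass_m_test')
      show "summable (\<lambda>j. R * \<rho> ^ j)"
        using \<rho> by (intro summable_mult summable_geometric) auto
    qed (use le in auto)
  qed (auto intro!: continuous_intros K)
  moreover have "lim (\<lambda>N. \<Prod>j<N. 1 - a * q ^ j) = qpoch_inf a q" if "(a, q) \<in> K" for a q
    using K(2) that by (intro limI qpoch_limit) auto
  ultimately show ?thesis
    unfolding uniformly_convergent_uniform_limit_iff
    by (auto simp: case_prod_unfold cong: uniform_limit_cong')
qed auto

lemma qpoch_shift:
  assumes "norm q < 1"
  shows "qpoch_inf a q = (1 - a) * qpoch_inf (a * q) q"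
proof (rule LIMSEQ_unique)
  show "(\<lambda>n. \<Prod>j<Suc n. 1 - a * q ^ j) \<longlonglongrightarrow> qpoch_inf a q"
    by (rule LIMSEQ_Suc[OF qpoch_limit[OF assms]])
  have "(\<lambda>n. (1 - a) * (\<Prod>j<n. 1 - (a * q) * q ^ j)) \<longlonglongrightarrow> (1 - a) * qpoch_inf (a * q) q"
    by (intro tendsto_intros qpoch_limit assms)
  then show "(\<lambda>n. \<Prod>j<Suc n. 1 - a * q ^ j) \<longlonglongrightarrow> (1 - a) * qpoch_inf (a * q) q"
    by (subst prod.lessThan_Suc_shift) (simp add: mult_ac)
qed

lemma qpoch_eq_0_iff:
  assumes "norm q < 1"
  shows "qpoch_inf a q = 0 \<longleftrightarrow> (\<exists>j. a * q ^ j = 1)"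
proof
  assume "qpoch_inf a q = 0"
  then show "\<exists>j. a * q ^ j = 1"
    using prodinf_nonzero[OF qpoch_convergent[OF assms, of a]] by (force simp: qpoch_inf_def)
next
  assume "\<exists>j. a * q ^ j = 1"
  then obtain j where j: "a * q ^ j = 1" by auto
  have "(\<lambda>n. \<Prod>j<n. 1 - a * q ^ j) \<longlonglongrightarrow> 0"
    by (rule tendsto_eventually, rule eventually_sequentiallyI[of "Suc j"])
       (use j in \<open>auto intro!: bexI[of _ j]\<close>)
  then show "qpoch_inf a q = 0"
    using LIMSEQ_unique qpoch_limit[OF assms] by blast
qed

lemma qpoch_nonzero:
  assumes "norm q < 1" "norm a < 1"
  shows "qpoch_inf a q \<noteq> 0"
proof
  assume "qpoch_inf a q = 0"
  then obtain j where "a * q ^ j = 1" using qpoch_eq_0_iff assms by blast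
  then have "norm a * norm q ^ j = 1" by (metis norm_mult norm_power norm_one)
  moreover have "norm a * norm q ^ j \<le> norm a * 1"
    using assms by (intro mult_left_mono power_le_one) auto
  ultimately show False using assms by simp
qed

lemma qpoch_continuous:
  "continuous_on (UNIV \<times> ball 0 1) (\<lambda>(a, q). qpoch_inf a q)"
proof -
  have "continuous_on (cball x r) (\<lambda>(a, q). qpoch_inf a q)"
    if "cball x r \<subseteq> UNIV \<times> ball (0::complex) 1" for x :: "complex \<times> complex" and r
    by (rule uniform_limit_theorem[OF _ qpoch_uniform_limit])
       (use that in \<open>auto intro!: always_eventually continuous_intros simp: case_prod_unfold\<close>)
  moreover have "open (UNIV \<times> ball (0::complex) 1 :: (complex \<times> complex) set)"
    by (intro open_Times) auto
  ultimately show ?thesis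
    by (metis (no_types, lifting) continuous_at_imp_continuous_on open_contains_cball
        centre_in_ball ball_subset_cball continuous_on_subset continuous_on_eq_continuous_at open_ball)
qed

lemma qpoch_continuous_compose [continuous_intros]:
  assumes "continuous_on S f" "continuous_on S g" "\<And>x. x \<in> S \<Longrightarrow> norm (g x) < 1"
  shows "continuous_on S (\<lambda>x. qpoch_inf (f x) (g x))"
proof -
  have "continuous_on S ((\<lambda>(a, q). qpoch_inf a q) \<circ> (\<lambda>x. (f x, g x)))"
    by (intro continuous_on_compose continuous_on_subset[OF qpoch_continuous] continuous_intros)
       (use assms in auto)
  then show ?thesis by (simp add: o_def)
qed

lemma qpoch_holomorphic [holomorphic_intros]:
  assumes "open S" "f holomorphic_on S" "g holomorphic_on S" "\<And>x. x \<in> S \<Longrightarrow> norm (g x) < 1"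
  shows "(\<lambda>x. qpoch_inf (f x) (g x)) holomorphic_on S"
proof (rule holomorphic_uniform_sequence[OF \<open>open S\<close>])
  show "(\<lambda>x. \<Prod>j<n. 1 - f x * g x ^ j) holomorphic_on S" for n
    by (intro holomorphic_intros assms)
  fix x assume "x \<in> S"
  then obtain d where d: "d > 0" "cball x d \<subseteq> S"
    using \<open>open S\<close> open_contains_cball by blast
  define K where "K = (\<lambda>x. (f x, g x)) ` cball x d"
  have "compact K" unfolding K_def
    using assms(2,3) d
    by (intro compact_continuous_image continuous_on_Pair)
       (auto intro: holomorphic_on_imp_continuous_on holomorphic_on_subset)
  moreover have "K \<subseteq> UNIV \<times> ball 0 1" using assms(4) d by (auto simp: K_def)
  ultimately have "uniform_limit K (\<lambda>n (a, q). \<Prod>j<n. 1 - a * q ^ j) (\<lambda>(a, q). qpoch_inf a q) sequentially"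
    by (rule qpoch_uniform_limit)
  from uniform_limit_compose'[OF this, of "\<lambda>x. (f x, g x)" "cball x d"]
  have "uniform_limit (cball x d) (\<lambda>n x. \<Prod>j<n. 1 - f x * g x ^ j) (\<lambda>x. qpoch_inf (f x) (g x)) sequentially"
    by (simp add: K_def)
  with d show "\<exists>d>0. cball x d \<subseteq> S \<and>
      uniform_limit (cball x d) (\<lambda>n x. \<Prod>j<n. 1 - f x * g x ^ j) (\<lambda>x. qpoch_inf (f x) (g x)) sequentially"
    by blast
qed

text \<open>This is Euler's identity \<open>(-q; q) (q; q^2) = 1\<close> with \<open>q = p^2\<close>: the products in \<open>p\<close> and \<open>-p\<close> combine to \<open>(q; q^2)\<close>,
while \<open>(q; q) (-q; q) = (q^2; q^2)\<close> and \<open>(q; q) = (q; q^2) (q^2; q^2)\<close>.\<close>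

lemma qpoch_sqrt_product:
  assumes "norm p < 1"
  shows "qpoch_inf (- (p^2)) (p^2) * qpoch_inf p (p^2) * qpoch_inf (- p) (p^2) = 1"
proof -
  have p2: "norm (p^2) < 1" "norm (p^4) < 1"
    using assms by (auto simp: norm_power power_less_one_iff)
  have A: "qpoch_inf p (p^2) * qpoch_inf (- p) (p^2) = qpoch_inf (p^2) (p^4)"
  proof (rule LIMSEQ_unique)
    show "(\<lambda>n. \<Prod>j<n. 1 - p^2 * (p^4)^j) \<longlonglongrightarrow> qpoch_inf (p^2) (p^4)"
      by (rule qpoch_limit[OF p2(2)])
    have "(1 - p * (p\<^sup>2) ^ j) * (1 - - p * (p\<^sup>2) ^ j) = 1 - p^2 * (p^4)^j" for j
    proof -
      have "(p^4)^j = ((p\<^sup>2) ^ j)^2" by (simp flip: power_mult)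
      then show ?thesis by (simp add: algebra_simps power2_eq_square)
    qed
    moreover have "(\<lambda>n. (\<Prod>j<n. 1 - p * (p^2)^j) * (\<Prod>j<n. 1 - (-p) * (p^2)^j)) \<longlonglongrightarrow>
        qpoch_inf p (p^2) * qpoch_inf (- p) (p^2)"
      by (intro tendsto_mult qpoch_limit p2)
    ultimately show "(\<lambda>n. \<Prod>j<n. 1 - p^2 * (p^4)^j) \<longlonglongrightarrow> qpoch_inf p (p^2) * qpoch_inf (- p) (p^2)"
      by (simp only: flip: prod.distrib)
  qed
  have B: "qpoch_inf (p^2) (p^2) * qpoch_inf (- (p^2)) (p^2) = qpoch_inf (p^4) (p^4)"
  proof (rule LIMSEQ_unique)
    show "(\<lambda>n. \<Prod>j<n. 1 - p^4 * (p^4)^j) \<longlonglongrightarrow> qpoch_inf (p^4) (p^4)"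
      by (rule qpoch_limit[OF p2(2)])
    have "(1 - p^2 * (p\<^sup>2) ^ j) * (1 - - (p^2) * (p\<^sup>2) ^ j) = 1 - p^4 * (p^4)^j" for j
    proof -
      have "(p^4)^j = ((p\<^sup>2) ^ j)^2" by (simp flip: power_mult)
      then show ?thesis by (simp add: algebra_simps power2_eq_square power4_eq_xxxx)
    qed
    moreover have "(\<lambda>n. (\<Prod>j<n. 1 - p^2 * (p^2)^j) * (\<Prod>j<n. 1 - (-(p^2)) * (p^2)^j)) \<longlonglongrightarrow>
        qpoch_inf (p^2) (p^2) * qpoch_inf (- (p^2)) (p^2)"
      by (intro tendsto_mult qpoch_limit p2)
    ultimately show "(\<lambda>n. \<Prod>j<n. 1 - p^4 * (p^4)^j) \<longlonglongrightarrow> qpoch_inf (p^2) (p^2) * qpoch_inf (- (p^2)) (p^2)"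
      by (simp only: flip: prod.distrib)
  qed
  have C: "qpoch_inf (p^2) (p^2) = qpoch_inf (p^2) (p^4) * qpoch_inf (p^4) (p^4)"
  proof (rule LIMSEQ_unique)
    have "(\<lambda>n. \<Prod>j<2*n. 1 - p^2 * (p^2)^j) \<longlonglongrightarrow> qpoch_inf (p^2) (p^2)"
      by (rule filterlim_compose[OF qpoch_limit[OF p2(1)]]) (auto intro!: filterlim_subseq strict_monoI)
    then show "(\<lambda>n. \<Prod>j<2*n. 1 - p^2 * (p^2)^j) \<longlonglongrightarrow> qpoch_inf (p^2) (p^2)" .
    have "(\<Prod>j<2*n. 1 - p^2 * (p^2)^j) = (\<Prod>j<n. 1 - p^2 * (p^4)^j) * (\<Prod>j<n. 1 - p^4 * (p^4)^j)" for n
    proof (induction n)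
      case (Suc n)
      have 1: "p^2 * (p^2)^(2*n) = p^2 * (p^4)^n" "p^2 * (p^2)^(Suc (2*n)) = p^4 * (p^4)^n"
        by (simp_all add: power_add flip: power_mult)
      have "(\<Prod>j<2*Suc n. 1 - p^2 * (p^2)^j)
          = (\<Prod>j<2*n. 1 - p^2 * (p^2)^j) * (1 - p^2 * (p^2)^(2*n)) * (1 - p^2 * (p^2)^(Suc (2*n)))"
        by (simp only: mult_Suc_right add_2_eq_Suc prod.lessThan_Suc)
      then show ?case unfolding 1 Suc.IH prod.lessThan_Suc by (simp only: mult_ac)
    qed simp
    moreover have "(\<lambda>n. (\<Prod>j<n. 1 - p^2 * (p^4)^j) * (\<Prod>j<n. 1 - p^4 * (p^4)^j)) \<longlonglongrightarrow>
        qpoch_inf (p^2) (p^4) * qpoch_inf (p^4) (p^4)"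
      by (intro tendsto_mult qpoch_limit p2)
    ultimately show "(\<lambda>n. \<Prod>j<2*n. 1 - p^2 * (p^2)^j) \<longlonglongrightarrow> qpoch_inf (p^2) (p^4) * qpoch_inf (p^4) (p^4)"
      by simp
  qed
  have nz: "qpoch_inf (p^4) (p^4) \<noteq> 0" by (rule qpoch_nonzero) (use p2 in auto)
  have "qpoch_inf (p^4) (p^4) * (qpoch_inf (- (p^2)) (p^2) * qpoch_inf (p^2) (p^4)) = qpoch_inf (p^4) (p^4)"
    using B C by (simp add: mult_ac)
  then have "qpoch_inf (- (p^2)) (p^2) * qpoch_inf (p^2) (p^4) = 1" using nz by simp
  then show ?thesis by (simp only: mult.assoc A)
qed

section \<open>The theta function on a lattice\<close>

definition theta_lattice :: "complex \<Rightarrow> complex set" where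
  "theta_lattice \<tau> = {of_int m * \<tau> + of_int n | m n. True}"

lemma half_notin_theta_lattice:
  assumes "\<tau> \<in> upper_half_plane"
  shows "1 / 2 \<notin> theta_lattice \<tau>"
proof
  assume "1 / 2 \<in> theta_lattice \<tau>"
  then obtain m n where mn: "1 / 2 = of_int m * \<tau> + of_int n" by (auto simp: theta_lattice_def)
  have "m = 0" using arg_cong[OF mn, of Im] assms by (simp add: upper_half_plane_def)
  then have "of_int (2 * n) = (1 :: real)" using arg_cong[OF mn, of Re] by simp
  then have "2 * n = 1" by linarith
  then show False by presburger
qed

lemma minus_one_e2pi: "- 1 = e2pi (1 / 2) 1"
  by (simp add: e2pi_def)

lemma e2pi_1_add_1: "e2pi 1 (z + 1) = e2pi 1 z"
  using e2pi_of_int[of 1 1] by (simp add: e2pi_add_right)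

lemma theta_add_1: "jacobi_theta (z + 1) \<tau> = - jacobi_theta z \<tau>"
proof -
  have "e2pi (- 1 / 2) (z + 1) = - e2pi (- 1 / 2) z"
    using e2pi_minus_left[of "1/2" 1] by (simp add: e2pi_add_right flip: minus_one_e2pi)
  then show ?thesis
    by (simp add: jacobi_theta_def Let_def e2pi_1_add_1)
qed

text \<open>Passing from \<open>\<zeta>\<close> to \<open>\<zeta>q\<close> removes the factor \<open>1 - \<zeta>\<close> from the first product and adds \<open>1 - 1/\<zeta>\<close> to the second.\<close>

lemma theta_add_tau:
  assumes "\<tau> \<in> upper_half_plane"
  shows "jacobi_theta (z + \<tau>) \<tau> = - e2pi (- 1 / 2) \<tau> * e2pi (- 1) z * jacobi_theta z \<tau>"
proof -
  define q \<zeta> where "q = e2pi 1 \<tau>" and "\<zeta> = e2pi 1 z"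
  have q: "norm q < 1" using norm_nome[OF assms] by (simp add: q_def)
  have nz: "q \<noteq> 0" "\<zeta> \<noteq> 0" by (auto simp: q_def \<zeta>_def)
  have e1: "e2pi 1 (z + \<tau>) = \<zeta> * q" by (simp add: q_def \<zeta>_def e2pi_add_right)
  have e2: "e2pi (- 1) z = inverse \<zeta>" unfolding \<zeta>_def by (rule e2pi_minus_left)
  have "qpoch_inf (\<zeta> * q) q * qpoch_inf (inverse \<zeta>) q
      = - inverse \<zeta> * (qpoch_inf \<zeta> q * qpoch_inf (inverse \<zeta> * q) q)"
    unfolding qpoch_shift[OF q, of \<zeta>] qpoch_shift[OF q, of "inverse \<zeta>"]
    using nz by (simp add: field_simps)
  note E = this
  have iq: "inverse (\<zeta> * q) * q = inverse \<zeta>" using nz by (simp add: field_simps)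
  show ?thesis
    unfolding jacobi_theta_def Let_def e1 q_def[symmetric] \<zeta>_def[symmetric] e2 e2pi_add_right[of "-1/2"] iq
    by (simp only: mult.assoc E) (simp add: algebra_simps)
qed

lemma theta_add_nat_tau:
  assumes "\<tau> \<in> upper_half_plane"
  shows "jacobi_theta (z + of_nat m * \<tau>) \<tau>
    = e2pi (real m / 2) 1 * e2pi (- ((real m)\<^sup>2 / 2)) \<tau> * e2pi (- real m) z * jacobi_theta z \<tau>"
proof (induction m)
  case (Suc m)
  have "jacobi_theta (z + of_nat (Suc m) * \<tau>) \<tau> = jacobi_theta ((z + of_nat m * \<tau>) + \<tau>) \<tau>"
    by (simp add: algebra_simps)
  also have "\<dots> = e2pi (1/2) 1 * e2pi (- 1 / 2) \<tau> * e2pi (- 1) (z + of_nat m * \<tau>) *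
      (e2pi (real m / 2) 1 * e2pi (- ((real m)\<^sup>2 / 2)) \<tau> * e2pi (- real m) z) * jacobi_theta z \<tau>"
    unfolding theta_add_tau[OF assms] Suc.IH by (simp flip: minus_one_e2pi)
  also have "e2pi (1/2) 1 * e2pi (- 1 / 2) \<tau> * e2pi (- 1) (z + of_nat m * \<tau>) *
      (e2pi (real m / 2) 1 * e2pi (- ((real m)\<^sup>2 / 2)) \<tau> * e2pi (- real m) z)
      = e2pi (real (Suc m) / 2) 1 * e2pi (- ((real (Suc m))\<^sup>2 / 2)) \<tau> * e2pi (- real (Suc m)) z"
    unfolding e2pi_def exp_add[symmetric]
    by (rule arg_cong[of _ _ exp]) (simp add: field_simps power2_eq_square)
  finally show ?case .
qed simp

lemma theta_add_tau_multiple: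
  assumes "\<tau> \<in> upper_half_plane"
  shows "jacobi_theta (z + of_int m * \<tau>) \<tau>
    = e2pi (of_int m / 2) 1 * e2pi (- ((of_int m)\<^sup>2 / 2)) \<tau> * e2pi (- of_int m) z * jacobi_theta z \<tau>"
proof (cases "m \<ge> 0")
  case True
  then show ?thesis using theta_add_nat_tau[OF assms, of z "nat m"] by simp
next
  case False
  define k where "k = nat (- m)"
  have k: "m = - int k" using False by (simp add: k_def)
  have "jacobi_theta z \<tau> = e2pi (real k / 2) 1 * e2pi (- ((real k)\<^sup>2 / 2)) \<tau> * e2pi (- real k) (z + of_int m * \<tau>)
       * jacobi_theta (z + of_int m * \<tau>) \<tau>"
    using theta_add_nat_tau[OF assms, of "z + of_int m * \<tau>" k] by (simp add: k)
  moreover have "e2pi (of_int m / 2) 1 * e2pi (- ((of_int m)\<^sup>2 / 2)) \<tau> * e2pi (- of_int m) z *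
     (e2pi (real k / 2) 1 * e2pi (- ((real k)\<^sup>2 / 2)) \<tau> * e2pi (- real k) (z + of_int m * \<tau>)) = 1"
    unfolding e2pi_def exp_add[symmetric] k
    by (simp add: field_simps power2_eq_square)
  ultimately show ?thesis by (subst \<open>jacobi_theta z \<tau> = _\<close>) (simp only: mult.assoc[symmetric] mult_1)
qed

lemma theta_add_int:
  "jacobi_theta (z + of_int n) \<tau> = e2pi (of_int n / 2) 1 * jacobi_theta z \<tau>"
proof -
  have nat: "jacobi_theta (z + of_nat n) \<tau> = e2pi (of_nat n / 2) 1 * jacobi_theta z \<tau>" for n z
  proof (induction n)
    case (Suc n)
    have "jacobi_theta (z + of_nat (Suc n)) \<tau> = jacobi_theta ((z + of_nat n) + 1) \<tau>"
      by (simp add: algebra_simps)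
    also have "\<dots> = (e2pi (1/2) 1 * e2pi (of_nat n / 2) 1) * jacobi_theta z \<tau>"
      unfolding theta_add_1 Suc.IH by (simp flip: minus_one_e2pi)
    also have "e2pi (1/2) 1 * e2pi (of_nat n / 2) 1 = e2pi (of_nat (Suc n) / 2) 1"
      by (simp add: add_divide_distrib flip: e2pi_add_left)
    finally show ?case .
  qed simp
  show ?thesis
  proof (cases "n \<ge> 0")
    case True
    then show ?thesis using nat[of z "nat n"] by simp
  next
    case False
    define k where "k = nat (- n)"
    have k: "n = - int k" using False by (simp add: k_def)
    have "jacobi_theta z \<tau> = e2pi (of_nat k / 2) 1 * jacobi_theta (z + of_int n) \<tau>"
      using nat[of "z + of_int n" k] by (simp add: k)
    moreover have "e2pi (of_int n / 2) 1 * e2pi (of_nat k / 2) 1 = 1"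
      by (simp add: k flip: e2pi_add_left)
    ultimately show ?thesis by (subst \<open>jacobi_theta z \<tau> = _\<close>) (simp only: mult.assoc[symmetric] mult_1)
  qed
qed

lemma theta_eq_0_iff:
  assumes "\<tau> \<in> upper_half_plane"
  shows "jacobi_theta z \<tau> = 0 \<longleftrightarrow> z \<in> theta_lattice \<tau>"
proof
  define q \<zeta> where "q = e2pi 1 \<tau>" and "\<zeta> = e2pi 1 z"
  have q: "norm q < 1" "q \<noteq> 0" using norm_nome[OF assms] by (simp_all add: q_def)
  assume "jacobi_theta z \<tau> = 0"
  moreover have "qpoch_inf q q \<noteq> 0" using q by (intro qpoch_nonzero) auto
  ultimately have "qpoch_inf \<zeta> q = 0 \<or> qpoch_inf (inverse \<zeta> * q) q = 0"
    by (auto simp: jacobi_theta_def Let_def q_def \<zeta>_def)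
  then obtain m :: int where "e2pi 1 (z - of_int m * \<tau>) = 1"
  proof
    assume "qpoch_inf \<zeta> q = 0"
    then obtain j where "\<zeta> * q ^ j = 1" using qpoch_eq_0_iff q by blast
    then have "e2pi 1 (z - of_int (- int j) * \<tau>) = 1"
      by (simp add: \<zeta>_def q_def e2pi_add_right) (simp add: e2pi_def mult_ac flip: exp_of_nat_mult)
    then show ?thesis using that by blast
  next
    assume "qpoch_inf (inverse \<zeta> * q) q = 0"
    then obtain j where "inverse \<zeta> * q * q ^ j = 1" using qpoch_eq_0_iff q by blast
    then have "\<zeta> * inverse (q ^ Suc j) = 1" using q by (simp add: field_simps \<zeta>_def)
    moreover have "inverse (q ^ Suc j) = e2pi 1 (- (of_nat (Suc j) * \<tau>))"
      unfolding q_def e2pi_power e2pi_minus_right by (simp add: e2pi_def mult_ac)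
    ultimately have "e2pi 1 (z + - (of_nat (Suc j) * \<tau>)) = 1"
      unfolding \<zeta>_def e2pi_add_right by metis
    then have "e2pi 1 (z - of_int (int (Suc j)) * \<tau>) = 1"
      by simp
    then show ?thesis using that by blast
  qed
  then obtain n where "z - of_int m * \<tau> = of_int n"
    unfolding e2pi_1_eq_1_iff by (auto simp: Ints_def)
  then have "z = of_int m * \<tau> + of_int n" by (simp add: algebra_simps)
  then show "z \<in> theta_lattice \<tau>" by (auto simp: theta_lattice_def)
next
  assume "z \<in> theta_lattice \<tau>"
  then obtain m n where z: "z = of_int m * \<tau> + of_int n" by (auto simp: theta_lattice_def)
  have "qpoch_inf 1 (e2pi 1 \<tau>) = 0" using qpoch_eq_0_iff[OF norm_nome[OF assms]] by (metis mult.left_neutral power_0)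
  then have "jacobi_theta 0 \<tau> = 0" by (simp add: jacobi_theta_def)
  then show "jacobi_theta z \<tau> = 0"
    using theta_add_int[of "0 + of_int m * \<tau>" n \<tau>] theta_add_tau_multiple[OF assms, of 0 m] by (simp add: z)
qed

text \<open>The first factor \<open>1 - \<zeta>\<close> of the product for \<open>\<theta>\<close> carries the zero at \<open>z = 0\<close>. Dividing it out by hand gives an explicit
formula for the entire function \<open>\<theta>(z)/z\<close>, from which its zeros, its continuity in \<open>(z, \<tau>)\<close> and bounds can be read
off.\<close>

definition exp_quotient :: "complex \<Rightarrow> complex" where
  "exp_quotient z = (if z = 0 then - (2 * of_real pi * \<i>) else (1 - e2pi 1 z) / z)"

definition theta_over_z :: "complex \<Rightarrow> complex \<Rightarrow> complex" where
  "theta_over_z z \<tau> = - \<i> * e2pi (- 1 / 2) z * e2pi (1 / 8) \<tau> * qpoch_inf (e2pi 1 \<tau>) (e2pi 1 \<tau>) * exp_quotient z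
     * qpoch_inf (e2pi 1 z * e2pi 1 \<tau>) (e2pi 1 \<tau>) * qpoch_inf (inverse (e2pi 1 z) * e2pi 1 \<tau>) (e2pi 1 \<tau>)"

lemma exp_quotient_holomorphic: "exp_quotient holomorphic_on UNIV"
proof -
  have "((\<lambda>z. 1 - e2pi 1 z) has_field_derivative - (2 * of_real pi * \<i>)) (at 0)"
    unfolding e2pi_def by (auto intro!: derivative_eq_intros)
  then have "(\<lambda>z. (1 - e2pi 1 z) / z) \<midarrow>0\<rightarrow> - (2 * of_real pi * \<i>)"
    by (simp add: DERIV_def)
  then have "exp_quotient \<midarrow>0\<rightarrow> - (2 * of_real pi * \<i>)"
    by (rule Lim_transform_eventually) (auto simp: eventually_at_filter exp_quotient_def)
  then have "isCont exp_quotient 0"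
    by (simp add: isCont_def exp_quotient_def)
  moreover have hol: "exp_quotient holomorphic_on UNIV - {0}"
  proof (rule holomorphic_transform)
    show "(\<lambda>z. (1 - e2pi 1 z) / z) holomorphic_on UNIV - {0}" by (intro holomorphic_intros) auto
  qed (auto simp: exp_quotient_def)
  ultimately have "continuous_on UNIV exp_quotient"
    using holomorphic_on_imp_continuous_on[OF hol]
    by (metis continuous_at_imp_continuous_on continuous_on_eq_continuous_at open_delete open_UNIV DiffI UNIV_I singletonD)
  then show ?thesis using hol by (intro no_isolated_singularity[of UNIV _ "{0}"]) auto
qed

lemma theta_eq_z_times:
  assumes "\<tau> \<in> upper_half_plane"
  shows "jacobi_theta z \<tau> = z * theta_over_z z \<tau>"
proof -
  have "qpoch_inf (e2pi 1 z) (e2pi 1 \<tau>) = z * exp_quotient z * qpoch_inf (e2pi 1 z * e2pi 1 \<tau>) (e2pi 1 \<tau>)"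
    by (subst qpoch_shift[OF norm_nome[OF assms]]) (simp add: exp_quotient_def)
  then show ?thesis by (simp add: jacobi_theta_def theta_over_z_def Let_def mult_ac)
qed

text \<open>This is \<open>\<theta>'(0)\<close>, that is, \<open>-2\<pi>\<close> times the cube of the Dedekind eta function.\<close>

lemma theta_over_z_0:
  "theta_over_z 0 \<tau> = - 2 * of_real pi * e2pi (1 / 8) \<tau> * qpoch_inf (e2pi 1 \<tau>) (e2pi 1 \<tau>) ^ 3"
  by (simp add: theta_over_z_def exp_quotient_def power3_eq_cube algebra_simps)

lemma theta_over_z_nonzero:
  assumes "\<tau> \<in> upper_half_plane" "z \<notin> theta_lattice \<tau> - {0}"
  shows "theta_over_z z \<tau> \<noteq> 0"
proof (cases "z = 0")
  case True
  have "qpoch_inf (e2pi 1 \<tau>) (e2pi 1 \<tau>) \<noteq> 0" using norm_nome[OF assms(1)] by (intro qpoch_nonzero) auto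
  then show ?thesis using True by (simp add: theta_over_z_0)
next
  case False
  then show ?thesis using theta_eq_0_iff[OF assms(1), of z] theta_eq_z_times[OF assms(1), of z] assms(2) by auto
qed

lemma theta_over_z_holomorphic: 
  assumes "\<tau> \<in> upper_half_plane"
  shows "(\<lambda>z. theta_over_z z \<tau>) holomorphic_on UNIV"
  unfolding theta_over_z_def
  by (intro holomorphic_intros exp_quotient_holomorphic) (auto simp: norm_nome assms)

lemma theta_holomorphic:
  assumes "\<tau> \<in> upper_half_plane"
  shows "(\<lambda>z. jacobi_theta z \<tau>) holomorphic_on UNIV"
  unfolding theta_eq_z_times[OF assms] by (intro holomorphic_intros theta_over_z_holomorphic assms)

lemma open_upper_half_plane [simp]: "open upper_half_plane"
  unfolding upper_half_plane_def by (rule open_halfspace_Im_gt)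

lemma convex_upper_half_plane: "convex upper_half_plane"
  unfolding upper_half_plane_def by (rule convex_halfspace_Im_gt)

lemma theta_over_z_holomorphic_tau: "(\<lambda>\<tau>. theta_over_z z \<tau>) holomorphic_on upper_half_plane"
  unfolding theta_over_z_def by (intro holomorphic_intros) (auto simp: norm_nome)

lemma theta_holomorphic_tau: "(\<lambda>\<tau>. jacobi_theta z \<tau>) holomorphic_on upper_half_plane"
  unfolding jacobi_theta_def Let_def by (intro holomorphic_intros) (auto simp: norm_nome)

lemma theta_over_z_continuous:
  assumes "continuous_on S f" "continuous_on S g" "\<And>x. x \<in> S \<Longrightarrow> g x \<in> upper_half_plane"
  shows "continuous_on S (\<lambda>x. theta_over_z (f x) (g x))"
proof -
  have "continuous_on S (\<lambda>x. exp_quotient (f x))"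
    by (rule continuous_on_compose2[OF holomorphic_on_imp_continuous_on[OF exp_quotient_holomorphic] assms(1)]) auto
  then show ?thesis
    unfolding theta_over_z_def by (intro continuous_intros assms) (use assms(3) norm_nome in auto)
qed

lemma theta_continuous:
  assumes "continuous_on S f" "continuous_on S g" "\<And>x. x \<in> S \<Longrightarrow> g x \<in> upper_half_plane"
  shows "continuous_on S (\<lambda>x. jacobi_theta (f x) (g x))"
  unfolding jacobi_theta_def Let_def by (intro continuous_intros assms) (use assms(3) norm_nome in auto)

section \<open>The invariant absolute value\<close>

text \<open>The Gaussian factor compensates the factor \<open>|q^(-1/2) \<zeta>^(-1)|\<close> that \<open>|\<theta>|\<close> acquires under \<open>z \<mapsto> z + \<tau>\<close>. The result is
a genuine function on the complex torus.\<close>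

definition theta_abs :: "complex \<Rightarrow> complex \<Rightarrow> real" where
  "theta_abs z \<tau> = norm (jacobi_theta z \<tau>) * exp (- (pi * (Im z)\<^sup>2 / Im \<tau>))"

lemma theta_abs_lattice:
  assumes "\<tau> \<in> upper_half_plane"
  shows "theta_abs (z + of_int m * \<tau> + of_int n) \<tau> = theta_abs z \<tau>"
proof -
  have y: "Im \<tau> \<noteq> 0" using assms by (auto simp: upper_half_plane_def)
  have "theta_abs (z + of_int m * \<tau> + of_int n) \<tau> = norm (jacobi_theta z \<tau>) *
     (exp (pi * (of_int m)\<^sup>2 * Im \<tau>) * exp (2 * pi * of_int m * Im z) * exp (- (pi * (Im z + of_int m * Im \<tau>)\<^sup>2 / Im \<tau>)))"
    unfolding theta_abs_def theta_add_int theta_add_tau_multiple[OF assms]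
    by (simp add: norm_mult norm_e2pi)
  also have "exp (pi * (of_int m)\<^sup>2 * Im \<tau>) * exp (2 * pi * of_int m * Im z) * exp (- (pi * (Im z + of_int m * Im \<tau>)\<^sup>2 / Im \<tau>))
     = exp (- (pi * (Im z)\<^sup>2 / Im \<tau>))"
    unfolding exp_add[symmetric] using y by (simp add: field_simps power2_eq_square)
  finally show ?thesis by (simp add: theta_abs_def)
qed

text \<open>At the half periods the product for \<open>\<theta>\<close> reduces to the products in \<open>-q\<close> and \<open>\<plusminus>q^(1/2)\<close>, whose product is \<open>1\<close> by
Euler's identity. What is left is \<open>(q; q)^3\<close> up to elementary factors, as in \<open>\<theta>'(0)\<close>. This is the absolute value
of Jacobi's derivative formula.\<close>

lemma theta_abs_half_periods:
  assumes "\<tau> \<in> upper_half_plane"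
  shows "pi * (theta_abs (1 / 2) \<tau> * theta_abs (\<tau> / 2) \<tau> * theta_abs ((1 + \<tau>) / 2) \<tau>) = norm (theta_over_z 0 \<tau>)"
proof -
  define p where "p = e2pi (1 / 2) \<tau>"
  define Q where "Q = qpoch_inf (p^2) (p^2)"
  have y: "Im \<tau> > 0" using assms by (auto simp: upper_half_plane_def)
  have p2: "e2pi 1 \<tau> = p^2" by (simp add: p_def e2pi_power)
  have p: "norm p < 1" using y by (simp add: p_def norm_e2pi)
  have q: "norm (p^2) < 1" using norm_nome[OF assms] by (simp add: p2)
  have p0: "p \<noteq> 0" by (simp add: p_def)
  have half: "e2pi 1 (1 / 2) = - 1" by (simp add: e2pi_def)
  have e\<tau>: "e2pi 1 (\<tau> / 2) = p" by (simp add: p_def e2pi_def mult_ac)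
  have e\<tau>1: "e2pi 1 ((1 + \<tau>) / 2) = - p"
    by (simp add: add_divide_distrib e2pi_add_right half e\<tau>)
  have ip: "inverse p * p\<^sup>2 = p" "inverse (- p) * p\<^sup>2 = - p" using p0 by (simp_all add: power2_eq_square)
  have sh: "qpoch_inf (- 1) (p^2) = 2 * qpoch_inf (- (p^2)) (p^2)"
    by (subst qpoch_shift[OF q]) simp
  have 1: "theta_abs (1 / 2) \<tau> = 2 * exp (- (pi * Im \<tau> / 4)) * norm Q * norm (qpoch_inf (- (p^2)) (p^2)) ^ 2"
    unfolding theta_abs_def jacobi_theta_def Let_def half p2 sh
    by (simp add: norm_mult norm_e2pi Q_def power2_eq_square)
  have 2: "theta_abs (\<tau> / 2) \<tau> = norm Q * norm (qpoch_inf p (p^2)) ^ 2"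
  proof -
    have "exp (pi * Im \<tau> / 2) * exp (- (pi * Im \<tau> / 4)) * exp (- (pi * (Im \<tau> / 2)\<^sup>2 / Im \<tau>)) = 1"
      unfolding exp_add[symmetric] using y by (simp add: field_simps power2_eq_square)
    then show ?thesis
      unfolding theta_abs_def jacobi_theta_def Let_def p2 e\<tau> ip
      by (simp add: norm_mult norm_e2pi Q_def power2_eq_square mult_ac)
  qed
  have 3: "theta_abs ((1 + \<tau>) / 2) \<tau> = norm Q * norm (qpoch_inf (- p) (p^2)) ^ 2"
  proof -
    have "exp (pi * Im \<tau> / 2) * exp (- (pi * Im \<tau> / 4)) * exp (- (pi * (Im \<tau> / 2)\<^sup>2 / Im \<tau>)) = 1"
      unfolding exp_add[symmetric] using y by (simp add: field_simps power2_eq_square)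
    then show ?thesis
      unfolding theta_abs_def jacobi_theta_def Let_def p2 e\<tau>1 ip
      by (simp add: norm_mult norm_e2pi Q_def power2_eq_square mult_ac)
  qed
  have "norm (qpoch_inf (- (p^2)) (p^2) * qpoch_inf p (p^2) * qpoch_inf (- p) (p^2)) = 1"
    unfolding qpoch_sqrt_product[OF p] by simp
  then have n1: "(norm (qpoch_inf (- (p^2)) (p^2)) * norm (qpoch_inf p (p^2)) * norm (qpoch_inf (- p) (p^2)))^2 = 1"
    by (simp add: norm_mult)
  have "pi * (theta_abs (1 / 2) \<tau> * theta_abs (\<tau> / 2) \<tau> * theta_abs ((1 + \<tau>) / 2) \<tau>)
     = 2 * pi * exp (- (pi * Im \<tau> / 4)) * norm Q ^ 3 *
       (norm (qpoch_inf (- (p^2)) (p^2)) * norm (qpoch_inf p (p^2)) * norm (qpoch_inf (- p) (p^2)))^2"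
    unfolding 1 2 3 by (simp add: power2_eq_square power3_eq_cube)
  also have "\<dots> = norm (theta_over_z 0 \<tau>)"
    unfolding n1 theta_over_z_0 p2 by (simp add: norm_mult norm_power norm_e2pi Q_def)
  finally show ?thesis .
qed

section \<open>Moebius transformations\<close>

definition mob_denom :: "int ^ 2 ^ 2 \<Rightarrow> complex \<Rightarrow> complex" where
  "mob_denom A \<tau> = of_int (A $ 2 $ 1) * \<tau> + of_int (A $ 2 $ 2)"

lemma aut_factor_denom: "aut_factor k A \<tau> = mob_denom A \<tau> powr of_real k"
  by (simp add: aut_factor_def mob_denom_def)

lemma SL2Z_det:
  assumes "A \<in> carrier SL2Z"
  shows "A $ 1 $ 1 * A $ 2 $ 2 - A $ 1 $ 2 * A $ 2 $ 1 = 1"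
  using assms by (simp add: SL2Z_def det_2)

lemma mob_denom_nonzero:
  assumes "A \<in> carrier SL2Z" "\<tau> \<in> upper_half_plane"
  shows "mob_denom A \<tau> \<noteq> 0"
proof
  assume 0: "mob_denom A \<tau> = 0"
  then have "Im (mob_denom A \<tau>) = 0" by simp
  then have "A $ 2 $ 1 = 0" using assms(2) by (simp add: mob_denom_def upper_half_plane_def)
  moreover from this have "A $ 2 $ 2 = 0" using 0 by (simp add: mob_denom_def)
  ultimately show False using SL2Z_det[OF assms(1)] by simp
qed

text \<open>The determinant enters here as the numerator; the same formula shows that the upper half plane is preserved.\<close>

lemma Im_mob:
  assumes "A \<in> carrier SL2Z" "\<tau> \<in> upper_half_plane"
  shows "Im (mob A \<tau>) = Im \<tau> / (norm (mob_denom A \<tau>))\<^sup>2"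
proof -
  have "real_of_int (A $ 1 $ 1 * A $ 2 $ 2 - A $ 1 $ 2 * A $ 2 $ 1) = 1"
    using SL2Z_det[OF assms(1)] by simp
  then have d: "real_of_int (A $ 1 $ 1) * real_of_int (A $ 2 $ 2) - real_of_int (A $ 1 $ 2) * real_of_int (A $ 2 $ 1) = 1"
    by simp
  have "Im (mob A \<tau>) = Im \<tau> * (real_of_int (A $ 1 $ 1) * real_of_int (A $ 2 $ 2) - real_of_int (A $ 1 $ 2) * real_of_int (A $ 2 $ 1)) / (norm (mob_denom A \<tau>))\<^sup>2"
    unfolding mob_def mob_denom_def[symmetric]
    by (simp add: Im_divide cmod_power2) (simp add: mob_denom_def algebra_simps)
  then show ?thesis using d by simp
qed

lemma mob_upper_half_plane:
  assumes "A \<in> carrier SL2Z" "\<tau> \<in> upper_half_plane"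
  shows "mob A \<tau> \<in> upper_half_plane"
  using Im_mob[OF assms] mob_denom_nonzero[OF assms] assms(2) by (simp add: upper_half_plane_def)

lemma mob_times_denom: 
  assumes "A \<in> carrier SL2Z" "\<tau> \<in> upper_half_plane"
  shows "mob A \<tau> * mob_denom A \<tau> = of_int (A $ 1 $ 1) * \<tau> + of_int (A $ 1 $ 2)"
  using mob_denom_nonzero[OF assms] by (simp add: mob_def mob_denom_def)

lemma mob_denom_mult:
  assumes "A \<in> carrier SL2Z" "B \<in> carrier SL2Z" "\<tau> \<in> upper_half_plane"
  shows "mob_denom (A ** B) \<tau> = mob_denom A (mob B \<tau>) * mob_denom B \<tau>"
proof -
  have "mob_denom A (mob B \<tau>) * mob_denom B \<tau> = of_int (A $ 2 $ 1) * (mob B \<tau> * mob_denom B \<tau>) + of_int (A $ 2 $ 2) * mob_denom B \<tau>"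
    by (simp add: mob_denom_def algebra_simps)
  also have "\<dots> = mob_denom (A ** B) \<tau>"
    unfolding mob_times_denom[OF assms(2,3)] by (simp add: mob_denom_def matrix_matrix_mult_def sum_2 algebra_simps)
  finally show ?thesis by simp
qed

lemma mob_mult:
  assumes "A \<in> carrier SL2Z" "B \<in> carrier SL2Z" "A ** B \<in> carrier SL2Z" "\<tau> \<in> upper_half_plane"
  shows "mob (A ** B) \<tau> = mob A (mob B \<tau>)"
proof -
  have "mob A (mob B \<tau>) * mob_denom (A ** B) \<tau> = (mob A (mob B \<tau>) * mob_denom A (mob B \<tau>)) * mob_denom B \<tau>"
    unfolding mob_denom_mult[OF assms(1,2,4)] by simp
  also have "\<dots> = of_int (A $ 1 $ 1) * (mob B \<tau> * mob_denom B \<tau>) + of_int (A $ 1 $ 2) * mob_denom B \<tau>"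
    unfolding mob_times_denom[OF assms(1) mob_upper_half_plane[OF assms(2,4)]] by (simp add: algebra_simps)
  also have "\<dots> = mob (A ** B) \<tau> * mob_denom (A ** B) \<tau>"
    unfolding mob_times_denom[OF assms(2,4)] mob_times_denom[OF assms(3,4)]
    by (simp add: mob_denom_def matrix_matrix_mult_def sum_2 algebra_simps)
  finally show ?thesis using mob_denom_nonzero[OF assms(3,4)] by simp
qed

section \<open>Modular transformation of the theta function\<close>

text \<open>The quotient is bounded wherever it is defined. Its singularities are isolated because the zeros of a non-zero
entire function are, hence they are removable, and Liouville's theorem applies.\<close>

lemma entire_quotient_constant:
  assumes n: "n holomorphic_on UNIV" and d: "d holomorphic_on UNIV"
    and le: "\<And>z. norm (n z) \<le> B * norm (d z)" and nz: "d z0 \<noteq> 0"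
  shows "\<exists>C. \<forall>z. n z = C * d z"
proof -
  define f where "f = (\<lambda>z. n z / d z)"
  have punctured: "\<exists>r>0. \<forall>w\<in>ball z r - {z}. d w \<noteq> 0" for z
  proof (cases "d z = 0")
    case True
    obtain r where "0 < r" "\<And>w. w \<in> ball z r - {z} \<Longrightarrow> d w \<noteq> 0"
      by (rule isolated_zeros[OF d open_UNIV connected_UNIV UNIV_I True UNIV_I nz]) blast
    then show ?thesis by blast
  next
    case False
    have "continuous_on UNIV d" using d by (rule holomorphic_on_imp_continuous_on)
    then have "isCont d z" by (simp add: continuous_on_eq_continuous_at)
    then obtain r where "r > 0" "\<forall>w. dist z w < r \<longrightarrow> d w \<noteq> 0"
      using continuous_at_avoid[of z d 0] False by auto
    then show ?thesis by (intro exI[of _ r]) auto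
  qed
  have bnd: "norm (f z) \<le> \<bar>B\<bar>" for z
  proof (cases "d z = 0")
    case False
    then show ?thesis using le[of z] by (simp add: f_def norm_divide divide_le_eq) (smt (verit) mult_right_mono norm_ge_zero)
  qed (auto simp: f_def)
  have lim: "\<exists>g. \<exists>r>0. g holomorphic_on ball z r \<and> (\<forall>w\<in>ball z r - {z}. g w = f w)" for z
  proof -
    obtain r where r: "r > 0" "\<forall>w\<in>ball z r - {z}. d w \<noteq> 0" using punctured by blast
    have hol: "f holomorphic_on ball z r - {z}"
      unfolding f_def using r(2)
      by (intro holomorphic_intros holomorphic_on_subset[OF n] holomorphic_on_subset[OF d]) auto
    have "\<exists>g. g holomorphic_on ball z r \<and> (\<forall>w\<in>ball z r - {z}. g w = f w)"
      using r(1) bnd by (subst holomorphic_on_extend_bounded[OF hol]) (auto intro!: always_eventually)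
    then show ?thesis using r(1) by blast
  qed
  have ana: "remove_sings f analytic_on {z}" and bnd': "norm (remove_sings f z) \<le> \<bar>B\<bar>" for z
  proof -
    obtain g r where g: "r > 0" "g holomorphic_on ball z r" "\<And>w. w\<in>ball z r - {z} \<Longrightarrow> g w = f w" using lim by metis
    have "f holomorphic_on ball z r - {z}"
      by (rule holomorphic_transform[of g]) (use g in \<open>auto intro: holomorphic_on_subset\<close>)
    then have iso: "isolated_singularity_at f z"
      using g(1) by (intro isolated_singularity_at_holomorphic[of _ "ball z r"]) auto
    have "continuous_on (ball z r) g" using g(2) by (rule holomorphic_on_imp_continuous_on)
    then have "g \<midarrow>z\<rightarrow> g z" using g(1) by (simp add: continuous_on_eq_continuous_at isContD)
    then have l: "f \<midarrow>z\<rightarrow> g z"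
      by (rule Lim_transform_within_open[OF _ open_ball[of z r]]) (use g in auto)
    show "remove_sings f analytic_on {z}" using remove_sings_analytic_at[OF iso l] .
    have "norm (g z) \<le> \<bar>B\<bar>"
      by (rule Lim_norm_ubound[OF _ l]) (use bnd in auto)
    then show "norm (remove_sings f z) \<le> \<bar>B\<bar>" using remove_sings_eqI[OF l] by simp
  qed
  have "remove_sings f holomorphic_on UNIV"
    by (rule analytic_imp_holomorphic) (use ana analytic_on_analytic_at in blast)
  moreover have "bounded (range (remove_sings f))"
    using bnd' by (auto simp: bounded_iff)
  ultimately obtain C where C: "\<And>z. remove_sings f z = C"
    using Liouville_theorem by (metis UNIV_I constant_on_def)
  have "n z = C * d z" for z
  proof (cases "d z = 0")
    case True
    then show ?thesis using le[of z] by simp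
  next
    case False
    then obtain r where r: "r > 0" "\<forall>w\<in>ball z r. d w \<noteq> 0" using punctured[of z] by (metis DiffI singletonD)
    have "f holomorphic_on ball z r"
      unfolding f_def using r(2)
      by (intro holomorphic_intros holomorphic_on_subset[OF n] holomorphic_on_subset[OF d]) auto
    then have "f analytic_on {z}" using r(1) by (meson analytic_at centre_in_ball open_ball)
    then have "f z = C" using C[of z] by simp
    then show ?thesis using False by (simp add: f_def field_simps)
  qed
  then show ?thesis by blast
qed

lemma theta_abs_lattice':
  assumes "\<tau> \<in> upper_half_plane" "w \<in> theta_lattice \<tau>"
  shows "theta_abs (z + w) \<tau> = theta_abs z \<tau>"
  using theta_abs_lattice[OF assms(1), of z] assms(2)
  by (auto simp: theta_lattice_def add.assoc)

text \<open>The inverse matrix, which is again integral, gives the coordinates of \<open>w/(c\<tau> + d)\<close> with respect to the new basis.\<close>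

lemma theta_lattice_transform:
  assumes A: "A \<in> carrier SL2Z" and \<tau>: "\<tau> \<in> upper_half_plane" and w: "w \<in> theta_lattice \<tau>"
  shows "w / mob_denom A \<tau> \<in> theta_lattice (mob A \<tau>)"
proof -
  obtain m n where w: "w = of_int m * \<tau> + of_int n" using w by (auto simp: theta_lattice_def)
  define m' n' where "m' = m * A$2$2 - n * A$2$1" and "n' = n * A$1$1 - m * A$1$2"
  have d: "A $ 1 $ 1 * A $ 2 $ 2 = 1 + A $ 1 $ 2 * A $ 2 $ 1" using SL2Z_det[OF A] by simp
  have "m' * A$1$1 + n' * A$2$1 = m * (A $ 1 $ 1 * A $ 2 $ 2 - A $ 1 $ 2 * A $ 2 $ 1)"
       "m' * A$1$2 + n' * A$2$2 = n * (A $ 1 $ 1 * A $ 2 $ 2 - A $ 1 $ 2 * A $ 2 $ 1)"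
    by (simp_all add: m'_def n'_def algebra_simps)
  then have mn: "m = m' * A$1$1 + n' * A$2$1" "n = m' * A$1$2 + n' * A$2$2"
    using SL2Z_det[OF A] by simp_all
  have "w = of_int m' * (mob A \<tau> * mob_denom A \<tau>) + of_int n' * mob_denom A \<tau>"
    unfolding mob_times_denom[OF A \<tau>] w by (subst mn(1), subst mn(2)) (simp add: mob_denom_def algebra_simps)
  then have "w / mob_denom A \<tau> = of_int m' * mob A \<tau> + of_int n'"
    using mob_denom_nonzero[OF A \<tau>] by (simp add: field_simps)
  then show ?thesis by (auto simp: theta_lattice_def)
qed

text \<open>The difference of the two Gaussian exponents is the imaginary part of a holomorphic function of \<open>z\<close>. This is what
allows the invariant absolute values on both sides to be compared by a holomorphic factor.\<close>

lemma transform_gauge: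
  assumes A: "A \<in> carrier SL2Z" and \<tau>: "\<tau> \<in> upper_half_plane"
  shows "of_int (A $ 2 $ 1) * Im (z\<^sup>2 / mob_denom A \<tau>)
    = (Im z)\<^sup>2 / Im \<tau> - (Im (z / mob_denom A \<tau>))\<^sup>2 / Im (mob A \<tau>)"
proof -
  define c e y u w where "c = real_of_int (A $ 2 $ 1)" and "e = Re (mob_denom A \<tau>)" and "y = Im \<tau>"
    and "u = Re z" and "w = Im z"
  have y: "y > 0" using \<tau> by (simp add: y_def upper_half_plane_def)
  have J: "Re (mob_denom A \<tau>) = e" "Im (mob_denom A \<tau>) = c * y" by (auto simp: e_def c_def y_def mob_denom_def)
  define n where "n = e\<^sup>2 + (c * y)\<^sup>2"
  have n: "(norm (mob_denom A \<tau>))\<^sup>2 = n" by (simp add: n_def cmod_power2 J)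
  have n0: "n \<noteq> 0" using mob_denom_nonzero[OF A \<tau>] n by auto
  have 1: "Im (z / mob_denom A \<tau>) = (w * e - u * (c * y)) / n"
    by (simp add: Im_divide J n_def u_def w_def)
  have 2: "Im (z\<^sup>2 / mob_denom A \<tau>) = (2 * u * w * e - (u\<^sup>2 - w\<^sup>2) * (c * y)) / n"
    by (simp add: Im_divide J n_def u_def w_def power2_eq_square)
  have "((w * e - u * (c * y)) / n)\<^sup>2 / (y / n) = (w * e - u * (c * y))\<^sup>2 / (n * y)"
    using n0 y by (simp add: field_simps power2_eq_square)
  moreover have "w\<^sup>2 / y - X / (n * y) = (w\<^sup>2 * n - X) / (n * y)" for X
    using n0 y by (simp add: field_simps)
  ultimately have "w\<^sup>2 / y - ((w * e - u * (c * y)) / n)\<^sup>2 / (y / n) = (w\<^sup>2 * n - (w * e - u * (c * y))\<^sup>2) / (n * y)"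
    by simp
  also have "w\<^sup>2 * n - (w * e - u * (c * y))\<^sup>2 = (c * (2 * u * w * e - (u\<^sup>2 - w\<^sup>2) * (c * y))) * y"
    by (simp add: n_def power2_eq_square algebra_simps)
  also have "\<dots> / (n * y) = c * ((2 * u * w * e - (u\<^sup>2 - w\<^sup>2) * (c * y)) / n)"
    using y by simp
  finally show ?thesis
    unfolding 1 2 Im_mob[OF A \<tau>] n c_def[symmetric] y_def[symmetric] w_def[symmetric] by simp
qed

lemma theta_abs_transform_gauge:
  assumes A: "A \<in> carrier SL2Z" and \<tau>: "\<tau> \<in> upper_half_plane"
  shows "norm (jacobi_theta (z / mob_denom A \<tau>) (mob A \<tau>) * e2pi (- of_int (A $ 2 $ 1) / 2) (z\<^sup>2 / mob_denom A \<tau>))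
    = theta_abs (z / mob_denom A \<tau>) (mob A \<tau>) * exp (pi * (Im z)\<^sup>2 / Im \<tau>)"
proof -
  have "- (2 * pi * (- of_int (A $ 2 $ 1) / 2) * Im (z\<^sup>2 / mob_denom A \<tau>)) = pi * (of_int (A $ 2 $ 1) * Im (z\<^sup>2 / mob_denom A \<tau>))"
    by simp
  also have "\<dots> = - (pi * (Im (z / mob_denom A \<tau>))\<^sup>2 / Im (mob A \<tau>)) + pi * (Im z)\<^sup>2 / Im \<tau>"
    unfolding transform_gauge[OF A \<tau>] by (simp add: algebra_simps)
  finally show ?thesis
    unfolding norm_mult norm_e2pi theta_abs_def by (simp only: exp_add mult.assoc)
qed

text \<open>Both sides are invariant under the lattice, so it suffices to look at a fundamental parallelogram centred at \<open>0\<close>.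
There both sides vanish only at \<open>0\<close>, to first order; after division by \<open>|z|\<close> the quotient is continuous on a compact
set.\<close>

lemma theta_transform_bounded:
  assumes A: "A \<in> carrier SL2Z" and \<tau>: "\<tau> \<in> upper_half_plane"
  shows "\<exists>B. \<forall>z. theta_abs (z / mob_denom A \<tau>) (mob A \<tau>) \<le> B * theta_abs z \<tau>"
proof -
  define J where "J = mob_denom A \<tau>"
  have J: "J \<noteq> 0" using mob_denom_nonzero[OF A \<tau>] by (simp add: J_def)
  have A\<tau>: "mob A \<tau> \<in> upper_half_plane" by (rule mob_upper_half_plane[OF A \<tau>])
  have y: "Im \<tau> > 0" "Im (mob A \<tau>) > 0" using \<tau> A\<tau> by (auto simp: upper_half_plane_def)
  \<comment> \<open>the fundamental parallelogram centred at 0\<close>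
  define P where "P = (\<lambda>p. of_real (fst p) * \<tau> + of_real (snd p)) ` (cbox (- 1 / 2, - 1 / 2) (1 / 2, 1 / 2) :: (real \<times> real) set)"
  have "compact P" unfolding P_def
    by (intro compact_continuous_image continuous_intros compact_cbox)
  have nz: "theta_over_z z \<tau> \<noteq> 0" if "z \<in> P" for z
  proof (rule theta_over_z_nonzero[OF \<tau>], rule notI)
    assume z: "z \<in> theta_lattice \<tau> - {0}"
    then obtain m n where mn: "z = of_int m * \<tau> + of_int n" by (auto simp: theta_lattice_def)
    obtain p where p: "z = of_real (fst p) * \<tau> + of_real (snd p)" "p \<in> cbox (- 1 / 2, - 1 / 2) (1 / 2, 1 / 2)"
      using \<open>z \<in> P\<close> by (auto simp: P_def)
    define s t where "s = fst p" and "t = snd p"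
    have st: "z = of_real s * \<tau> + of_real t" "\<bar>s\<bar> \<le> 1/2" "\<bar>t\<bar> \<le> 1/2"
      using p by (cases p, auto simp: s_def t_def cbox_Pair_eq)+
    have "Im (of_real s * \<tau> + of_real t) = Im (of_int m * \<tau> + of_int n)" using mn st(1) by simp
    then have "s = of_int m" using y by simp
    with st(2) have "m = 0" by linarith
    with \<open>s = of_int m\<close> have m: "m = 0" "s = 0" by simp_all
    have "complex_of_real t = of_real (of_int n)" using mn st(1) m by simp
    then have "t = of_int n" by (simp only: of_real_eq_iff)
    with st(3) have "n = 0" by linarith
    with m mn z show False by simp
  qed
  define F where "F = (\<lambda>z. norm (theta_over_z (z / J) (mob A \<tau>)) * exp (- (pi * (Im (z / J))\<^sup>2 / Im (mob A \<tau>))) /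
      (norm J * norm (theta_over_z z \<tau>) * exp (- (pi * (Im z)\<^sup>2 / Im \<tau>))))"
  have "continuous_on P F" unfolding F_def
    by (intro continuous_intros theta_over_z_continuous) (use nz J y \<tau> A\<tau> in auto)
  then have "compact (F ` P)" using \<open>compact P\<close> by (rule compact_continuous_image)
  then obtain B where B: "\<And>z. z \<in> P \<Longrightarrow> norm (F z) \<le> B"
    by (meson bounded_iff compact_imp_bounded imageI)
  have "theta_abs (z / J) (mob A \<tau>) \<le> B * theta_abs z \<tau>" if "z \<in> P" for z
  proof -
    have "theta_abs (z / J) (mob A \<tau>) = F z * theta_abs z \<tau>"
      unfolding theta_abs_def theta_eq_z_times[OF \<tau>] theta_eq_z_times[OF A\<tau>] F_def using nz[OF that] J
      by (simp add: norm_mult norm_divide)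
    also have "\<dots> \<le> B * theta_abs z \<tau>"
      using B[OF that] by (intro mult_right_mono) (auto simp: theta_abs_def)
    finally show ?thesis .
  qed
  note onP = this
  have "theta_abs (z / J) (mob A \<tau>) \<le> B * theta_abs z \<tau>" for z
  proof -
    \<comment> \<open>the real coordinates of z with respect to the basis \<open>\<tau>, 1\<close>; rounding them moves z into P\<close>
    define s where "s = Im z / Im \<tau>"
    define t where "t = Re z - s * Re \<tau>"
    have z: "z = of_real s * \<tau> + of_real t"
      using y by (simp add: complex_eq_iff s_def t_def)
    define w where "w = of_int (round s) * \<tau> + of_int (round t)"
    have w: "w \<in> theta_lattice \<tau>" by (auto simp: w_def theta_lattice_def)
    define p where "p = of_real (s - of_int (round s)) * \<tau> + of_real (t - of_int (round t))"
    have zp: "z = p + w" by (simp add: z p_def w_def algebra_simps)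
    have in_P: "of_real x * \<tau> + of_real x' \<in> P" if "\<bar>x\<bar> \<le> 1 / 2" "\<bar>x'\<bar> \<le> 1 / 2" for x x'
      unfolding P_def by (rule image_eqI[of _ _ "(x, x')"]) (use that in \<open>auto simp: cbox_Pair_eq\<close>)
    have "p \<in> P" unfolding p_def
      using of_int_round_abs_le[of s] of_int_round_abs_le[of t] by (intro in_P) (simp_all only: abs_minus_commute)
    have "theta_abs (z / J) (mob A \<tau>) = theta_abs (p / J) (mob A \<tau>)"
      using theta_abs_lattice'[OF A\<tau> theta_lattice_transform[OF A \<tau> w], of "p / J"]
      by (simp add: zp add_divide_distrib J_def)
    also have "\<dots> \<le> B * theta_abs p \<tau>" by (rule onP) fact
    also have "theta_abs p \<tau> = theta_abs z \<tau>"
      using theta_abs_lattice'[OF \<tau> w, of p] by (simp add: zp)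
    finally show ?thesis .
  qed
  then show ?thesis unfolding J_def by blast
qed

text \<open>The constant \<open>C\<close> of the transformation formula, expressed through the derivatives at \<open>0\<close>. This form shows at once that
it is holomorphic in \<open>\<tau>\<close>.\<close>

definition theta_factor :: "int ^ 2 ^ 2 \<Rightarrow> complex \<Rightarrow> complex" where
  "theta_factor A \<tau> = theta_over_z 0 (mob A \<tau>) / (mob_denom A \<tau> * theta_over_z 0 \<tau>)"

lemma theta_over_z_0_nonzero: "\<tau> \<in> upper_half_plane \<Longrightarrow> theta_over_z 0 \<tau> \<noteq> 0"
  by (rule theta_over_z_nonzero) auto

text \<open>By \<open>theta_transform_bounded\<close> the left side divided by the right side without \<open>C\<close> is an entire bounded function. Its
constant value is found by dividing by \<open>z\<close> and letting \<open>z\<close> tend to \<open>0\<close>.\<close>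

lemma theta_transform:
  assumes A: "A \<in> carrier SL2Z" and \<tau>: "\<tau> \<in> upper_half_plane"
  shows "jacobi_theta (z / mob_denom A \<tau>) (mob A \<tau>)
    = theta_factor A \<tau> * e2pi (of_int (A $ 2 $ 1) / 2) (z\<^sup>2 / mob_denom A \<tau>) * jacobi_theta z \<tau>"
proof -
  define J where "J = mob_denom A \<tau>"
  define E where "E = (\<lambda>z. e2pi (- of_int (A $ 2 $ 1) / 2) (z\<^sup>2 / J))"
  have J: "J \<noteq> 0" using mob_denom_nonzero[OF A \<tau>] by (simp add: J_def)
  have A\<tau>: "mob A \<tau> \<in> upper_half_plane" by (rule mob_upper_half_plane[OF A \<tau>])
  obtain B where B: "\<And>z. theta_abs (z / mob_denom A \<tau>) (mob A \<tau>) \<le> B * theta_abs z \<tau>"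
    using theta_transform_bounded[OF A \<tau>] by blast
  have "\<exists>C. \<forall>z. jacobi_theta (z / J) (mob A \<tau>) * E z = C * jacobi_theta z \<tau>"
  proof (rule entire_quotient_constant)
    show "(\<lambda>z. jacobi_theta (z / J) (mob A \<tau>) * E z) holomorphic_on UNIV"
    proof -
      have "((\<lambda>z. jacobi_theta z (mob A \<tau>)) \<circ> (\<lambda>z. z / J)) holomorphic_on UNIV"
        by (intro holomorphic_on_compose holomorphic_intros holomorphic_on_subset[OF theta_holomorphic[OF A\<tau>]]) (use J in auto)
      then show ?thesis unfolding E_def o_def using J by (intro holomorphic_intros) auto
    qed
    show "(\<lambda>z. jacobi_theta z \<tau>) holomorphic_on UNIV" by (rule theta_holomorphic[OF \<tau>])
    show "jacobi_theta (1 / 2) \<tau> \<noteq> 0"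
      using half_notin_theta_lattice[OF \<tau>] theta_eq_0_iff[OF \<tau>] by blast
    fix z
    have "norm (jacobi_theta (z / J) (mob A \<tau>) * E z) = theta_abs (z / J) (mob A \<tau>) * exp (pi * (Im z)\<^sup>2 / Im \<tau>)"
      unfolding E_def J_def by (rule theta_abs_transform_gauge[OF A \<tau>])
    also have "\<dots> \<le> (B * theta_abs z \<tau>) * exp (pi * (Im z)\<^sup>2 / Im \<tau>)"
      using B[of z] by (intro mult_right_mono) (auto simp: J_def)
    also have "\<dots> = B * norm (jacobi_theta z \<tau>)"
      by (simp add: theta_abs_def mult.assoc flip: exp_add)
    finally show "norm (jacobi_theta (z / J) (mob A \<tau>) * E z) \<le> B * norm (jacobi_theta z \<tau>)" .
  qed
  then obtain C where C: "\<And>z. jacobi_theta (z / J) (mob A \<tau>) * E z = C * jacobi_theta z \<tau>" by blast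
  \<comment> \<open>dividing by z and then letting z tend to 0 identifies C\<close>
  have red: "theta_over_z (z / J) (mob A \<tau>) * E z / J - C * theta_over_z z \<tau> = 0" if "z \<noteq> 0" for z
  proof -
    have "z * (theta_over_z (z / J) (mob A \<tau>) * E z / J) = z * (C * theta_over_z z \<tau>)"
      using C[of z] unfolding theta_eq_z_times[OF \<tau>] theta_eq_z_times[OF A\<tau>]
      by (simp only: times_divide_eq_left times_divide_eq_right mult_ac)
    then show ?thesis using that by (simp only: mult_cancel_left) simp
  qed
  have lim1: "(\<lambda>z. theta_over_z (z / J) (mob A \<tau>) * E z / J - C * theta_over_z z \<tau>) \<midarrow>0\<rightarrow>
     theta_over_z (0 / J) (mob A \<tau>) * E 0 / J - C * theta_over_z 0 \<tau>"
  proof -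
    have "continuous_on UNIV (\<lambda>z. theta_over_z (z / J) (mob A \<tau>) * E z / J - C * theta_over_z z \<tau>)"
      unfolding E_def by (intro continuous_intros theta_over_z_continuous) (use J \<tau> A\<tau> in auto)
    then have "isCont (\<lambda>z. theta_over_z (z / J) (mob A \<tau>) * E z / J - C * theta_over_z z \<tau>) 0"
      by (simp add: continuous_on_eq_continuous_at)
    then show ?thesis by (simp only: isCont_def)
  qed
  have lim2: "(\<lambda>z. theta_over_z (z / J) (mob A \<tau>) * E z / J - C * theta_over_z z \<tau>) \<midarrow>0\<rightarrow> 0"
    by (rule tendsto_eventually, unfold eventually_at_filter, rule always_eventually) (use red in blast)
  have "theta_over_z (0 / J) (mob A \<tau>) * E 0 / J - C * theta_over_z 0 \<tau> = 0"
    by (rule tendsto_unique[OF _ lim1 lim2]) simp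
  then have "C = theta_factor A \<tau>"
    using theta_over_z_0_nonzero[OF \<tau>] J by (simp add: theta_factor_def E_def J_def[symmetric] field_simps)
  moreover have "E z * e2pi (of_int (A $ 2 $ 1) / 2) (z\<^sup>2 / J) = 1"
    by (simp add: E_def flip: e2pi_add_left)
  ultimately show ?thesis
    using C[of z] unfolding J_def[symmetric] by (simp add: E_def e2pi_minus_left field_simps)
qed

lemma theta_factor_nonzero:
  assumes A: "A \<in> carrier SL2Z" and \<tau>: "\<tau> \<in> upper_half_plane"
  shows "theta_factor A \<tau> \<noteq> 0"
  unfolding theta_factor_def
  using theta_over_z_0_nonzero[OF \<tau>] theta_over_z_0_nonzero[OF mob_upper_half_plane[OF A \<tau>]] mob_denom_nonzero[OF A \<tau>] by simp

lemma theta_abs_transform: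
  assumes A: "A \<in> carrier SL2Z" and \<tau>: "\<tau> \<in> upper_half_plane"
  shows "theta_abs w (mob A \<tau>) = norm (theta_factor A \<tau>) * theta_abs (w * mob_denom A \<tau>) \<tau>"
proof -
  define z where "z = w * mob_denom A \<tau>"
  have w: "w = z / mob_denom A \<tau>" using mob_denom_nonzero[OF A \<tau>] by (simp add: z_def)
  have "norm (jacobi_theta (z / mob_denom A \<tau>) (mob A \<tau>) * e2pi (- of_int (A $ 2 $ 1) / 2) (z\<^sup>2 / mob_denom A \<tau>))
      = norm (theta_factor A \<tau>) * norm (jacobi_theta z \<tau>)"
    unfolding theta_transform[OF A \<tau>]
    by (simp add: norm_mult norm_e2pi mult.assoc) (simp flip: exp_add)
  then have "theta_abs (z / mob_denom A \<tau>) (mob A \<tau>) * (exp (pi * (Im z)\<^sup>2 / Im \<tau>) * exp (- (pi * (Im z)\<^sup>2 / Im \<tau>)))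
      = norm (theta_factor A \<tau>) * (norm (jacobi_theta z \<tau>) * exp (- (pi * (Im z)\<^sup>2 / Im \<tau>)))"
    unfolding theta_abs_transform_gauge[OF A \<tau>] by (metis mult.assoc)
  moreover have "exp (pi * (Im z)\<^sup>2 / Im \<tau>) * exp (- (pi * (Im z)\<^sup>2 / Im \<tau>)) = 1"
    by (simp flip: exp_add)
  ultimately show ?thesis
    unfolding z_def[symmetric] by (subst w) (simp only: mult_1_right theta_abs_def[of z \<tau>])
qed

lemma theta_abs_half_period_parity:
  assumes \<tau>: "\<tau> \<in> upper_half_plane" and "even (m - m')" "even (n - n')"
  shows "theta_abs ((of_int m * \<tau> + of_int n) / 2) \<tau> = theta_abs ((of_int m' * \<tau> + of_int n') / 2) \<tau>"
proof -
  obtain k where "m - m' = 2 * k" using assms(2) by (rule evenE)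
  moreover obtain l where "n - n' = 2 * l" using assms(3) by (rule evenE)
  ultimately have mn: "m = m' + 2 * k" "n = n' + 2 * l" by auto
  have eq: "(of_int m * \<tau> + of_int n) / 2 = (of_int m' * \<tau> + of_int n') / 2 + of_int k * \<tau> + of_int l"
    by (simp add: mn add_divide_distrib distrib_right)
  show ?thesis unfolding eq by (rule theta_abs_lattice[OF \<tau>])
qed

text \<open>Modulo \<open>2\<close> the matrix is invertible and so permutes the three non-zero vectors of a two-dimensional space over the
field with two elements; the values depend on the parities alone.\<close>

lemma theta_abs_half_periods_transform:
  assumes A: "A \<in> carrier SL2Z" and \<tau>: "\<tau> \<in> upper_half_plane"
  defines "T \<equiv> (\<lambda>m n. theta_abs ((of_int m * \<tau> + of_int n) / 2) \<tau>)"
  shows "T (A$2$1) (A$2$2) * T (A$1$1) (A$1$2) * T (A$1$1 + A$2$1) (A$1$2 + A$2$2) = T 0 1 * T 1 0 * T 1 1"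
proof -
  have T: "T m n = T (m mod 2) (n mod 2)" for m n
    unfolding T_def by (rule theta_abs_half_period_parity[OF \<tau>]) simp_all
  define a b c d where "a = A$1$1 mod 2" and "b = A$1$2 mod 2" and "c = A$2$1 mod 2" and "d = A$2$2 mod 2"
  have "(a * d - b * c) mod 2 = (A $ 1 $ 1 * A $ 2 $ 2 - A $ 1 $ 2 * A $ 2 $ 1) mod 2"
    unfolding a_def b_def c_def d_def by (intro mod_diff_cong mod_mult_eq)
  then have det: "(a * d - b * c) mod 2 = 1" using SL2Z_det[OF A] by simp
  have rng: "a \<in> {0,1}" "b \<in> {0,1}" "c \<in> {0,1}" "d \<in> {0,1}"
    by (auto simp: a_def b_def c_def d_def)
  have s: "(A$1$1 + A$2$1) mod 2 = (a + c) mod 2" "(A$1$2 + A$2$2) mod 2 = (b + d) mod 2"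
    unfolding a_def b_def c_def d_def by (simp_all add: mod_simps)
  have "T (A$2$1) (A$2$2) * T (A$1$1) (A$1$2) * T (A$1$1 + A$2$1) (A$1$2 + A$2$2)
     = T c d * T a b * T ((a + c) mod 2) ((b + d) mod 2)"
    using T[of "A$2$1" "A$2$2"] T[of "A$1$1" "A$1$2"] T[of "A$1$1 + A$2$1" "A$1$2 + A$2$2"]
    unfolding s a_def b_def c_def d_def by simp
  also have "\<dots> = T 0 1 * T 1 0 * T 1 1"
    using rng det by auto
  finally show ?thesis .
qed

text \<open>The product over the half periods is multiplied by \<open>|C|^3\<close> and \<open>|\<theta>'(0)|\<close> by \<open>|C| |c\<tau> + d|\<close>. The two quantities agree up
to the factor \<open>\<pi>\<close>, and \<open>C\<close> is not zero.\<close>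

lemma norm_theta_factor:
  assumes A: "A \<in> carrier SL2Z" and \<tau>: "\<tau> \<in> upper_half_plane"
  shows "(norm (theta_factor A \<tau>))\<^sup>2 = norm (mob_denom A \<tau>)"
proof -
  define J where "J = mob_denom A \<tau>"
  define C where "C = norm (theta_factor A \<tau>)"
  define T where "T = (\<lambda>m n. theta_abs ((of_int m * \<tau> + of_int n) / 2) \<tau>)"
  have A\<tau>: "mob A \<tau> \<in> upper_half_plane" by (rule mob_upper_half_plane[OF A \<tau>])
  have J: "J \<noteq> 0" using mob_denom_nonzero[OF A \<tau>] by (simp add: J_def)
  have C: "C \<noteq> 0" using theta_factor_nonzero[OF A \<tau>] by (simp add: C_def)
  have aJ: "mob A \<tau> * J = of_int (A $ 1 $ 1) * \<tau> + of_int (A $ 1 $ 2)"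
    unfolding J_def by (rule mob_times_denom[OF A \<tau>])
  have 1: "theta_abs (1 / 2) (mob A \<tau>) = C * T (A$2$1) (A$2$2)"
    unfolding theta_abs_transform[OF A \<tau>] C_def T_def by (simp add: mob_denom_def)
  have 2: "theta_abs (mob A \<tau> / 2) (mob A \<tau>) = C * T (A$1$1) (A$1$2)"
    unfolding theta_abs_transform[OF A \<tau>] C_def T_def by (simp add: aJ flip: J_def)
  have "(1 + mob A \<tau>) / 2 * J = (of_int (A$1$1 + A$2$1) * \<tau> + of_int (A$1$2 + A$2$2)) / 2"
    using aJ by (simp add: field_simps) (simp add: J_def mob_denom_def algebra_simps)
  then have 3: "theta_abs ((1 + mob A \<tau>) / 2) (mob A \<tau>) = C * T (A$1$1 + A$2$1) (A$1$2 + A$2$2)"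
    unfolding theta_abs_transform[OF A \<tau>] C_def T_def by (simp add: J_def)
  have "norm (theta_over_z 0 (mob A \<tau>)) = pi * (C * T (A$2$1) (A$2$2) * (C * T (A$1$1) (A$1$2)) * (C * T (A$1$1 + A$2$1) (A$1$2 + A$2$2)))"
    using theta_abs_half_periods[OF A\<tau>] unfolding 1 2 3 by simp
  also have "\<dots> = C ^ 3 * (pi * (T (A$2$1) (A$2$2) * T (A$1$1) (A$1$2) * T (A$1$1 + A$2$1) (A$1$2 + A$2$2)))"
    by (simp add: power3_eq_cube mult_ac)
  also have "T (A$2$1) (A$2$2) * T (A$1$1) (A$1$2) * T (A$1$1 + A$2$1) (A$1$2 + A$2$2) = T 0 1 * T 1 0 * T 1 1"
    unfolding T_def by (rule theta_abs_half_periods_transform[OF A \<tau>])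
  also have "pi * (T 0 1 * T 1 0 * T 1 1) = norm (theta_over_z 0 \<tau>)"
    using theta_abs_half_periods[OF \<tau>] by (simp add: T_def add.commute)
  finally have "norm (theta_over_z 0 (mob A \<tau>)) = C ^ 3 * norm (theta_over_z 0 \<tau>)" .
  moreover have "norm (theta_over_z 0 (mob A \<tau>)) = C * norm J * norm (theta_over_z 0 \<tau>)"
    using theta_over_z_0_nonzero[OF \<tau>] J unfolding C_def theta_factor_def J_def[symmetric]
    by (simp add: norm_mult norm_divide)
  ultimately have "C ^ 3 = C * norm J" using theta_over_z_0_nonzero[OF \<tau>] by simp
  then show ?thesis using C unfolding C_def[symmetric] J_def[symmetric]
    by (simp add: power3_eq_cube power2_eq_square)
qed

lemma mob_denom_holomorphic: "mob_denom A holomorphic_on S"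
  unfolding mob_denom_def by (intro holomorphic_intros)

lemma mob_holomorphic:
  assumes "A \<in> carrier SL2Z"
  shows "mob A holomorphic_on upper_half_plane"
  unfolding mob_def using mob_denom_nonzero[OF assms] by (intro holomorphic_intros) (auto simp: mob_denom_def)

text \<open>Either \<open>c = 0\<close> and the function is constant, or \<open>c\<tau> + d\<close> is never real; in both cases the branch cut causes no
problem.\<close>

lemma mob_denom_powr_holomorphic:
  assumes A: "A \<in> carrier SL2Z"
  shows "(\<lambda>\<tau>. mob_denom A \<tau> powr a) holomorphic_on upper_half_plane"
proof (cases "A $ 2 $ 1 = 0")
  case True
  then show ?thesis by (simp add: mob_denom_def)
next
  case False
  have "mob_denom A \<tau> \<notin> \<real>\<^sub>\<le>\<^sub>0" if "\<tau> \<in> upper_half_plane" for \<tau>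
  proof -
    have "Im (mob_denom A \<tau>) \<noteq> 0" using that False by (simp add: mob_denom_def upper_half_plane_def)
    then show ?thesis using complex_nonpos_Reals_iff by auto
  qed
  then show ?thesis by (intro holomorphic_intros mob_denom_holomorphic)
qed

lemma constant_modulus_constant:
  fixes f :: "complex \<Rightarrow> complex"
  assumes "f holomorphic_on S" "open S" "connected S" "S \<noteq> {}" "\<And>z. z \<in> S \<Longrightarrow> norm (f z) = 1"
  shows "\<exists>u. norm u = 1 \<and> (\<forall>z\<in>S. f z = u)"
proof -
  obtain s where "s \<in> S" using assms(4) by blast
  have "f constant_on S"
    by (rule maximum_modulus_principle[OF assms(1-3) assms(2) order_refl \<open>s \<in> S\<close>]) (use assms(5) \<open>s \<in> S\<close> in simp)
  then obtain u where "\<And>z. z \<in> S \<Longrightarrow> f z = u" by (auto simp: constant_on_def)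
  then show ?thesis using assms(5) \<open>s \<in> S\<close> by (intro exI[of _ u]) auto
qed

lemma theta_factor_eq:
  assumes A: "A \<in> carrier SL2Z"
  shows "\<exists>u. norm u = 1 \<and> (\<forall>\<tau>\<in>upper_half_plane. theta_factor A \<tau> = u * mob_denom A \<tau> powr (1 / 2))"
proof -
  define f where "f = (\<lambda>\<tau>. theta_factor A \<tau> / mob_denom A \<tau> powr (1 / 2))"
  have "\<exists>u. norm u = 1 \<and> (\<forall>\<tau>\<in>upper_half_plane. f \<tau> = u)"
  proof (rule constant_modulus_constant)
    have "(theta_over_z 0 \<circ> mob A) holomorphic_on upper_half_plane"
      by (rule holomorphic_on_compose_gen[OF mob_holomorphic[OF A] theta_over_z_holomorphic_tau])
         (use mob_upper_half_plane[OF A] in auto)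
    then show "f holomorphic_on upper_half_plane"
      unfolding f_def theta_factor_def using mob_denom_nonzero[OF A] theta_over_z_0_nonzero
      by (intro holomorphic_intros mob_denom_powr_holomorphic[OF A] theta_over_z_holomorphic_tau mob_denom_holomorphic) (auto simp: o_def)
    show "connected upper_half_plane" by (intro convex_connected convex_upper_half_plane)
    show "upper_half_plane \<noteq> {}" by (auto simp: upper_half_plane_def intro!: exI[of _ \<i>])
    fix \<tau> assume \<tau>: "\<tau> \<in> upper_half_plane"
    have "norm (mob_denom A \<tau> powr (1 / 2)) ^ 2 = norm (mob_denom A \<tau>)"
      using mob_denom_nonzero[OF A \<tau>] by (simp add: powr_def flip: norm_power exp_of_nat_mult)
    then have "(norm (f \<tau>))\<^sup>2 = 1"
      unfolding f_def norm_divide power_divide norm_theta_factor[OF A \<tau>] using mob_denom_nonzero[OF A \<tau>] by simp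
    then show "norm (f \<tau>) = 1" by (simp add: power2_eq_1_iff) (use norm_ge_zero[of "f \<tau>"] in linarith)
  qed simp
  then show ?thesis using mob_denom_nonzero[OF A] by (auto simp: f_def field_simps)
qed

section \<open>Translates of theta by two-torsion points\<close>

text \<open>For \<open>c, d\<close> in \<open>{0, 1}\<close> these are, up to constants, the four classical theta functions. The exponential prefactor makes
the family depend on \<open>c\<close> and \<open>d\<close> modulo \<open>2\<close> only, up to a root of unity.\<close>

definition theta_shift :: "int \<Rightarrow> int \<Rightarrow> complex \<Rightarrow> complex \<Rightarrow> complex" where
  "theta_shift c d z \<tau> = e2pi (of_int c / 2) z * e2pi ((of_int c)\<^sup>2 / 8) \<tau> * jacobi_theta (z + (of_int c * \<tau> + of_int d) / 2) \<tau>"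

lemma theta_shift_01: "theta_shift 0 1 z \<tau> = jacobi_theta (z + 1 / 2) \<tau>"
  by (simp add: theta_shift_def)

lemma theta_shift_mod:
  assumes \<tau>: "\<tau> \<in> upper_half_plane"
  shows "theta_shift (c + 2 * k) (d + 2 * l) z \<tau> = e2pi ((of_int l + of_int k - of_int (k * d)) / 2) 1 * theta_shift c d z \<tau>"
proof -
  define w where "w = z + (of_int c * \<tau> + of_int d) / 2"
  have w: "z + (of_int (c + 2 * k) * \<tau> + of_int (d + 2 * l)) / 2 = w + of_int k * \<tau> + of_int l"
    by (simp add: w_def algebra_simps add_divide_distrib)
  have "e2pi (of_int (c + 2 * k) / 2) z * e2pi ((of_int (c + 2 * k))\<^sup>2 / 8) \<tau> *
      (e2pi (of_int l / 2) 1 * (e2pi (of_int k / 2) 1 * e2pi (- ((of_int k)\<^sup>2 / 2)) \<tau> * e2pi (- of_int k) w))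
      = e2pi ((of_int l + of_int k - of_int (k * d)) / 2) 1 * (e2pi (of_int c / 2) z * e2pi ((of_int c)\<^sup>2 / 8) \<tau>)"
    unfolding e2pi_def exp_add[symmetric] w_def
    by (rule arg_cong[of _ _ exp]) (simp add: field_simps power2_eq_square)
  then show ?thesis
    unfolding theta_shift_def w theta_add_int theta_add_tau_multiple[OF \<tau>] w_def[symmetric]
    by (simp only: mult.assoc[symmetric])
qed

lemma theta_shift_reduce:
  "\<exists>u. norm u = 1 \<and> (\<forall>\<tau>\<in>upper_half_plane. \<forall>z. theta_shift c d z \<tau> = u * theta_shift (c mod 2) (d mod 2) z \<tau>)"
proof -
  define k l where "k = c div 2" and "l = d div 2"
  have cd: "c = c mod 2 + 2 * k" "d = d mod 2 + 2 * l" by (simp_all add: k_def l_def)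
  show ?thesis
    by (rule exI[of _ "e2pi ((of_int l + of_int k - of_int (k * (d mod 2))) / 2) 1"])
       (use theta_shift_mod[of _ "c mod 2" k "d mod 2" l] cd in \<open>auto simp: norm_e2pi\<close>)
qed

lemma theta_shift_holomorphic:
  assumes "\<tau> \<in> upper_half_plane"
  shows "(\<lambda>z. theta_shift c d z \<tau>) holomorphic_on UNIV"
proof -
  have "((\<lambda>z. jacobi_theta z \<tau>) \<circ> (\<lambda>z. z + (of_int c * \<tau> + of_int d) / 2)) holomorphic_on UNIV"
    by (intro holomorphic_on_compose holomorphic_intros holomorphic_on_subset[OF theta_holomorphic[OF assms]]) auto
  then show ?thesis
    unfolding theta_shift_def o_def by (intro holomorphic_intros)
qed

text \<open>The translation by \<open>1/2\<close> becomes a translation by \<open>(c\<tau> + d)/2\<close> in the variable \<open>z\<close>. For even \<open>c\<close> this is again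
\<open>1/2\<close> modulo the lattice; for odd \<open>c\<close> another theta function appears, as it must at the other cusp.\<close>

lemma theta_shift_transform:
  assumes A: "A \<in> carrier SL2Z" and \<tau>: "\<tau> \<in> upper_half_plane"
  shows "jacobi_theta (z / mob_denom A \<tau> + 1 / 2) (mob A \<tau>)
     = e2pi (of_int (A $ 2 $ 1) * of_int (A $ 2 $ 2) / 8) 1 * theta_factor A \<tau> *
       e2pi (of_int (A $ 2 $ 1) / 2) (z\<^sup>2 / mob_denom A \<tau>) * theta_shift (A $ 2 $ 1) (A $ 2 $ 2) z \<tau>"
proof -
  define J c d where "J = mob_denom A \<tau>" and "c = A $ 2 $ 1" and "d = A $ 2 $ 2"
  have J: "J \<noteq> 0" using mob_denom_nonzero[OF A \<tau>] by (simp add: J_def)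
  have Jcd: "J = of_int c * \<tau> + of_int d" by (simp add: J_def mob_denom_def c_def d_def)
  have 1: "z / J + 1 / 2 = (z + J / 2) / J" using J by (simp add: field_simps)
  have "(z + J / 2)\<^sup>2 / J = z\<^sup>2 / J + (z + J / 4)" using J by (simp add: field_simps power2_eq_square)
  then have 2: "e2pi (of_int c / 2) ((z + J / 2)\<^sup>2 / J) = e2pi (of_int c / 2) (z\<^sup>2 / J) * e2pi (of_int c / 2) z * e2pi (of_int c / 2) (J / 4)"
    by (simp only: e2pi_add_right mult.assoc)
  have 3: "e2pi (of_int c / 2) (J / 4) = e2pi (of_int c * of_int d / 8) 1 * e2pi ((of_int c)\<^sup>2 / 8) \<tau>"
    unfolding e2pi_def exp_add[symmetric] Jcd
    by (rule arg_cong[of _ _ exp]) (simp add: field_simps power2_eq_square)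
  have "jacobi_theta (z / J + 1 / 2) (mob A \<tau>) = theta_factor A \<tau> * e2pi (of_int c / 2) ((z + J / 2)\<^sup>2 / J) * jacobi_theta (z + J / 2) \<tau>"
    unfolding 1 unfolding J_def c_def by (rule theta_transform[OF A \<tau>])
  also have "jacobi_theta (z + J / 2) \<tau> = jacobi_theta (z + (of_int c * \<tau> + of_int d) / 2) \<tau>"
    by (simp add: Jcd)
  finally show ?thesis
    unfolding 2 3 theta_shift_def J_def[symmetric] c_def[symmetric] d_def[symmetric] by (simp only: mult_ac)
qed

lemma theta_over_z_transform:
  assumes A: "A \<in> carrier SL2Z" and \<tau>: "\<tau> \<in> upper_half_plane"
  shows "theta_over_z (z / mob_denom A \<tau>) (mob A \<tau>)
     = mob_denom A \<tau> * theta_factor A \<tau> * e2pi (of_int (A $ 2 $ 1) / 2) (z\<^sup>2 / mob_denom A \<tau>) * theta_over_z z \<tau>"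
proof (cases "z = 0")
  case True
  then show ?thesis
    using mob_denom_nonzero[OF A \<tau>] theta_over_z_0_nonzero[OF \<tau>] by (simp add: theta_factor_def)
next
  case False
  have "z * (theta_over_z (z / mob_denom A \<tau>) (mob A \<tau>)) =
     z * (mob_denom A \<tau> * theta_factor A \<tau> * e2pi (of_int (A $ 2 $ 1) / 2) (z\<^sup>2 / mob_denom A \<tau>) * theta_over_z z \<tau>)"
    using theta_transform[OF A \<tau>, of z] mob_denom_nonzero[OF A \<tau>]
    unfolding theta_eq_z_times[OF \<tau>] theta_eq_z_times[OF mob_upper_half_plane[OF A \<tau>]] by (simp add: field_simps)
  then show ?thesis using False by (simp only: mult_cancel_left) simp
qed

section \<open>The regular part of phi at the origin\<close>

text \<open>For \<open>c = 0\<close> and \<open>d = 1\<close> this is \<open>z^N \<phi>\<close>, regular at \<open>z = 0\<close>. The other values of \<open>c\<close> and \<open>d\<close> describe its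
transforms under matrices outside the level \<open>2\<close> group.\<close>

definition regular_part :: "nat \<Rightarrow> nat \<Rightarrow> int \<Rightarrow> int \<Rightarrow> complex \<Rightarrow> complex \<Rightarrow> complex" where
  "regular_part M N c d z \<tau> = theta_shift c d z \<tau> ^ M / theta_over_z z \<tau> ^ N"

text \<open>The Gaussian factor turns a Jacobi form of index \<open>(M - N)/2\<close> into a function that transforms without an exponential
factor, at the expense of holomorphy in \<open>\<tau>\<close>.\<close>

definition completed_part :: "nat \<Rightarrow> nat \<Rightarrow> int \<Rightarrow> int \<Rightarrow> complex \<Rightarrow> complex \<Rightarrow> complex" where
  "completed_part M N c d z \<tau> = exp (of_real (pi * (real M - real N) / 2) / of_real (Im \<tau>) * z\<^sup>2) * regular_part M N c d z \<tau>"

lemma phi_eq_regular_part: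
  assumes "\<tau> \<in> upper_half_plane"
  shows "phi M N z \<tau> = regular_part M N 0 1 z \<tau> / z ^ N"
  by (simp add: phi_def regular_part_def theta_shift_01 theta_eq_z_times[OF assms, of z] power_mult_distrib)

lemma regular_part_reduce:
  "\<exists>u. norm u = 1 \<and> (\<forall>\<tau>\<in>upper_half_plane. \<forall>z. regular_part M N c d z \<tau> = u * regular_part M N (c mod 2) (d mod 2) z \<tau>)"
proof -
  obtain u where "norm u = 1" "\<forall>\<tau>\<in>upper_half_plane. \<forall>z. theta_shift c d z \<tau> = u * theta_shift (c mod 2) (d mod 2) z \<tau>"
    using theta_shift_reduce by blast
  then show ?thesis
    by (intro exI[of _ "u ^ M"]) (auto simp: regular_part_def norm_power power_mult_distrib)
qed

lemma regular_part_transform: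
  assumes A: "A \<in> carrier SL2Z"
  shows "\<exists>w. norm w = 1 \<and> (\<forall>\<tau>\<in>upper_half_plane. \<forall>z. regular_part M N 0 1 (z / mob_denom A \<tau>) (mob A \<tau>)
     = w * mob_denom A \<tau> powr of_real ((real M - real N) / 2 - real N) *
       e2pi ((real M - real N) * of_int (A $ 2 $ 1) / 2) (z\<^sup>2 / mob_denom A \<tau>) * regular_part M N (A $ 2 $ 1) (A $ 2 $ 2) z \<tau>)"
proof -
  obtain u where u: "norm u = 1" "\<forall>\<tau>\<in>upper_half_plane. theta_factor A \<tau> = u * mob_denom A \<tau> powr (1 / 2)"
    using theta_factor_eq[OF A] by blast
  define c d where "c = A $ 2 $ 1" and "d = A $ 2 $ 2"
  define t where "t = e2pi (of_int c * of_int d / 8) 1"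
  have t: "norm t = 1" by (simp add: t_def norm_e2pi)
  have "regular_part M N 0 1 (z / mob_denom A \<tau>) (mob A \<tau>)
     = (t * u) ^ M / u ^ N * mob_denom A \<tau> powr of_real ((real M - real N) / 2 - real N) *
       e2pi ((real M - real N) * of_int c / 2) (z\<^sup>2 / mob_denom A \<tau>) * regular_part M N c d z \<tau>" if \<tau>: "\<tau> \<in> upper_half_plane" for z \<tau>
  proof -
    define J where "J = mob_denom A \<tau>"
    define s where "s = J powr (1 / 2)"
    define E where "E = e2pi (of_int c / 2) (z\<^sup>2 / J)"
    have J: "J \<noteq> 0" using mob_denom_nonzero[OF A \<tau>] by (simp add: J_def)
    have s: "s ^ m = J powr (of_nat m / 2)" for m
      using J by (simp add: s_def powr_def flip: exp_of_nat_mult)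
    have "J ^ N = J powr of_nat N" using J by (simp add: powr_def exp_of_nat_mult)
    then have "s ^ M / (s ^ N * J ^ N) = J powr (of_nat M / 2 - (of_nat N / 2 + of_nat N))"
      by (simp only: s powr_diff powr_add)
    also have "of_nat M / 2 - (of_nat N / 2 + of_nat N) = complex_of_real ((real M - real N) / 2 - real N)"
      by (simp add: field_simps)
    finally have 1: "s ^ M / (s ^ N * J ^ N) = J powr of_real ((real M - real N) / 2 - real N)" .
    have EE: "E ^ m = e2pi (real m * (of_int c / 2)) (z\<^sup>2 / J)" for m
      by (simp only: E_def e2pi_power)
    have "E ^ M / E ^ N = e2pi (real M * (of_int c / 2) + - (real N * (of_int c / 2))) (z\<^sup>2 / J)"
      by (simp only: EE e2pi_add_left e2pi_minus_left divide_inverse)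
    also have "real M * (of_int c / 2) + - (real N * (of_int c / 2)) = (real M - real N) * of_int c / 2"
      by (simp add: field_simps)
    finally have 2: "E ^ M / E ^ N = e2pi ((real M - real N) * of_int c / 2) (z\<^sup>2 / J)" .
    have num: "theta_shift 0 1 (z / J) (mob A \<tau>) = t * (u * s) * E * theta_shift c d z \<tau>"
      using theta_shift_transform[OF A \<tau>, of z] u(2) \<tau>
      by (simp add: theta_shift_01 t_def E_def s_def J_def c_def d_def)
    have den: "theta_over_z (z / J) (mob A \<tau>) = J * (u * s) * E * theta_over_z z \<tau>"
      using theta_over_z_transform[OF A \<tau>, of z] u(2) \<tau> by (simp add: E_def s_def J_def c_def)
    have "regular_part M N 0 1 (z / J) (mob A \<tau>) = (t * u) ^ M / u ^ N * (s ^ M / (s ^ N * J ^ N)) * (E ^ M / E ^ N) * regular_part M N c d z \<tau>"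
      unfolding regular_part_def num den by (simp add: power_mult_distrib mult_ac)
    then show ?thesis unfolding 1 2 unfolding J_def .
  qed
  then show ?thesis using u(1) t unfolding c_def d_def
    by (intro exI[of _ "(t * u) ^ M / u ^ N"]) (auto simp: norm_mult norm_divide norm_power)
qed

text \<open>Under \<open>z \<mapsto> z/(c\<tau> + d)\<close> and \<open>\<tau> \<mapsto> A\<tau>\<close> the expression \<open>z^2/Im \<tau>\<close> changes by \<open>-2ic z^2/(c\<tau> + d)\<close>, which cancels the
exponential factor of the Jacobi form.\<close>

lemma completed_part_transform:
  assumes A: "A \<in> carrier SL2Z"
  shows "\<exists>w. norm w = 1 \<and> (\<forall>\<tau>\<in>upper_half_plane. \<forall>z. completed_part M N 0 1 (z / mob_denom A \<tau>) (mob A \<tau>)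
     = w * mob_denom A \<tau> powr of_real ((real M - real N) / 2 - real N) * completed_part M N (A $ 2 $ 1) (A $ 2 $ 2) z \<tau>)"
proof -
  obtain w where w: "norm w = 1" "\<And>\<tau> z. \<tau>\<in>upper_half_plane \<Longrightarrow> regular_part M N 0 1 (z / mob_denom A \<tau>) (mob A \<tau>)
     = w * mob_denom A \<tau> powr of_real ((real M - real N) / 2 - real N) *
       e2pi ((real M - real N) * of_int (A $ 2 $ 1) / 2) (z\<^sup>2 / mob_denom A \<tau>) * regular_part M N (A $ 2 $ 1) (A $ 2 $ 2) z \<tau>"
    using regular_part_transform[OF A, of M N] by blast
  have "exp (of_real (pi * (real M - real N) / 2) / of_real (Im (mob A \<tau>)) * (z / mob_denom A \<tau>)\<^sup>2) *
       e2pi ((real M - real N) * of_int (A $ 2 $ 1) / 2) (z\<^sup>2 / mob_denom A \<tau>)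
     = exp (of_real (pi * (real M - real N) / 2) / of_real (Im \<tau>) * z\<^sup>2)" if \<tau>: "\<tau> \<in> upper_half_plane" for z \<tau>
  proof -
    define J c where "J = mob_denom A \<tau>" and "c = A $ 2 $ 1"
    define m where "m = complex_of_real (pi * (real M - real N) / 2)"
    define y where "y = complex_of_real (Im \<tau>)"
    have J: "J \<noteq> 0" using mob_denom_nonzero[OF A \<tau>] by (simp add: J_def)
    have y: "y \<noteq> 0" using \<tau> by (simp add: y_def upper_half_plane_def)
    have iy: "complex_of_real (Im (mob A \<tau>)) = y / (J * cnj J)"
      unfolding Im_mob[OF A \<tau>] J_def y_def by (simp add: complex_norm_square[symmetric])
    have "cnj J + 2 * \<i> * of_int c * y = J"
      by (simp add: J_def c_def y_def mob_denom_def complex_eq_iff)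
    then have "cnj J / y + 2 * \<i> * of_int c = J / y"
      using y by (simp add: field_simps)
    moreover have "(z / J)\<^sup>2 * (J * cnj J / y) + 2 * \<i> * of_int c * (z\<^sup>2 / J) = z\<^sup>2 / J * (cnj J / y + 2 * \<i> * of_int c)"
      using J by (simp add: power2_eq_square algebra_simps)
    ultimately have key: "(z / J)\<^sup>2 * (J * cnj J / y) + 2 * \<i> * of_int c * (z\<^sup>2 / J) = z\<^sup>2 / y"
      using J by simp
    define x where "x = complex_of_real (real M - real N)"
    have mx: "m = of_real pi * x / 2" by (simp add: m_def x_def)
    have ex: "complex_of_real ((real M - real N) * of_int c / 2) = x * of_int c / 2" by (simp add: x_def)
    have "m / (y / (J * cnj J)) * (z / J)\<^sup>2 + 2 * of_real pi * \<i> * of_real ((real M - real N) * of_int c / 2) * (z\<^sup>2 / J)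
      = m * ((z / J)\<^sup>2 * (J * cnj J / y) + 2 * \<i> * of_int c * (z\<^sup>2 / J))"
      unfolding mx ex by (simp add: algebra_simps)
    then have "m / (y / (J * cnj J)) * (z / J)\<^sup>2 + 2 * of_real pi * \<i> * of_real ((real M - real N) * of_int c / 2) * (z\<^sup>2 / J)
      = m / y * z\<^sup>2"
      unfolding key by simp
    then show ?thesis
      unfolding iy e2pi_def exp_add[symmetric] m_def[symmetric] y_def[symmetric] J_def[symmetric] c_def[symmetric]
      by simp
  qed
  note E = this
  show ?thesis
  proof (rule exI[of _ w], intro conjI ballI allI w(1))
    fix \<tau> z assume \<tau>: "\<tau> \<in> upper_half_plane"
    show "completed_part M N 0 1 (z / mob_denom A \<tau>) (mob A \<tau>)
     = w * mob_denom A \<tau> powr of_real ((real M - real N) / 2 - real N) * completed_part M N (A $ 2 $ 1) (A $ 2 $ 2) z \<tau>"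
      unfolding completed_part_def w(2)[OF \<tau>] E[OF \<tau>, of z, symmetric] by (simp only: mult_ac)
  qed
qed

text \<open>This bound makes the punctured disc of radius \<open>min 1 (Im \<tau>)\<close> free of poles, locally uniformly in \<open>\<tau>\<close> and, for
\<open>Im \<tau> \<ge> 1\<close>, with a fixed radius.\<close>

lemma theta_lattice_norm:
  assumes "w \<in> theta_lattice \<tau>" "w \<noteq> 0"
  shows "norm w \<ge> min 1 (Im \<tau>)"
proof -
  obtain m n where w: "w = of_int m * \<tau> + of_int n" using assms(1) by (auto simp: theta_lattice_def)
  show ?thesis
  proof (cases "m = 0")
    case True
    then have "n \<noteq> 0" using assms(2) w by auto
    then have "1 \<le> \<bar>of_int n :: real\<bar>" by linarith
    then show ?thesis using True by (simp add: w)
  next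
    case False
    then have "1 \<le> \<bar>of_int m :: real\<bar>" by linarith
    then have "1 * \<bar>Im \<tau>\<bar> \<le> \<bar>of_int m\<bar> * \<bar>Im \<tau>\<bar>" by (intro mult_right_mono) auto
    also have "\<dots> = \<bar>Im w\<bar>" by (simp add: w abs_mult)
    also have "\<dots> \<le> norm w" by (rule abs_Im_le_cmod)
    finally show ?thesis by linarith
  qed
qed

lemma theta_over_z_nonzero_near_0:
  assumes "\<tau> \<in> upper_half_plane" "norm z < min 1 (Im \<tau>)"
  shows "theta_over_z z \<tau> \<noteq> 0"
proof (rule theta_over_z_nonzero[OF assms(1)], rule notI)
  assume "z \<in> theta_lattice \<tau> - {0}"
  then show False using theta_lattice_norm[of z \<tau>] assms(2) by simp
qed

lemma regular_part_holomorphic: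
  assumes "\<tau> \<in> upper_half_plane"
  shows "(\<lambda>z. regular_part M N c d z \<tau>) holomorphic_on - (theta_lattice \<tau> - {0})"
  unfolding regular_part_def
  by (intro holomorphic_intros holomorphic_on_subset[OF theta_shift_holomorphic[OF assms]]
      holomorphic_on_subset[OF theta_over_z_holomorphic[OF assms]])
     (use theta_over_z_nonzero[OF assms] in auto)

lemma regular_part_holomorphic_ball:
  assumes "\<tau> \<in> upper_half_plane"
  shows "(\<lambda>z. regular_part M N c d z \<tau>) holomorphic_on ball 0 (min 1 (Im \<tau>))"
proof (rule holomorphic_on_subset[OF regular_part_holomorphic[OF assms]], rule subsetI, rule ComplI)
  fix z assume "z \<in> ball 0 (min 1 (Im \<tau>))" "z \<in> theta_lattice \<tau> - {0}"
  then show False using theta_lattice_norm[of z \<tau>] by (auto simp: min_def split: if_splits)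
qed

lemma completed_part_holomorphic_ball:
  assumes "\<tau> \<in> upper_half_plane"
  shows "(\<lambda>z. completed_part M N c d z \<tau>) holomorphic_on ball 0 (min 1 (Im \<tau>))"
  unfolding completed_part_def by (intro holomorphic_intros regular_part_holomorphic_ball assms)

section \<open>Taylor coefficients as functions of the modulus\<close>

text \<open>The derivative at \<open>0\<close> is a Cauchy integral over the circle of radius \<open>r\<close>. Inserting Cauchy's formula in the parameter
and exchanging the two integrals exhibits this function of \<open>\<tau>\<close> as the Cauchy integral of a continuous function, and
such integrals are differentiable.\<close>

lemma parametric_higher_deriv_holomorphic:
  assumes U: "open U" and r: "r > 0"
    and cont: "continuous_on (cball 0 r \<times> U) (\<lambda>(z, \<tau>). f z \<tau>)"
    and hol_z: "\<And>\<tau>. \<tau> \<in> U \<Longrightarrow> (\<lambda>z. f z \<tau>) holomorphic_on ball 0 r"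
    and hol_\<tau>: "\<And>z. z \<in> sphere 0 r \<Longrightarrow> f z holomorphic_on U"
  shows "(\<lambda>\<tau>. (deriv ^^ n) (\<lambda>z. f z \<tau>) 0) holomorphic_on U"
proof -
  define F where "F = (\<lambda>z \<tau>. f z \<tau> / z ^ Suc n)"
  define G where "G = (\<lambda>\<tau>. contour_integral (circlepath 0 r) (\<lambda>z. F z \<tau>))"
  have contF: "continuous_on (sphere 0 r \<times> U) (\<lambda>(z, \<tau>). F z \<tau>)"
    unfolding F_def case_prod_unfold
    by (intro continuous_intros continuous_on_subset[OF cont, unfolded case_prod_unfold]) (use r in auto)
  have G: "(deriv ^^ n) (\<lambda>z. f z \<tau>) 0 = fact n / (2 * pi * \<i>) * G \<tau>" if "\<tau> \<in> U" for \<tau>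
  proof -
    have "continuous_on (cball 0 r) ((\<lambda>(z, \<tau>). f z \<tau>) \<circ> (\<lambda>z. (z, \<tau>)))"
      by (intro continuous_on_compose continuous_intros continuous_on_subset[OF cont]) (use that in auto)
    then have "contour_integral (circlepath 0 r) (\<lambda>u. f u \<tau> / (u - 0) ^ Suc n) = (2 * pi * \<i>) * (deriv ^^ n) (\<lambda>z. f z \<tau>) 0 / fact n"
      by (intro Cauchy_contour_integral_circlepath hol_z that) (use r in \<open>auto simp: o_def\<close>)
    then show ?thesis by (simp add: G_def F_def)
  qed
  have contG: "continuous_on U G"
  proof -
    have "continuous_on (U \<times> cbox 0 1) (\<lambda>(\<tau>, x). F (circlepath 0 r x) \<tau> * vector_derivative (circlepath 0 r) (at x))"
    proof -
      have "continuous_on (U \<times> cbox 0 1) ((\<lambda>(z, \<tau>). F z \<tau>) \<circ> (\<lambda>(\<tau>, x). (circlepath 0 r x, \<tau>)))"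
      proof (intro continuous_on_compose continuous_on_subset[OF contF])
        show "continuous_on (U \<times> cbox 0 1) (\<lambda>(\<tau>, x). (circlepath 0 r x, \<tau>))"
          unfolding circlepath_def part_circlepath_def linepath_def case_prod_unfold by (intro continuous_intros)
      qed (use r in \<open>auto simp: circlepath norm_mult\<close>)
      then show ?thesis
        unfolding vector_derivative_circlepath case_prod_unfold o_def fst_conv snd_conv by (intro continuous_intros)
    qed
    then have "continuous_on U (\<lambda>\<tau>. integral (cbox 0 1) (\<lambda>x. F (circlepath 0 r x) \<tau> * vector_derivative (circlepath 0 r) (at x)))"
      by (rule integral_continuous_on_param)
    then show ?thesis unfolding G_def contour_integral_integral by simp
  qed
  have "\<exists>D. (G has_field_derivative D) (at w)" if "w \<in> U" for w
  proof -
    obtain \<rho> where \<rho>: "\<rho> > 0" "cball w \<rho> \<subseteq> U"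
      using open_contains_cball[THEN iffD1, OF U] \<open>w \<in> U\<close> by meson
    have "sphere w \<rho> \<subseteq> U" using \<rho>(2) sphere_cball by (rule subset_trans[rotated])
    then have sub: "path_image (circlepath w \<rho>) \<subseteq> U" using \<rho>(1) by simp
    \<comment> \<open>G reproduces itself under Cauchy's integral in the parameter\<close>
    have swapped: "((\<lambda>t. G t / (t - \<tau>) ^ 1) has_contour_integral 2 * pi * \<i> * G \<tau>) (circlepath w \<rho>)" if \<tau>: "\<tau> \<in> ball w \<rho>" for \<tau>
    proof -
      have ne: "t \<noteq> \<tau>" if "t \<in> sphere w \<rho>" for t using that \<tau> by auto
      have "contour_integral (circlepath w \<rho>) (\<lambda>t. G t / (t - \<tau>))
          = contour_integral (circlepath w \<rho>) (\<lambda>t. contour_integral (circlepath 0 r) (\<lambda>z. F z t / (t - \<tau>)))"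
        unfolding G_def divide_inverse
      proof (intro contour_integral_eq)
        fix t assume t: "t \<in> path_image (circlepath w \<rho>)"
        then have "t \<in> U" using sub by blast
        have "continuous_on (sphere 0 r) ((\<lambda>(z, \<tau>). F z \<tau>) \<circ> (\<lambda>z. (z, t)))"
          by (intro continuous_on_compose continuous_intros continuous_on_subset[OF contF]) (use \<open>t \<in> U\<close> in auto)
        then have "(\<lambda>z. F z t) contour_integrable_on circlepath 0 r"
          by (intro contour_integrable_continuous_circlepath) (use r in \<open>simp add: o_def\<close>)
        then show "contour_integral (circlepath 0 r) (\<lambda>z. F z t) * inverse (t - \<tau>) = contour_integral (circlepath 0 r) (\<lambda>z. F z t * inverse (t - \<tau>))"
          by (simp add: contour_integral_rmul)
      qed
      also have "\<dots> = contour_integral (circlepath 0 r) (\<lambda>z. contour_integral (circlepath w \<rho>) (\<lambda>t. F z t / (t - \<tau>)))"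
      proof (rule contour_integral_swap)
        have "continuous_on (sphere w \<rho> \<times> sphere 0 r) ((\<lambda>(z, \<tau>). F z \<tau>) \<circ> (\<lambda>(t, z). (z, t)))"
          unfolding case_prod_unfold
          by (intro continuous_on_compose continuous_intros continuous_on_subset[OF contF, unfolded case_prod_unfold])
             (use \<rho> in auto)
        then show "continuous_on (path_image (circlepath w \<rho>) \<times> path_image (circlepath 0 r)) (\<lambda>(t, z). F z t / (t - \<tau>))"
          unfolding case_prod_unfold o_def
          by (intro continuous_intros) (use \<rho> r ne in auto)
      qed (auto simp: vector_derivative_circlepath intro!: continuous_intros)
      also have "\<dots> = contour_integral (circlepath 0 r) (\<lambda>z. 2 * pi * \<i> * F z \<tau>)"
      proof (intro contour_integral_eq)
        fix z assume "z \<in> path_image (circlepath 0 r)"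
        then have z: "z \<in> sphere 0 r" "z \<noteq> 0" using r by auto
        have "F z holomorphic_on cball w \<rho>"
          unfolding F_def using z \<rho> by (intro holomorphic_intros holomorphic_on_subset[OF hol_\<tau>]) auto
        then have "((\<lambda>t. F z t / (t - \<tau>)) has_contour_integral (2 * of_real pi * \<i> * F z \<tau>)) (circlepath w \<rho>)"
          using \<tau> by (intro Cauchy_integral_circlepath_simple) (auto simp: dist_norm norm_minus_commute)
        then show "contour_integral (circlepath w \<rho>) (\<lambda>t. F z t / (t - \<tau>)) = 2 * pi * \<i> * F z \<tau>"
          by (simp add: contour_integral_unique)
      qed
      also have "\<dots> = 2 * pi * \<i> * G \<tau>"
      proof -
        have "\<tau> \<in> U" using \<tau> \<rho> by auto
        have "continuous_on (sphere 0 r) ((\<lambda>(z, \<tau>). F z \<tau>) \<circ> (\<lambda>z. (z, \<tau>)))"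
          by (intro continuous_on_compose continuous_intros continuous_on_subset[OF contF]) (use \<open>\<tau> \<in> U\<close> in auto)
        then have "(\<lambda>z. F z \<tau>) contour_integrable_on circlepath 0 r"
          by (intro contour_integrable_continuous_circlepath) (use r in \<open>simp add: o_def\<close>)
        then show ?thesis unfolding G_def by (simp add: contour_integral_lmul)
      qed
      finally have "contour_integral (circlepath w \<rho>) (\<lambda>t. G t / (t - \<tau>) ^ 1) = 2 * pi * \<i> * G \<tau>" by simp
      moreover have "(\<lambda>t. G t / (t - \<tau>) ^ 1) contour_integrable_on circlepath w \<rho>"
        by (intro contour_integrable_continuous_circlepath continuous_intros continuous_on_subset[OF contG sub])
           (use ne \<rho> in auto)
      ultimately show ?thesis by (metis has_contour_integral_integral)
    qed
    have "((\<lambda>\<tau>. 2 * pi * \<i> * G \<tau>) has_field_derivative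
        (of_nat 1 * contour_integral (circlepath w \<rho>) (\<lambda>u. G u / (u - w) ^ Suc 1))) (at w)"
      by (rule Cauchy_next_derivative_circlepath(2)[OF _ swapped])
         (use contG sub continuous_on_subset \<rho> in auto)
    from DERIV_cmult[OF this, of "1 / (2 * pi * \<i>)"] show ?thesis by (auto simp: field_simps)
  qed
  then have "G holomorphic_on U" using U by (auto simp: holomorphic_on_open)
  then have "(\<lambda>\<tau>. fact n / (2 * pi * \<i>) * G \<tau>) holomorphic_on U" by (intro holomorphic_intros) auto
  then show ?thesis by (rule holomorphic_transform) (use G in auto)
qed

section \<open>Almost holomorphic completion of the Taylor coefficients\<close>

text \<open>The factorial is left out: this is \<open>n!\<close> times the coefficient of \<open>z^(n - N)\<close> in the Laurent expansion of \<open>\<phi>\<close>.\<close>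

definition laurent_coeff :: "nat \<Rightarrow> nat \<Rightarrow> nat \<Rightarrow> complex \<Rightarrow> complex" where
  "laurent_coeff M N n \<tau> = (deriv ^^ n) (\<lambda>z. regular_part M N 0 1 z \<tau>) 0"

definition completed_coeff :: "nat \<Rightarrow> nat \<Rightarrow> int \<Rightarrow> int \<Rightarrow> nat \<Rightarrow> complex \<Rightarrow> complex" where
  "completed_coeff M N c d n \<tau> = (deriv ^^ n) (\<lambda>z. completed_part M N c d z \<tau>) 0"

text \<open>The value is \<open>n!/(n/2)!\<close> for even \<open>n\<close> and \<open>0\<close> for odd \<open>n\<close>; the recursion comes from \<open>f' = 2\<alpha>z f\<close>.\<close>

fun gauss_coeff :: "nat \<Rightarrow> complex" where
  "gauss_coeff 0 = 1"
| "gauss_coeff (Suc 0) = 0"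
| "gauss_coeff (Suc (Suc n)) = 2 * of_nat (Suc n) * gauss_coeff n"

lemma higher_deriv_gauss:
  "(deriv ^^ n) (\<lambda>z. exp (\<alpha> * z\<^sup>2)) 0 = gauss_coeff n * \<alpha> ^ (n div 2)"
proof -
  define f where "f = (\<lambda>z::complex. exp (\<alpha> * z\<^sup>2))"
  have hol: "f holomorphic_on UNIV" unfolding f_def by (intro holomorphic_intros)
  have d: "deriv f = (\<lambda>z. (2 * \<alpha> * z) * f z)"
    unfolding f_def by (rule ext, rule DERIV_imp_deriv) (auto intro!: derivative_eq_intros)
  have step: "(deriv ^^ Suc (Suc n)) f 0 = 2 * \<alpha> * of_nat (Suc n) * (deriv ^^ n) f 0" for n
  proof -
    have "(deriv ^^ Suc (Suc n)) f 0 = (deriv ^^ Suc n) (\<lambda>z. (2 * \<alpha> * z) * f z) 0"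
      by (simp only: funpow_Suc_right o_def d)
    also have "\<dots> = (\<Sum>i = 0..Suc n. of_nat (Suc n choose i) * (deriv ^^ i) (\<lambda>z. 2 * \<alpha> * z) 0 * (deriv ^^ (Suc n - i)) f 0)"
      by (intro higher_deriv_mult[of _ UNIV] hol holomorphic_intros) auto
    also have "\<dots> = (\<Sum>i \<in> {1}. of_nat (Suc n choose i) * (deriv ^^ i) (\<lambda>z. 2 * \<alpha> * z) 0 * (deriv ^^ (Suc n - i)) f 0)"
      by (rule sum.mono_neutral_right) (auto simp: higher_deriv_linear)
    also have "\<dots> = of_nat (Suc n choose 1) * (deriv ^^ 1) (\<lambda>z. 2 * \<alpha> * z) 0 * (deriv ^^ (Suc n - 1)) f 0"
      by simp
    also have "(deriv ^^ 1) (\<lambda>z. 2 * \<alpha> * z) 0 = 2 * \<alpha>"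
      by (simp only: higher_deriv_linear) simp
    finally show ?thesis by (simp only: binomial_1 One_nat_def diff_Suc_Suc minus_nat.diff_0 mult_ac)
  qed
  have "(deriv ^^ n) f 0 = gauss_coeff n * \<alpha> ^ (n div 2)"
  proof (induction n rule: gauss_coeff.induct)
    case 1
    then show ?case by (simp add: f_def)
  next
    case 2
    then show ?case by (simp add: d)
  next
    case (3 n)
    then show ?case by (simp only: step) (simp add: mult_ac)
  qed
  then show ?thesis by (simp only: f_def)
qed

text \<open>On a half plane \<open>Im \<tau> > s\<close> with \<open>s > 0\<close> one circle around \<open>0\<close> avoids all other lattice points, so the Cauchy integral
over a fixed path applies.\<close>

lemma laurent_coeff_holomorphic: "laurent_coeff M N n holomorphic_on upper_half_plane"
proof -
  have loc: "laurent_coeff M N n holomorphic_on {\<tau>. Im \<tau> > s}" if s: "s > 0" for s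
  proof -
    define U where "U = {\<tau>. Im \<tau> > s}"
    define r where "r = min 1 s / 2"
    have r: "r > 0" using s by (simp add: r_def)
    have U: "U \<subseteq> upper_half_plane" using s by (auto simp: U_def upper_half_plane_def)
    have rU: "r < min 1 (Im \<tau>)" if "\<tau> \<in> U" for \<tau> using that s by (auto simp: U_def r_def min_def)
    have nz: "theta_over_z z \<tau> \<noteq> 0" if "norm z \<le> r" "\<tau> \<in> U" for z \<tau>
      by (rule theta_over_z_nonzero_near_0) (use that U rU[OF that(2)] in auto)
    have "(\<lambda>\<tau>. (deriv ^^ n) (\<lambda>z. regular_part M N 0 1 z \<tau>) 0) holomorphic_on U"
    proof (rule parametric_higher_deriv_holomorphic[OF _ r])
      show "open U" unfolding U_def by (rule open_halfspace_Im_gt)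
      show "continuous_on (cball 0 r \<times> U) (\<lambda>(z, \<tau>). regular_part M N 0 1 z \<tau>)"
        unfolding regular_part_def theta_shift_def case_prod_unfold
        by (intro continuous_intros theta_continuous theta_over_z_continuous) (use U nz in auto)
      show "(\<lambda>z. regular_part M N 0 1 z \<tau>) holomorphic_on ball 0 r" if "\<tau> \<in> U" for \<tau>
        by (rule holomorphic_on_subset[OF regular_part_holomorphic_ball]) (use that U rU[OF that] in auto)
      show "regular_part M N 0 1 z holomorphic_on U" if "z \<in> sphere 0 r" for z
      proof -
        have "(\<lambda>\<tau>. jacobi_theta (z + 1 / 2) \<tau> ^ M / theta_over_z z \<tau> ^ N) holomorphic_on U"
          by (intro holomorphic_intros holomorphic_on_subset[OF theta_holomorphic_tau U] holomorphic_on_subset[OF theta_over_z_holomorphic_tau U])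
             (use nz that in auto)
        moreover have "regular_part M N 0 1 z = (\<lambda>\<tau>. jacobi_theta (z + 1 / 2) \<tau> ^ M / theta_over_z z \<tau> ^ N)"
          by (rule ext) (simp add: regular_part_def theta_shift_01)
        ultimately show ?thesis by (simp only:)
      qed
    qed
    moreover have "laurent_coeff M N n = (\<lambda>\<tau>. (deriv ^^ n) (\<lambda>z. regular_part M N 0 1 z \<tau>) 0)"
      by (rule ext) (rule laurent_coeff_def)
    ultimately show ?thesis by (simp only: U_def)
  qed
  have "laurent_coeff M N n analytic_on upper_half_plane"
    unfolding analytic_on_def
  proof
    fix \<tau> assume "\<tau> \<in> upper_half_plane"
    then have s: "Im \<tau> / 2 > 0" "\<tau> \<in> {t. Im t > Im \<tau> / 2}" by (auto simp: upper_half_plane_def)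
    have "open {t. Im t > Im \<tau> / 2}" by (rule open_halfspace_Im_gt)
    then obtain e where e: "e > 0" "ball \<tau> e \<subseteq> {t. Im t > Im \<tau> / 2}"
      using open_contains_ball[THEN iffD1, rule_format] s(2) by metis
    show "\<exists>e>0. laurent_coeff M N n holomorphic_on ball \<tau> e"
      using e(1) holomorphic_on_subset[OF loc[OF s(1)] e(2)] by blast
  qed
  then show ?thesis by (rule analytic_imp_holomorphic)
qed

text \<open>By the Leibniz rule every two derivatives falling on the Gaussian contribute one power of \<open>1/Im \<tau>\<close>; the term without
derivatives on it is the holomorphic coefficient.\<close>

lemma completed_coeff_expansion:
  "\<exists>p h. inverse_Im_expansion p h (completed_coeff M N 0 1 n) \<and> h 0 = laurent_coeff M N n"
proof -
  define \<beta> where "\<beta> = complex_of_real (pi * (real M - real N) / 2)"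
  define t where "t = (\<lambda>i \<tau>. of_nat (n choose i) * (gauss_coeff i * \<beta> ^ (i div 2)) * laurent_coeff M N (n - i) \<tau>)"
  define h where "h = (\<lambda>j \<tau>. \<Sum>i | i \<in> {0..n} \<and> i div 2 = j. t i \<tau>)"
  have "completed_coeff M N 0 1 n \<tau> = (\<Sum>j\<le>n. h j \<tau> / of_real (Im \<tau>) ^ j)" if \<tau>: "\<tau> \<in> upper_half_plane" for \<tau>
  proof -
    define y where "y = complex_of_real (Im \<tau>)"
    have pos: "min 1 (Im \<tau>) > 0" using \<tau> by (simp add: upper_half_plane_def)
    have "completed_coeff M N 0 1 n \<tau> = (deriv ^^ n) (\<lambda>z. exp (\<beta> / y * z\<^sup>2) * regular_part M N 0 1 z \<tau>) 0"
      by (simp only: completed_coeff_def completed_part_def \<beta>_def y_def)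
    also have "\<dots> = (\<Sum>i = 0..n. of_nat (n choose i) * (deriv ^^ i) (\<lambda>z. exp (\<beta> / y * z\<^sup>2)) 0 * (deriv ^^ (n - i)) (\<lambda>z. regular_part M N 0 1 z \<tau>) 0)"
      by (rule higher_deriv_mult[of _ "ball 0 (min 1 (Im \<tau>))"])
         (use pos in \<open>auto intro!: holomorphic_intros regular_part_holomorphic_ball[OF \<tau>]\<close>)
    also have "\<dots> = (\<Sum>i = 0..n. t i \<tau> / y ^ (i div 2))"
      unfolding higher_deriv_gauss laurent_coeff_def[symmetric] t_def by (simp add: power_divide mult_ac)
    also have "\<dots> = (\<Sum>j\<le>n. \<Sum>i | i \<in> {0..n} \<and> i div 2 = j. t i \<tau> / y ^ (i div 2))"
      by (rule sum.group[symmetric]) auto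
    also have "\<dots> = (\<Sum>j\<le>n. h j \<tau> / y ^ j)"
      unfolding h_def sum_divide_distrib by (intro sum.cong refl) auto
    finally show ?thesis by (simp only: y_def)
  qed
  moreover have "h j holomorphic_on upper_half_plane" for j
    unfolding h_def t_def by (intro holomorphic_intros laurent_coeff_holomorphic)
  moreover have "h 0 = laurent_coeff M N n"
  proof
    fix \<tau>
    have "h 0 \<tau> = (\<Sum>i\<in>{0}. t i \<tau>)"
      unfolding h_def
    proof (rule sum.mono_neutral_right)
      show "\<forall>i\<in>{i \<in> {0..n}. i div 2 = 0} - {0}. t i \<tau> = 0"
      proof
        fix i assume "i \<in> {i \<in> {0..n}. i div 2 = 0} - {0}"
        then have "i = Suc 0" by auto
        then show "t i \<tau> = 0" by (simp add: t_def)
      qed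
    qed auto
    then show "h 0 \<tau> = laurent_coeff M N n \<tau>" by (simp add: t_def)
  qed
  ultimately show ?thesis
    by (intro exI[of _ n] exI[of _ h]) (auto simp: inverse_Im_expansion_def)
qed

lemma completed_part_reduce:
  "\<exists>u. norm u = 1 \<and> (\<forall>\<tau>\<in>upper_half_plane. \<forall>z. completed_part M N c d z \<tau> = u * completed_part M N (c mod 2) (d mod 2) z \<tau>)"
proof -
  obtain u where "norm u = 1" "\<forall>\<tau>\<in>upper_half_plane. \<forall>z. regular_part M N c d z \<tau> = u * regular_part M N (c mod 2) (d mod 2) z \<tau>"
    using regular_part_reduce by blast
  then show ?thesis by (intro exI[of _ u]) (auto simp: completed_part_def)
qed

lemma completed_coeff_scale:
  assumes \<tau>: "\<tau> \<in> upper_half_plane"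
  shows "(deriv ^^ n) (\<lambda>z. u * completed_part M N c d z \<tau>) 0 = u * completed_coeff M N c d n \<tau>"
  unfolding completed_coeff_def
proof (rule higher_deriv_cmult[of _ "ball 0 (min 1 (Im \<tau>))"])
  show "0 \<in> ball 0 (min 1 (Im \<tau>))" using \<tau> by (simp add: upper_half_plane_def)
qed (rule completed_part_holomorphic_ball[OF \<tau>], rule open_ball)

text \<open>Rescaling \<open>z\<close> by \<open>c\<tau> + d\<close> raises the weight of the \<open>n\<close>-th coefficient by \<open>n\<close>. The constant \<open>w\<close> is the same for all \<open>n\<close>.\<close>

lemma completed_coeff_transform:
  assumes A: "A \<in> carrier SL2Z"
  shows "\<exists>w. norm w = 1 \<and> (\<forall>n. \<forall>\<tau>\<in>upper_half_plane. completed_coeff M N 0 1 n (mob A \<tau>)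
     = w * aut_factor ((real M - real N) / 2 - real N + real n) A \<tau> * completed_coeff M N (A $ 2 $ 1 mod 2) (A $ 2 $ 2 mod 2) n \<tau>)"
proof -
  define k where "k = (real M - real N) / 2 - real N"
  define c d where "c = A $ 2 $ 1" and "d = A $ 2 $ 2"
  obtain w where w: "norm w = 1" "\<And>\<tau> z. \<tau>\<in>upper_half_plane \<Longrightarrow> completed_part M N 0 1 (z / mob_denom A \<tau>) (mob A \<tau>)
     = w * mob_denom A \<tau> powr of_real k * completed_part M N c d z \<tau>"
    using completed_part_transform[OF A, of M N] unfolding k_def c_def d_def by blast
  obtain u where u: "norm u = 1" "\<And>\<tau> z. \<tau>\<in>upper_half_plane \<Longrightarrow> completed_part M N c d z \<tau> = u * completed_part M N (c mod 2) (d mod 2) z \<tau>"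
    using completed_part_reduce[of M N c d] by blast
  have "completed_coeff M N 0 1 n (mob A \<tau>) = (w * u) * aut_factor (k + real n) A \<tau> * completed_coeff M N (c mod 2) (d mod 2) n \<tau>"
    if \<tau>: "\<tau> \<in> upper_half_plane" for n \<tau>
  proof -
    define J where "J = mob_denom A \<tau>"
    have J: "J \<noteq> 0" using mob_denom_nonzero[OF A \<tau>] by (simp add: J_def)
    have A\<tau>: "mob A \<tau> \<in> upper_half_plane" by (rule mob_upper_half_plane[OF A \<tau>])
    define R where "R = min 1 (Im (mob A \<tau>))"
    have R: "R > 0" using A\<tau> by (simp add: R_def upper_half_plane_def)
    have "(deriv ^^ n) (\<lambda>z. completed_part M N 0 1 (1 / J * z) (mob A \<tau>)) 0 = (1 / J) ^ n * (deriv ^^ n) (\<lambda>z. completed_part M N 0 1 z (mob A \<tau>)) (1 / J * 0)"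
    proof (rule higher_deriv_compose_linear[where S = "ball 0 (R * norm J)" and T = "ball 0 R"])
      show "(\<lambda>z. completed_part M N 0 1 z (mob A \<tau>)) holomorphic_on ball 0 R"
        unfolding R_def by (rule completed_part_holomorphic_ball[OF A\<tau>])
    qed (use R J in \<open>auto simp: norm_divide divide_less_eq\<close>)
    then have "(1 / J) ^ n * completed_coeff M N 0 1 n (mob A \<tau>) = (deriv ^^ n) (\<lambda>z. completed_part M N 0 1 (z / J) (mob A \<tau>)) 0"
      by (simp add: completed_coeff_def)
    also have "\<dots> = (deriv ^^ n) (\<lambda>z. (w * J powr of_real k * u) * completed_part M N (c mod 2) (d mod 2) z \<tau>) 0"
      unfolding J_def w(2)[OF \<tau>] u(2)[OF \<tau>] by (simp only: mult.assoc)
    also have "\<dots> = (w * J powr of_real k * u) * completed_coeff M N (c mod 2) (d mod 2) n \<tau>"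
      by (rule completed_coeff_scale[OF \<tau>])
    finally have "completed_coeff M N 0 1 n (mob A \<tau>) = (w * u) * (J powr of_real k * J ^ n) * completed_coeff M N (c mod 2) (d mod 2) n \<tau>"
      using J by (simp add: field_simps)
    also have "J powr of_real k * J ^ n = aut_factor (k + real n) A \<tau>"
      using J unfolding aut_factor_denom J_def[symmetric] by (simp add: powr_def distrib_right exp_add exp_of_nat_mult)
    finally show ?thesis .
  qed
  then show ?thesis using w(1) u(1) unfolding k_def[symmetric] c_def[symmetric] d_def[symmetric]
    by (intro exI[of _ "w * u"]) (auto simp: norm_mult)
qed

section \<open>Growth at the cusps\<close>

lemma continuous_bounded_on_compact:
  fixes f :: "'a::topological_space \<Rightarrow> complex"
  assumes "compact K" "continuous_on K f"
  shows "\<exists>B. \<forall>x\<in>K. norm (f x) \<le> B"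
  using compact_imp_bounded[OF compact_continuous_image[OF assms(2,1)]] by (auto simp: bounded_iff)

lemma theta_shift_0_bound:
  "\<exists>K. \<forall>z \<tau>. norm z \<le> 1 / 2 \<longrightarrow> Im \<tau> \<ge> 1 \<longrightarrow> norm (theta_shift 0 d z \<tau>) \<le> K"
proof -
  define f where "f = (\<lambda>(z, q). e2pi (- 1 / 2) (z + of_int d / 2) * qpoch_inf q q * qpoch_inf (e2pi 1 (z + of_int d / 2)) q
      * qpoch_inf (inverse (e2pi 1 (z + of_int d / 2)) * q) q)"
  define K where "K = cball (0::complex) (1 / 2) \<times> cball (0::complex) (exp (- 2 * pi))"
  have "continuous_on K f"
    unfolding f_def case_prod_unfold
    by (intro continuous_intros) (auto simp: K_def intro: order.strict_trans1)
  moreover have "compact K" unfolding K_def by (intro compact_Times compact_cball)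
  ultimately obtain B where "\<forall>x\<in>K. norm (f x) \<le> B"
    using continuous_bounded_on_compact[of K f] by blast
  then have B: "\<And>x. x \<in> K \<Longrightarrow> norm (f x) \<le> B" by blast
  have "norm (theta_shift 0 d z \<tau>) \<le> B" if "norm z \<le> 1 / 2" "Im \<tau> \<ge> 1" for z \<tau>
  proof -
    have "(z, e2pi 1 \<tau>) \<in> K" using that by (simp add: K_def norm_e2pi)
    then have "norm (f (z, e2pi 1 \<tau>)) \<le> B" by (rule B)
    moreover have "norm (theta_shift 0 d z \<tau>) = norm (e2pi (1 / 8) \<tau>) * norm (f (z, e2pi 1 \<tau>))"
      by (simp add: theta_shift_def jacobi_theta_def f_def Let_def norm_mult)
    moreover have "norm (e2pi (1 / 8) \<tau>) \<le> 1" using that by (simp add: norm_e2pi)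
    then have "norm (e2pi (1 / 8) \<tau>) * norm (f (z, e2pi 1 \<tau>)) \<le> 1 * norm (f (z, e2pi 1 \<tau>))"
      by (rule mult_right_mono) simp
    ultimately show ?thesis by linarith
  qed
  then show ?thesis by blast
qed

text \<open>With \<open>p = q^(1/2)\<close> the exponential prefactors have total modulus \<open>1\<close>, and the remaining products are continuous
functions of \<open>(z, p)\<close> on a compact set that contains \<open>p = 0\<close>, i.e. the cusp.\<close>

lemma theta_shift_1_bound:
  "\<exists>K. \<forall>z \<tau>. norm z \<le> 1 / 2 \<longrightarrow> Im \<tau> \<ge> 1 \<longrightarrow> norm (theta_shift 1 d z \<tau>) \<le> K"
proof -
  define f where "f = (\<lambda>(z, p). qpoch_inf (p\<^sup>2) (p\<^sup>2) * qpoch_inf (e2pi 1 (z + of_int d / 2) * p) (p\<^sup>2)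
      * qpoch_inf (inverse (e2pi 1 (z + of_int d / 2)) * p) (p\<^sup>2))"
  define K where "K = cball (0::complex) (1 / 2) \<times> cball (0::complex) (exp (- pi))"
  have "continuous_on K f"
    unfolding f_def case_prod_unfold
    by (intro continuous_intros)
       (auto simp: K_def norm_power power_less_one_iff intro: order.strict_trans1)
  moreover have "compact K" unfolding K_def by (intro compact_Times compact_cball)
  ultimately obtain B where "\<forall>x\<in>K. norm (f x) \<le> B"
    using continuous_bounded_on_compact[of K f] by blast
  then have B: "\<And>x. x \<in> K \<Longrightarrow> norm (f x) \<le> B" by blast
  have "norm (theta_shift 1 d z \<tau>) \<le> B" if "norm z \<le> 1 / 2" "Im \<tau> \<ge> 1" for z \<tau>
  proof -
    define p where "p = e2pi (1 / 2) \<tau>"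
    have p: "e2pi 1 \<tau> = p\<^sup>2" "p \<noteq> 0" by (simp_all add: p_def e2pi_power)
    have "z + (\<tau> + of_int d) / 2 = (z + of_int d / 2) + \<tau> / 2" by (simp add: field_simps)
    then have "e2pi 1 (z + (\<tau> + of_int d) / 2) = e2pi 1 (z + of_int d / 2) * e2pi 1 (\<tau> / 2)"
      by (simp only: e2pi_add_right)
    also have "e2pi 1 (\<tau> / 2) = p" by (simp add: p_def e2pi_def mult_ac)
    finally have e: "e2pi 1 (z + (\<tau> + of_int d) / 2) = e2pi 1 (z + of_int d / 2) * p" .
    have i: "inverse (e2pi 1 (z + of_int d / 2) * p) * p\<^sup>2 = inverse (e2pi 1 (z + of_int d / 2)) * p"
      using p by (simp add: power2_eq_square)
    have "(z, p) \<in> K" using that by (simp add: K_def p_def norm_e2pi)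
    then have "norm (f (z, p)) \<le> B" by (rule B)
    moreover have "norm (e2pi (1 / 2) z * e2pi (1 / 8) \<tau> * e2pi (- 1 / 2) (z + (\<tau> + of_int d) / 2) * e2pi (1 / 8) \<tau>) = 1"
      unfolding norm_mult norm_e2pi exp_add[symmetric] by (simp add: field_simps)
    moreover have "norm (theta_shift 1 d z \<tau>)
        = norm (e2pi (1 / 2) z * e2pi (1 / 8) \<tau> * e2pi (- 1 / 2) (z + (\<tau> + of_int d) / 2) * e2pi (1 / 8) \<tau>) * norm (f (z, p))"
      unfolding theta_shift_def jacobi_theta_def f_def Let_def p(1) of_int_1 mult_1 one_power2 e i prod.case
      by (simp only: norm_mult norm_minus_cancel norm_ii mult_ac mult_1)
    ultimately show ?thesis by simp
  qed
  then show ?thesis by blast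
qed

text \<open>Apart from \<open>q^(1/8)\<close>, which has modulus \<open>exp (-\<pi>/4 Im \<tau>)\<close>, the function is continuous and without zeros in \<open>(z, q)\<close> on
a compact set that contains \<open>q = 0\<close>.\<close>

lemma theta_over_z_lower_bound:
  "\<exists>m>0. \<forall>z \<tau>. norm z \<le> 1 / 2 \<longrightarrow> Im \<tau> \<ge> 1 \<longrightarrow> m * exp (- (pi / 4 * Im \<tau>)) \<le> norm (theta_over_z z \<tau>)"
proof -
  define f where "f = (\<lambda>(z, q). e2pi (- 1 / 2) z * qpoch_inf q q * exp_quotient z * qpoch_inf (e2pi 1 z * q) q
      * qpoch_inf (inverse (e2pi 1 z) * q) q)"
  define K where "K = cball (0::complex) (1 / 2) \<times> cball (0::complex) (exp (- 2 * pi))"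
  have q1: "norm q < 1" if "(z, q) \<in> K" for z q
    using that by (auto simp: K_def intro: order.strict_trans1)
  have eq: "continuous_on K (\<lambda>x. exp_quotient (fst x))"
    by (rule continuous_on_compose2[OF holomorphic_on_imp_continuous_on[OF exp_quotient_holomorphic]])
       (auto intro: continuous_intros)
  have "continuous_on K f"
    unfolding f_def case_prod_unfold using q1
    by (intro continuous_intros eq) auto
  moreover have nz: "f x \<noteq> 0" if "x \<in> K" for x
  proof -
    obtain z q where x: "x = (z, q)" by (cases x)
    have z: "norm z \<le> 1 / 2" and q: "norm q \<le> exp (- 2 * pi)" using that by (auto simp: x K_def)
    have im: "\<bar>Im z\<bar> \<le> 1 / 2" using z abs_Im_le_cmod[of z] by linarith
    have ab: "norm (e2pi 1 z * q) \<le> exp pi * exp (- 2 * pi)" "norm (inverse (e2pi 1 z) * q) \<le> exp pi * exp (- 2 * pi)"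
    proof -
      have "norm (e2pi 1 z) \<le> exp pi" "norm (inverse (e2pi 1 z)) \<le> exp pi"
        unfolding norm_inverse norm_e2pi exp_minus[symmetric] exp_le_cancel_iff
        using im mult_left_mono[of "\<bar>Im z\<bar>" "1/2" pi] abs_ge_self[of "Im z"] abs_ge_minus_self[of "Im z"]
          mult_left_mono[of "Im z" "1/2" pi] mult_left_mono[of "- Im z" "1/2" pi] by simp_all
      then show "norm (e2pi 1 z * q) \<le> exp pi * exp (- 2 * pi)" "norm (inverse (e2pi 1 z) * q) \<le> exp pi * exp (- 2 * pi)"
        unfolding norm_mult using mult_mono[OF _ q] by simp_all
    qed
    have lt1: "exp pi * exp (- 2 * pi) < 1" unfolding exp_add[symmetric] by simp
    have "exp_quotient z \<noteq> 0"
    proof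
      assume e0: "exp_quotient z = 0"
      then have "z \<noteq> 0" by (auto simp: exp_quotient_def)
      with e0 have "e2pi 1 z = 1" by (simp add: exp_quotient_def)
      then obtain n where n: "z = of_int n" unfolding e2pi_1_eq_1_iff by (auto simp: Ints_def)
      with z have "\<bar>of_int n :: real\<bar> \<le> 1 / 2" by simp
      then have "n = 0" by linarith
      with n \<open>z \<noteq> 0\<close> show False by simp
    qed
    moreover have ql: "norm q < 1" using q1[of z q] that by (simp add: x)
    moreover note qpoch_nonzero[OF ql ql] qpoch_nonzero[OF ql order.strict_trans1[OF ab(1) lt1]]
      qpoch_nonzero[OF ql order.strict_trans1[OF ab(2) lt1]]
    ultimately show ?thesis by (simp add: f_def x)
  qed
  ultimately have "continuous_on K (\<lambda>x. inverse (f x))" by (intro continuous_intros) auto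
  moreover have "compact K" unfolding K_def by (intro compact_Times compact_cball)
  ultimately obtain B where "\<forall>x\<in>K. norm (inverse (f x)) \<le> B"
    using continuous_bounded_on_compact[of K "\<lambda>x. inverse (f x)"] by blast
  then have B: "\<And>x. x \<in> K \<Longrightarrow> norm (inverse (f x)) \<le> B" by blast
  have B': "1 / max B 1 \<le> norm (f x)" if "x \<in> K" for x
  proof -
    have "1 / norm (f x) \<le> max B 1" using B[OF that] by (simp add: norm_inverse norm_divide inverse_eq_divide)
    then show ?thesis using nz[OF that] by (simp add: field_simps)
  qed
  have "1 / max B 1 * exp (- (pi / 4 * Im \<tau>)) \<le> norm (theta_over_z z \<tau>)" if "norm z \<le> 1 / 2" "Im \<tau> \<ge> 1" for z \<tau>
  proof -
    have "(z, e2pi 1 \<tau>) \<in> K" using that by (simp add: K_def norm_e2pi)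
    then have "1 / max B 1 * exp (- (pi / 4 * Im \<tau>)) \<le> norm (f (z, e2pi 1 \<tau>)) * exp (- (pi / 4 * Im \<tau>))"
      by (intro mult_right_mono B') auto
    also have "\<dots> = norm (theta_over_z z \<tau>)"
      by (simp add: theta_over_z_def f_def norm_mult norm_e2pi)
    finally show ?thesis .
  qed
  moreover have "1 / max B 1 > 0" by simp
  ultimately show ?thesis by blast
qed

text \<open>The Cauchy inequality on the circle of radius \<open>1/2\<close>, on which the numerator is bounded and the denominator decays at
most like a power of \<open>q\<close>.\<close>

lemma completed_coeff_growth:
  assumes c: "c \<in> {0, 1}"
  shows "\<exists>B C. \<forall>\<tau>. Im \<tau> \<ge> 1 \<longrightarrow> norm (completed_coeff M N c d n \<tau>) \<le> C * exp (B * Im \<tau>)"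
proof -
  obtain K where K: "\<And>z \<tau>. norm z \<le> 1 / 2 \<Longrightarrow> Im \<tau> \<ge> 1 \<Longrightarrow> norm (theta_shift c d z \<tau>) \<le> K"
    using theta_shift_0_bound[of d] theta_shift_1_bound[of d] c by blast
  obtain m where m: "m > 0" "\<And>z \<tau>. norm z \<le> 1 / 2 \<Longrightarrow> Im \<tau> \<ge> 1 \<Longrightarrow> m * exp (- (pi / 4 * Im \<tau>)) \<le> norm (theta_over_z z \<tau>)"
    using theta_over_z_lower_bound by blast
  define \<beta> where "\<beta> = complex_of_real (pi * (real M - real N) / 2)"
  define B0 where "B0 = exp (norm \<beta>) * (K ^ M / m ^ N)"
  have "norm (completed_coeff M N c d n \<tau>) \<le> (fact n * B0 / (1 / 2) ^ n) * exp (real N * pi / 4 * Im \<tau>)" if \<tau>: "Im \<tau> \<ge> 1" for \<tau>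
  proof -
    have \<tau>H: "\<tau> \<in> upper_half_plane" using \<tau> by (simp add: upper_half_plane_def)
    have hol: "(\<lambda>z. completed_part M N c d z \<tau>) holomorphic_on ball 0 1"
      using completed_part_holomorphic_ball[OF \<tau>H] \<tau> by (simp add: min_def)
    have le: "norm (completed_part M N c d z \<tau>) \<le> B0 * exp (real N * pi / 4 * Im \<tau>)" if z: "norm z \<le> 1 / 2" for z
    proof -
      have K0: "0 \<le> K" using K[OF z \<tau>] norm_ge_zero order_trans by blast
      have "norm (\<beta> / of_real (Im \<tau>) * z\<^sup>2) = norm \<beta> * ((norm z)\<^sup>2 / Im \<tau>)"
        using \<tau> by (simp add: norm_mult norm_divide norm_power)
      also have "(norm z)\<^sup>2 / Im \<tau> \<le> 1"
        using \<tau> z power_le_one[of "norm z" 2] by (simp add: divide_le_eq)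
      then have "norm \<beta> * ((norm z)\<^sup>2 / Im \<tau>) \<le> norm \<beta> * 1" by (rule mult_left_mono) simp
      finally have "norm (exp (\<beta> / of_real (Im \<tau>) * z\<^sup>2)) \<le> exp (norm \<beta>)"
        by (intro order.trans[OF norm_exp]) simp
      moreover have "norm (regular_part M N c d z \<tau>) \<le> K ^ M / (m * exp (- (pi / 4 * Im \<tau>))) ^ N"
        unfolding regular_part_def norm_divide norm_power
        by (intro frac_le power_mono K m z \<tau>) (use K0 m(1) in auto)
      ultimately have "norm (completed_part M N c d z \<tau>) \<le> exp (norm \<beta>) * (K ^ M / (m * exp (- (pi / 4 * Im \<tau>))) ^ N)"
        unfolding completed_part_def \<beta>_def[symmetric] norm_mult by (intro mult_mono) auto
      also have "\<dots> = B0 * exp (real N * pi / 4 * Im \<tau>)"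
      proof -
        have "exp (- (pi / 4 * Im \<tau>)) ^ N = exp (real N * - (pi / 4 * Im \<tau>))"
          by (rule exp_of_nat_mult[symmetric])
        also have "\<dots> = inverse (exp (real N * pi / 4 * Im \<tau>))"
          by (simp flip: exp_minus)
        finally have e: "exp (- (pi / 4 * Im \<tau>)) ^ N = inverse (exp (real N * pi / 4 * Im \<tau>))" .
        show ?thesis unfolding B0_def power_mult_distrib e by (simp add: field_simps)
      qed
      finally show ?thesis .
    qed
    have "norm (completed_coeff M N c d n \<tau>) \<le> fact n * (B0 * exp (real N * pi / 4 * Im \<tau>)) / (1 / 2) ^ n"
      unfolding completed_coeff_def
    proof (rule Cauchy_inequality)
      show "(\<lambda>z. completed_part M N c d z \<tau>) holomorphic_on ball 0 (1 / 2)" by (rule holomorphic_on_subset[OF hol]) auto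
      show "continuous_on (cball 0 (1 / 2)) (\<lambda>z. completed_part M N c d z \<tau>)"
        by (intro holomorphic_on_imp_continuous_on holomorphic_on_subset[OF hol]) auto
    qed (use le in auto)
    then show ?thesis by (simp add: mult_ac)
  qed
  then show ?thesis by blast
qed

section \<open>The congruence subgroup and the multiplier system\<close>

text \<open>This group fixes the half period \<open>1/2\<close> modulo the lattice, hence \<open>\<theta>(z + 1/2)\<close> up to the automorphy factor.\<close>

definition gamma0_2 :: "(int ^ 2 ^ 2) set" where
  "gamma0_2 = {A \<in> carrier SL2Z. even (A $ 2 $ 1)}"

lemma gamma0_2_SL2Z: "A \<in> gamma0_2 \<Longrightarrow> A \<in> carrier SL2Z"
  by (simp add: gamma0_2_def)

definition adj2 :: "int ^ 2 ^ 2 \<Rightarrow> int ^ 2 ^ 2" where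
  "adj2 A = (\<chi> i j. if i = 1 then (if j = 1 then A $ 2 $ 2 else - (A $ 1 $ 2)) else (if j = 1 then - (A $ 2 $ 1) else A $ 1 $ 1))"

lemma adj2_nth [simp]:
  "adj2 A $ 1 $ 1 = A $ 2 $ 2" "adj2 A $ 1 $ 2 = - (A $ 1 $ 2)"
  "adj2 A $ 2 $ 1 = - (A $ 2 $ 1)" "adj2 A $ 2 $ 2 = A $ 1 $ 1"
  by (simp_all add: adj2_def)

lemma adj2_inverse:
  assumes "A \<in> carrier SL2Z"
  shows "adj2 A \<in> carrier SL2Z" "adj2 A ** A = mat 1"
  using SL2Z_det[OF assms]
  by (simp_all add: SL2Z_def det_2 vec_eq_iff forall_2 matrix_matrix_mult_def sum_2 mat_def algebra_simps)

lemma SL2Z_group: "group SL2Z"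
proof (rule groupI)
  fix A B C :: "int ^ 2 ^ 2"
  assume A: "A \<in> carrier SL2Z"
  show "\<one>\<^bsub>SL2Z\<^esub> \<otimes>\<^bsub>SL2Z\<^esub> A = A" by (simp add: SL2Z_def matrix_mul_lid)
  show "\<exists>B\<in>carrier SL2Z. B \<otimes>\<^bsub>SL2Z\<^esub> A = \<one>\<^bsub>SL2Z\<^esub>"
    using adj2_inverse[OF A] by (auto simp: SL2Z_def)
  assume B: "B \<in> carrier SL2Z"
  show "A \<otimes>\<^bsub>SL2Z\<^esub> B \<in> carrier SL2Z" using A B by (simp add: SL2Z_def det_mul)
  show "A \<otimes>\<^bsub>SL2Z\<^esub> B \<otimes>\<^bsub>SL2Z\<^esub> C = A \<otimes>\<^bsub>SL2Z\<^esub> (B \<otimes>\<^bsub>SL2Z\<^esub> C)"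
    by (simp add: SL2Z_def matrix_mul_assoc)
qed (simp add: SL2Z_def det_I)

lemma gamma0_2_congruence: "congruence_subgroup gamma0_2"
  unfolding congruence_subgroup_def
proof
  interpret group SL2Z by (rule SL2Z_group)
  show "subgroup gamma0_2 SL2Z"
  proof
    show "gamma0_2 \<subseteq> carrier SL2Z" by (auto simp: gamma0_2_def)
    show "\<one>\<^bsub>SL2Z\<^esub> \<in> gamma0_2" using one_closed by (simp add: gamma0_2_def) (simp add: SL2Z_def mat_def)
    fix A B assume A: "A \<in> gamma0_2"
    have "inv\<^bsub>SL2Z\<^esub> A = adj2 A"
      using adj2_inverse[of A] A by (intro inv_equality) (auto simp: gamma0_2_def SL2Z_def)
    then show "inv\<^bsub>SL2Z\<^esub> A \<in> gamma0_2" using A adj2_inverse[of A] by (auto simp: gamma0_2_def)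
    assume B: "B \<in> gamma0_2"
    show "A \<otimes>\<^bsub>SL2Z\<^esub> B \<in> gamma0_2"
      using A B m_closed[of A B] by (simp add: gamma0_2_def) (simp add: SL2Z_def matrix_matrix_mult_def sum_2)
  qed
  have "even (A $ 2 $ 1)" if "\<forall>i j. [A $ i $ j = mat 1 $ i $ j] (mod 2)" for A :: "int ^ 2 ^ 2"
  proof -
    have "[A $ 2 $ 1 = (mat 1 :: int ^ 2 ^ 2) $ 2 $ 1] (mod 2)" using that by blast
    then show ?thesis by (simp add: mat_def cong_0_iff)
  qed
  then show "\<exists>n\<ge>1. \<forall>A\<in>carrier SL2Z. (\<forall>i j. [A $ i $ j = mat 1 $ i $ j] (mod int n)) \<longrightarrow> A \<in> gamma0_2"
    by (intro exI[of _ 2]) (auto simp: gamma0_2_def)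
qed

text \<open>The coefficient of index \<open>0\<close> is \<open>\<theta>(1/2)^M/\<theta>'(0)^N\<close>, and neither value vanishes.\<close>

lemma completed_coeff_0_nonzero:
  assumes \<tau>: "\<tau> \<in> upper_half_plane"
  shows "completed_coeff M N 0 1 0 \<tau> \<noteq> 0"
  using theta_over_z_0_nonzero[OF \<tau>] theta_eq_0_iff[OF \<tau>] half_notin_theta_lattice[OF \<tau>]
  by (simp add: completed_coeff_def completed_part_def regular_part_def theta_shift_01)

text \<open>The cocycle relation of the multiplier system is forced by the coefficient of index \<open>0\<close>, because that function has no
zeros. It carries over to every \<open>n\<close> since the weights differ by integers, for which \<open>(c\<tau> + d)^n\<close> is an exact cocycle.\<close>

lemma completed_coeff_almost_holomorphic:
  "almost_holomorphic_modular_form ((real M - real N) / 2 - real N + real n) gamma0_2 (completed_coeff M N 0 1 n)"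
proof -
  define k where "k = (real M - real N) / 2 - real N"
  have "\<exists>w. norm w = 1 \<and> (\<forall>n. \<forall>\<tau>\<in>upper_half_plane. completed_coeff M N 0 1 n (mob A \<tau>)
     = w * aut_factor (k + real n) A \<tau> * completed_coeff M N 0 1 n \<tau>)" if A: "A \<in> gamma0_2" for A
  proof -
    have SL: "A \<in> carrier SL2Z" and ev: "even (A $ 2 $ 1)" using A by (auto simp: gamma0_2_def)
    have "A $ 1 $ 1 * A $ 2 $ 2 = 1 + A $ 1 $ 2 * A $ 2 $ 1" using SL2Z_det[OF SL] by simp
    then have "odd (A $ 1 $ 1 * A $ 2 $ 2)" using ev by simp
    then have "A $ 2 $ 2 mod 2 = 1" "A $ 2 $ 1 mod 2 = 0" using ev by (auto simp: odd_iff_mod_2_eq_one)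
    then show ?thesis using completed_coeff_transform[OF SL, of M N] by (simp add: k_def)
  qed
  then obtain v where v: "\<And>A. A \<in> gamma0_2 \<Longrightarrow> norm (v A) = 1"
    "\<And>A n \<tau>. A \<in> gamma0_2 \<Longrightarrow> \<tau> \<in> upper_half_plane \<Longrightarrow>
      completed_coeff M N 0 1 n (mob A \<tau>) = v A * aut_factor (k + real n) A \<tau> * completed_coeff M N 0 1 n \<tau>"
    by metis
  have closed: "A ** B \<in> gamma0_2" if "A \<in> gamma0_2" "B \<in> gamma0_2" for A B
    using subgroup.m_closed[of gamma0_2 SL2Z A B] gamma0_2_congruence that
    by (simp add: congruence_subgroup_def) (simp add: SL2Z_def)
  have aut: "aut_factor (k + real n) A \<tau> = aut_factor k A \<tau> * mob_denom A \<tau> ^ n"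
    if "A \<in> carrier SL2Z" "\<tau> \<in> upper_half_plane" for A \<tau>
    using mob_denom_nonzero[OF that] unfolding aut_factor_denom by (simp add: powr_def distrib_right exp_add exp_of_nat_mult)
  have "multiplier_system (k + real n) gamma0_2 v"
    unfolding multiplier_system_def
  proof (intro conjI ballI v(1))
    fix A B \<tau> assume A: "A \<in> gamma0_2" and B: "B \<in> gamma0_2" and \<tau>: "\<tau> \<in> upper_half_plane"
    have AB: "A ** B \<in> gamma0_2" by (rule closed[OF A B])
    have SL: "A \<in> carrier SL2Z" "B \<in> carrier SL2Z" "A ** B \<in> carrier SL2Z"
      by (rule gamma0_2_SL2Z[OF A] gamma0_2_SL2Z[OF B] gamma0_2_SL2Z[OF AB])+
    have B\<tau>: "mob B \<tau> \<in> upper_half_plane" by (rule mob_upper_half_plane[OF SL(2) \<tau>])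
    have "v (A ** B) * aut_factor k (A ** B) \<tau> * completed_coeff M N 0 1 0 \<tau> = completed_coeff M N 0 1 0 (mob A (mob B \<tau>))"
      using v(2)[OF AB \<tau>, of 0] by (simp add: mob_mult[OF SL \<tau>])
    also have "\<dots> = v A * aut_factor k A (mob B \<tau>) * (v B * aut_factor k B \<tau> * completed_coeff M N 0 1 0 \<tau>)"
      using v(2)[OF A B\<tau>, of 0] v(2)[OF B \<tau>, of 0] by simp
    finally have "(v (A ** B) * aut_factor k (A ** B) \<tau>) * completed_coeff M N 0 1 0 \<tau>
        = (v A * v B * aut_factor k A (mob B \<tau>) * aut_factor k B \<tau>) * completed_coeff M N 0 1 0 \<tau>"
      by (simp only: mult_ac)
    then have "v (A ** B) * aut_factor k (A ** B) \<tau> = v A * v B * aut_factor k A (mob B \<tau>) * aut_factor k B \<tau>"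
      using completed_coeff_0_nonzero[OF \<tau>] by simp
    then show "v (A ** B) * aut_factor (k + real n) (A ** B) \<tau>
        = v A * v B * aut_factor (k + real n) A (mob B \<tau>) * aut_factor (k + real n) B \<tau>"
      unfolding aut[OF SL(3) \<tau>] aut[OF SL(1) B\<tau>] aut[OF SL(2) \<tau>] mob_denom_mult[OF SL(1,2) \<tau>] power_mult_distrib
      by (simp only: mult.assoc[symmetric]) (simp only: mult_ac)
  qed
  moreover have "meromorphic_at_cusps (k + real n) (completed_coeff M N 0 1 n)"
    unfolding meromorphic_at_cusps_def
  proof
    fix A assume A: "A \<in> carrier SL2Z"
    obtain w where w: "norm w = 1" "\<And>\<tau>. \<tau>\<in>upper_half_plane \<Longrightarrow> completed_coeff M N 0 1 n (mob A \<tau>)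
       = w * aut_factor (k + real n) A \<tau> * completed_coeff M N (A $ 2 $ 1 mod 2) (A $ 2 $ 2 mod 2) n \<tau>"
      using completed_coeff_transform[OF A, of M N] unfolding k_def by blast
    have "A $ 2 $ 1 mod 2 \<in> {0, 1}" by auto
    from completed_coeff_growth[OF this, of M N "A $ 2 $ 2 mod 2" n]
    obtain B C where BC: "\<And>\<tau>. Im \<tau> \<ge> 1 \<Longrightarrow> norm (completed_coeff M N (A $ 2 $ 1 mod 2) (A $ 2 $ 2 mod 2) n \<tau>) \<le> C * exp (B * Im \<tau>)"
      by blast
    have "norm (completed_coeff M N 0 1 n (mob A \<tau>) / aut_factor (k + real n) A \<tau>) \<le> C * exp (B * Im \<tau>)" if "Im \<tau> \<ge> 1" for \<tau>
    proof -
      have \<tau>: "\<tau> \<in> upper_half_plane" using that by (simp add: upper_half_plane_def)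
      have "aut_factor (k + real n) A \<tau> \<noteq> 0" using mob_denom_nonzero[OF A \<tau>] by (simp add: aut_factor_denom)
      then show ?thesis using BC[OF that] by (simp add: w(2)[OF \<tau>] norm_mult norm_divide w(1))
    qed
    then show "\<exists>B C. \<forall>\<tau>. 1 \<le> Im \<tau> \<longrightarrow> norm (completed_coeff M N 0 1 n (mob A \<tau>) / aut_factor (k + real n) A \<tau>) \<le> C * exp (B * Im \<tau>)"
      by blast
  qed
  moreover have "2 * (k + real n) \<in> \<int>"
  proof -
    have "2 * (k + real n) = of_int (int M - 3 * int N + 2 * int n)" by (simp add: k_def field_simps)
    then show ?thesis by (simp only: Ints_of_int)
  qed
  moreover have "\<exists>p h. inverse_Im_expansion p h (completed_coeff M N 0 1 n)"
    using completed_coeff_expansion by blast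
  ultimately show ?thesis
    unfolding almost_holomorphic_modular_form_def k_def[symmetric] using gamma0_2_congruence v(2) by blast
qed

lemma laurent_coeff_quasimodular: "quasimodular_form (laurent_coeff M N n)"
  unfolding quasimodular_form_def
  using completed_coeff_almost_holomorphic completed_coeff_expansion by metis

section \<open>The Fourier expansion\<close>

lemma exponents_diff:
  assumes "r \<in> exponents M N" "s \<in> exponents M N"
  shows "\<exists>k::int. r - s = of_int k"
proof -
  obtain m n where "r = (real M - real N) / 2 + of_int m" "s = (real M - real N) / 2 + of_int n"
    using assms by (auto simp: exponents_def)
  then have "r - s = of_int (m - n)" by simp
  then show ?thesis by blast
qed

lemma exponents_add_int:
  assumes "r \<in> exponents M N"
  shows "r + of_int k \<in> exponents M N"
proof -
  obtain m where "r = (real M - real N) / 2 + of_int m" using assms by (auto simp: exponents_def)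
  then have "r + of_int k = (real M - real N) / 2 + of_int (m + k)" by simp
  then show ?thesis unfolding exponents_def by blast
qed

definition period_path :: "real \<Rightarrow> real \<Rightarrow> complex" where
  "period_path y = linepath (Complex (- 1 / 2) y) (Complex (1 / 2) y)"

lemma path_image_period: "z \<in> path_image (period_path y) \<Longrightarrow> Im z = y"
  by (auto simp: period_path_def closed_segment_def) (simp add: algebra_simps)

lemma e2pi_contour_integral:
  "((\<lambda>z. e2pi (of_int k) z) has_contour_integral (if k = 0 then 1 else 0)) (period_path y)"
proof (cases "k = 0")
  case True
  have "((\<lambda>z. 1) has_contour_integral (pathfinish (period_path y) - pathstart (period_path y))) (period_path y)"
    by (rule contour_integral_primitive[of UNIV "\<lambda>z. z"]) (auto simp: period_path_def)
  moreover have "pathfinish (period_path y) - pathstart (period_path y) = 1"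
    by (simp add: period_path_def complex_eq_iff)
  ultimately show ?thesis using True by simp
next
  case False
  define F where "F = (\<lambda>z. e2pi (of_int k) z / (2 * of_real pi * \<i> * of_int k))"
  have "((\<lambda>z. e2pi (of_int k) z) has_contour_integral (F (pathfinish (period_path y)) - F (pathstart (period_path y)))) (period_path y)"
    by (rule contour_integral_primitive[of UNIV])
       (use False in \<open>auto simp: period_path_def F_def e2pi_def intro!: derivative_eq_intros\<close>)
  moreover have "F (pathfinish (period_path y)) = F (pathstart (period_path y))"
  proof -
    have "Complex (1 / 2) y = Complex (- 1 / 2) y + 1" by (simp add: complex_eq_iff)
    then have "e2pi (of_int k) (Complex (1 / 2) y) = e2pi (of_int k) (Complex (- 1 / 2) y)"
      using e2pi_of_int[of k 1] by (simp only: e2pi_add_right) simp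
    then show ?thesis by (simp add: F_def period_path_def)
  qed
  ultimately show ?thesis using False by simp
qed

text \<open>On a horizontal line the moduli of the terms do not depend on \<open>z\<close>, so absolute convergence at one point gives uniform
convergence, and the integral over a period picks out a single coefficient. This shows both that the expansion is
unique and that the coefficients are integrals.\<close>

lemma fourier_coefficient:
  assumes sum: "\<And>z. Im z = y \<Longrightarrow> ((\<lambda>r. c r * e2pi r z) has_sum f z) (exponents M N)"
    and s: "s \<in> exponents M N"
  shows "contour_integral (period_path y) (\<lambda>z. f z * e2pi (- s) z) = c s"
proof -
  define X where "X = exponents M N"
  define g where "g = (\<lambda>r z. c r * e2pi (r - s) z)"
  define Mr where "Mr = (\<lambda>r. norm (c r) * exp (- (2 * pi * (r - s) * y)))"
  have gsum: "((\<lambda>r. g r z) has_sum (f z * e2pi (- s) z)) X" if "Im z = y" for z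
  proof -
    have "((\<lambda>r. c r * e2pi r z * e2pi (- s) z) has_sum (f z * e2pi (- s) z)) X"
      unfolding X_def by (rule has_sum_cmult_left[OF sum[OF that]])
    then show ?thesis by (simp add: g_def e2pi_add_left[of _ "- s", simplified] mult.assoc)
  qed
  have norm_g: "norm (g r z) = Mr r" if "Im z = y" for r z
    by (simp add: g_def Mr_def norm_mult norm_e2pi that)
  have "(\<lambda>r. g r (Complex 0 y)) summable_on X"
    using gsum[of "Complex 0 y"] by (auto simp: summable_on_def)
  then have "Mr summable_on X"
    by (simp add: summable_on_iff_abs_summable_on_complex norm_g)
  then have "uniform_limit (path_image (period_path y)) (\<lambda>F z. \<Sum>r\<in>F. g r z) (\<lambda>z. f z * e2pi (- s) z) (finite_subsets_at_top X)"
    by (intro Weierstrass_m_test_general'[where M = Mr]) (auto simp: norm_g path_image_period intro!: gsum)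
  then have lim: "((\<lambda>F. contour_integral (period_path y) (\<lambda>z. \<Sum>r\<in>F. g r z)) \<longlongrightarrow>
      contour_integral (period_path y) (\<lambda>z. f z * e2pi (- s) z)) (finite_subsets_at_top X)"
  proof (rule contour_integral_uniform_limit(2)[rotated])
    show "\<forall>\<^sub>F F in finite_subsets_at_top X. (\<lambda>z. \<Sum>r\<in>F. g r z) contour_integrable_on period_path y"
      unfolding period_path_def g_def
      by (intro always_eventually allI contour_integrable_continuous_linepath continuous_intros)
    show "norm (vector_derivative (period_path y) (at t)) \<le> 1" for t
      by (simp add: period_path_def vector_derivative_linepath_at cmod_def)
  qed (auto simp: period_path_def)
  have int: "contour_integral (period_path y) (g r) = (if r = s then c s else 0)" if "r \<in> X" for r
  proof -
    obtain k where k: "r - s = of_int k" using exponents_diff[OF \<open>r \<in> X\<close>[unfolded X_def] s] by blast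
    have "(g r has_contour_integral (c r * (if k = 0 then 1 else 0))) (period_path y)"
      unfolding g_def k by (intro has_contour_integral_lmul e2pi_contour_integral)
    then show ?thesis using k by (auto simp: contour_integral_unique)
  qed
  have "\<forall>\<^sub>F F in finite_subsets_at_top X. contour_integral (period_path y) (\<lambda>z. \<Sum>r\<in>F. g r z) = c s"
    unfolding eventually_finite_subsets_at_top
  proof (intro exI[of _ "{s}"] conjI allI impI)
    fix F assume F: "finite F \<and> {s} \<subseteq> F \<and> F \<subseteq> X"
    have "contour_integral (period_path y) (\<lambda>z. \<Sum>r\<in>F. g r z) = (\<Sum>r\<in>F. contour_integral (period_path y) (g r))"
      using F unfolding period_path_def g_def
      by (intro contour_integral_sum contour_integrable_continuous_linepath continuous_intros) auto
    also have "\<dots> = (\<Sum>r\<in>F. if r = s then c s else 0)"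
      using F by (intro sum.cong refl int) auto
    also have "\<dots> = c s" using F by (subst sum.delta) auto
    finally show "contour_integral (period_path y) (\<lambda>z. \<Sum>r\<in>F. g r z) = c s" .
  qed (use s in \<open>auto simp: X_def\<close>)
  then have "((\<lambda>F. contour_integral (period_path y) (\<lambda>z. \<Sum>r\<in>F. g r z)) \<longlongrightarrow> c s) (finite_subsets_at_top X)"
    by (rule tendsto_eventually)
  then show ?thesis using tendsto_unique[OF _ lim] by simp
qed

lemma has_sum_product_abs:
  fixes x :: "'a \<Rightarrow> complex" and y :: "'b \<Rightarrow> complex"
  assumes x: "(x has_sum X) A" and y: "(y has_sum Y) B"
  shows "((\<lambda>(i, k). x i * y k) has_sum (X * Y)) (A \<times> B)"
proof (rule has_sum_SigmaI)
  show "((\<lambda>k. case (i, k) of (i, k) \<Rightarrow> x i * y k) has_sum (x i * Y)) B" for i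
    by (simp add: has_sum_cmult_right[OF y])
  show "((\<lambda>i. x i * Y) has_sum X * Y) A" by (rule has_sum_cmult_left[OF x])
  have ax: "(\<lambda>i. norm (x i)) summable_on A" "(\<lambda>k. norm (y k)) summable_on B"
    using has_sum_imp_summable[OF x] has_sum_imp_summable[OF y]
    by (simp_all only: summable_on_iff_abs_summable_on_complex)
  have "(\<lambda>p. norm ((\<lambda>(i, k). x i * y k) p)) summable_on A \<times> B"
    unfolding Infinite_Sum.abs_summable_on_Sigma_iff
    using ax by (simp add: norm_mult summable_on_cmult_right infsum_cmult_right' summable_on_cmult_left abs_mult)
  then show "(\<lambda>(i, k). x i * y k) summable_on A \<times> B"
    by (simp only: summable_on_iff_abs_summable_on_complex)
qed

lemma holomorphic_has_sum:
  assumes "f holomorphic_on ball 0 1" "norm w < 1"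
  shows "((\<lambda>n. (deriv ^^ n) f 0 / fact n * w ^ n) has_sum f w) UNIV"
proof (rule norm_summable_imp_has_sum)
  obtain \<rho> where \<rho>: "norm w < \<rho>" "\<rho> < 1" using assms(2) dense by blast
  have "(\<lambda>n. (deriv ^^ n) f 0 / fact n * (v - 0) ^ n) sums f v" if "norm v < 1" for v
    by (rule holomorphic_power_series[OF assms(1)]) (use that in auto)
  then have s: "(\<lambda>n. (deriv ^^ n) f 0 / fact n * v ^ n) sums f v" if "norm v < 1" for v
    using that by simp
  show "(\<lambda>n. (deriv ^^ n) f 0 / fact n * w ^ n) sums f w" by (rule s) fact
  have \<rho>0: "0 \<le> \<rho>" using \<rho>(1) norm_ge_zero[of w] by linarith
  show "summable (\<lambda>n. norm ((deriv ^^ n) f 0 / fact n * w ^ n))"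
    by (rule powser_insidea[OF sums_summable[OF s[of "of_real \<rho>"]]]) (use \<rho> \<rho>0 in auto)
qed

text \<open>Substituting \<open>i = k + n\<close> in the absolutely convergent double series collects the powers of \<open>w\<close>.\<close>

lemma laurent_product:
  fixes a :: "nat \<Rightarrow> complex"
  assumes "w \<noteq> 0" and 1: "((\<lambda>i. a i * w ^ i) has_sum F) UNIV" and 2: "((\<lambda>k. a k * (inverse w * q) ^ k) has_sum G) UNIV"
  shows "((\<lambda>n::int. (\<Sum>\<^sub>\<infinity>k\<in>{k. int k + n \<ge> 0}. a (nat (int k + n)) * a k * q ^ k) * w powi n) has_sum (F * G)) UNIV"
proof -
  define B where "B = (\<lambda>n::int. {k::nat. int k + n \<ge> 0})"
  define f where "f = (\<lambda>n k. (a (nat (int k + n)) * a k * q ^ k) * w powi n)"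
  have bij: "bij_betw (\<lambda>(n, k). (nat (int k + n), k)) (Sigma UNIV B) (UNIV \<times> UNIV)"
    by (rule bij_betwI[of _ _ _ "\<lambda>(i, k). (int i - int k, k)"]) (auto simp: B_def)
  have eq: "(\<lambda>(i, k). a i * w ^ i * (a k * (inverse w * q) ^ k)) ((\<lambda>(n, k). (nat (int k + n), k)) x) = (case x of (n, k) \<Rightarrow> f n k)"
    if "x \<in> Sigma UNIV B" for x
  proof -
    obtain n k where x: "x = (n, k)" by (cases x)
    have nk: "int k + n \<ge> 0" using that by (simp add: x B_def)
    have "w ^ nat (int k + n) = w powi (int k + n)" using nk by (simp add: power_int_def)
    also have "\<dots> = w ^ k * w powi n" using assms(1) by (simp add: power_int_add)
    finally show ?thesis
      using assms(1) by (simp add: x f_def power_mult_distrib power_inverse field_simps)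
  qed
  have "((\<lambda>(i, k). a i * w ^ i * (a k * (inverse w * q) ^ k)) has_sum (F * G)) (UNIV \<times> UNIV)"
    by (rule has_sum_product_abs[OF 1 2])
  then have "((\<lambda>x. (\<lambda>(i, k). a i * w ^ i * (a k * (inverse w * q) ^ k)) ((\<lambda>(n, k). (nat (int k + n), k)) x)) has_sum (F * G)) (Sigma UNIV B)"
    by (subst has_sum_reindex_bij_betw[OF bij])
  then have sm: "((\<lambda>(n, k). f n k) has_sum (F * G)) (Sigma UNIV B)"
    by (subst (asm) has_sum_cong[OF eq])
  show ?thesis
  proof (rule has_sum_SigmaD[OF sm])
    fix n :: int
    have "f n summable_on B n"
      by (rule summable_on_SigmaD1[where A = UNIV]) (use sm in \<open>auto simp: summable_on_def\<close>)
    then have "(f n has_sum infsum (f n) (B n)) (B n)" by (rule has_sum_infsum)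
    also have "infsum (f n) (B n) = infsum (\<lambda>k. a (nat (int k + n)) * a k * q ^ k) (B n) * w powi n"
      unfolding f_def by (rule infsum_cmult_left')
    finally show "((\<lambda>k. case (n, k) of (n, k) \<Rightarrow> f n k) has_sum
        (\<Sum>\<^sub>\<infinity>k\<in>{k. int k + n \<ge> 0}. a (nat (int k + n)) * a k * q ^ k) * w powi n) (B n)"
      by (simp add: B_def)
  qed
qed

lemma e2pi_of_int_eq: "e2pi (of_int n) z = e2pi 1 z powi n"
  by (cases n rule: int_cases2) (simp_all add: e2pi_power e2pi_minus_left power_int_minus)

text \<open>In terms of \<open>\<zeta>\<close>, up to a constant and a power of \<open>\<zeta>\<close>, \<open>\<phi>\<close> is \<open>A(\<zeta>) A(q/\<zeta>)\<close> for one function \<open>A\<close> that is holomorphic on the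
unit disc, and \<open>0 < Im z < Im \<tau>\<close> says exactly that both arguments lie in this disc.\<close>

lemma fourier_expansion_exists:
  assumes \<tau>: "\<tau> \<in> upper_half_plane"
  shows "\<exists>c. is_fourier_expansion M N \<tau> c"
proof -
  define q where "q = e2pi 1 \<tau>"
  have q: "norm q < 1" using norm_nome[OF \<tau>] by (simp add: q_def)
  define A where "A = (\<lambda>w. qpoch_inf (- w) q ^ M / qpoch_inf w q ^ N)"
  define a where "a = (\<lambda>n. (deriv ^^ n) A 0 / fact n)"
  define K where "K = (- \<i> * e2pi (- 1 / 2) (1 / 2) * e2pi (1 / 8) \<tau> * qpoch_inf q q) ^ M / (- \<i> * e2pi (1 / 8) \<tau> * qpoch_inf q q) ^ N"
  define C where "C = (\<lambda>n::int. (\<Sum>\<^sub>\<infinity>k\<in>{k. int k + n \<ge> 0}. a (nat (int k + n)) * a k * q ^ k))"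
  \<comment> \<open>the exponent in front of \<open>A(\<zeta>) A(q/\<zeta>)\<close>; it is \<open>(M - N)/2\<close> up to an integer\<close>
  define e0 where "e0 = (real N - real M) / 2"
  define c where "c = (\<lambda>r. if r \<in> exponents M N then K * C \<lfloor>r - e0\<rfloor> else 0)"
  have holA: "A holomorphic_on ball 0 1" unfolding A_def
    by (intro holomorphic_intros open_ball) (use q qpoch_nonzero in auto)
  have bij: "bij_betw (\<lambda>n::int. e0 + of_int n) UNIV (exponents M N)"
  proof (rule bij_betwI')
    have e0: "e0 = (real M - real N) / 2 + of_int (int N - int M)" by (simp add: e0_def field_simps)
    show "e0 + of_int n \<in> exponents M N" for n
      unfolding exponents_def e0 by (auto intro!: exI[of _ "int N - int M + n"])
    show "\<exists>n\<in>UNIV. r = e0 + of_int n" if "r \<in> exponents M N" for r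
    proof -
      obtain m where "r = (real M - real N) / 2 + of_int m"
        using \<open>r \<in> exponents M N\<close> by (auto simp: exponents_def)
      then have "r = e0 + of_int (m - (int N - int M))" unfolding e0 by simp
      then show ?thesis by blast
    qed
  qed auto
  have "((\<lambda>r. c r * e2pi r z) has_sum phi M N z \<tau>) (exponents M N)" if z: "0 < Im z" "Im z < Im \<tau>" for z
  proof -
    define \<zeta> where "\<zeta> = e2pi 1 z"
    have \<zeta>: "norm \<zeta> < 1" "\<zeta> \<noteq> 0" using z by (auto simp: \<zeta>_def norm_e2pi)
    have "norm (inverse \<zeta> * q) = exp (- (2 * pi * (Im \<tau> - Im z)))"
      by (simp add: \<zeta>_def q_def norm_mult norm_inverse norm_e2pi algebra_simps flip: exp_minus exp_add)
    then have \<zeta>q: "norm (inverse \<zeta> * q) < 1" using z by simp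
    have "((\<lambda>n::int. C n * \<zeta> powi n) has_sum (A \<zeta> * A (inverse \<zeta> * q))) UNIV"
      unfolding C_def a_def
      by (rule laurent_product[OF \<zeta>(2) holomorphic_has_sum[OF holA \<zeta>(1)] holomorphic_has_sum[OF holA \<zeta>q]])
    from has_sum_cmult_right[OF this, of "K * e2pi e0 z"]
    have "((\<lambda>n::int. K * e2pi e0 z * (C n * \<zeta> powi n)) has_sum (K * e2pi e0 z * (A \<zeta> * A (inverse \<zeta> * q)))) UNIV" .
    moreover have "K * e2pi e0 z * (C n * \<zeta> powi n) = c (e0 + of_int n) * e2pi (e0 + of_int n) z" for n
    proof -
      have "e0 + of_int n \<in> exponents M N" using bij_betwE[OF bij] by blast
      then show ?thesis by (simp add: c_def e2pi_add_left e2pi_of_int_eq \<zeta>_def mult_ac)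
    qed
    moreover have "K * e2pi e0 z * (A \<zeta> * A (inverse \<zeta> * q)) = phi M N z \<tau>"
    proof -
      have h: "e2pi 1 (z + 1 / 2) = - \<zeta>"
        by (simp add: e2pi_add_right \<zeta>_def) (simp add: e2pi_def)
      have num: "jacobi_theta (z + 1 / 2) \<tau> = (- \<i> * e2pi (- 1 / 2) (1 / 2) * e2pi (1 / 8) \<tau> * qpoch_inf q q) * e2pi (- 1 / 2) z
          * (qpoch_inf (- \<zeta>) q * qpoch_inf (- (inverse \<zeta> * q)) q)"
        unfolding jacobi_theta_def Let_def h q_def[symmetric] by (simp add: e2pi_add_right)
      have den: "jacobi_theta z \<tau> = (- \<i> * e2pi (1 / 8) \<tau> * qpoch_inf q q) * e2pi (- 1 / 2) z
          * (qpoch_inf \<zeta> q * qpoch_inf (inverse \<zeta> * q) q)"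
        unfolding jacobi_theta_def Let_def q_def[symmetric] \<zeta>_def[symmetric] by simp
      have ez: "e2pi (- 1 / 2) z ^ M / e2pi (- 1 / 2) z ^ N = e2pi e0 z"
      proof -
        have "e2pi (- 1 / 2) z ^ M / e2pi (- 1 / 2) z ^ N = e2pi (real M * (- 1 / 2) + - (real N * (- 1 / 2))) z"
          by (simp only: e2pi_power e2pi_add_left e2pi_minus_left divide_inverse)
        then show ?thesis by (simp add: e0_def field_simps)
      qed
      have "phi M N z \<tau> = K * (e2pi (- 1 / 2) z ^ M / e2pi (- 1 / 2) z ^ N) * (A \<zeta> * A (inverse \<zeta> * q))"
        unfolding phi_def num den K_def A_def power_mult_distrib by simp
      then show ?thesis unfolding ez by simp
    qed
    ultimately have "((\<lambda>n. c (e0 + of_int n) * e2pi (e0 + of_int n) z) has_sum phi M N z \<tau>) UNIV" by simp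
    then show ?thesis by (subst (asm) has_sum_reindex_bij_betw[OF bij])
  qed
  then have "is_fourier_expansion M N \<tau> c"
    by (auto simp: is_fourier_expansion_def c_def)
  then show ?thesis by blast
qed

lemma chi_expansion:
  assumes \<tau>: "\<tau> \<in> upper_half_plane"
  shows "is_fourier_expansion M N \<tau> (\<lambda>r. chi M N r \<tau>)"
proof -
  have "\<exists>!c. is_fourier_expansion M N \<tau> c"
  proof (rule ex_ex1I[OF fourier_expansion_exists[OF \<tau>]])
    fix c c' assume c: "is_fourier_expansion M N \<tau> c" and c': "is_fourier_expansion M N \<tau> c'"
    have y: "0 < Im \<tau> / 2" "Im \<tau> / 2 < Im \<tau>" using \<tau> by (auto simp: upper_half_plane_def)
    show "c = c'"
    proof
      fix r
      show "c r = c' r"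
      proof (cases "r \<in> exponents M N")
        case True
        have s: "((\<lambda>r. c r * e2pi r z) has_sum phi M N z \<tau>) (exponents M N)"
             "((\<lambda>r. c' r * e2pi r z) has_sum phi M N z \<tau>) (exponents M N)" if "Im z = Im \<tau> / 2" for z
          using c c' y that by (auto simp: is_fourier_expansion_def)
        have "contour_integral (period_path (Im \<tau> / 2)) (\<lambda>z. phi M N z \<tau> * e2pi (- r) z) = c r"
          by (rule fourier_coefficient[OF s(1) True])
        moreover have "contour_integral (period_path (Im \<tau> / 2)) (\<lambda>z. phi M N z \<tau> * e2pi (- r) z) = c' r"
          by (rule fourier_coefficient[OF s(2) True])
        ultimately show ?thesis by simp
      next
        case False
        then show ?thesis using c c' by (auto simp: is_fourier_expansion_def)
      qed
    qed
  qed
  then have "is_fourier_expansion M N \<tau> (THE c. is_fourier_expansion M N \<tau> c)" by (rule theI')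
  moreover have "(\<lambda>r. chi M N r \<tau>) = (THE c. is_fourier_expansion M N \<tau> c)" by (rule ext) (simp add: chi_def)
  ultimately show ?thesis by simp
qed

lemma chi_has_sum:
  assumes "0 < Im z" "Im z < Im \<tau>"
  shows "((\<lambda>r. chi M N r \<tau> * e2pi r z) has_sum phi M N z \<tau>) (exponents M N)"
  using chi_expansion[of \<tau> M N] assms by (auto simp: is_fourier_expansion_def upper_half_plane_def)

section \<open>The recurrence in r\<close>

lemma phi_add_tau:
  assumes \<tau>: "\<tau> \<in> upper_half_plane"
  shows "phi M N z \<tau> = (- 1) ^ N * e2pi (- (real N - real M) / 2) \<tau> * e2pi (- (real N - real M)) z * phi M N (z + \<tau>) \<tau>"
proof -
  define u where "u = e2pi (- 1 / 2) \<tau> * e2pi (- 1) z"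
  have u0: "u \<noteq> 0" by (simp add: u_def)
  have half: "e2pi (- 1) (1 / 2) = - 1"
    using e2pi_minus_left[of 1 "1 / 2"] by (simp add: e2pi_def)
  have n: "jacobi_theta (z + \<tau> + 1 / 2) \<tau> = u * jacobi_theta (z + 1 / 2) \<tau>"
    using theta_add_tau[OF \<tau>, of "z + 1 / 2"] by (simp add: u_def e2pi_add_right half add_ac)
  have d: "jacobi_theta (z + \<tau>) \<tau> = - 1 * u * jacobi_theta z \<tau>"
    using theta_add_tau[OF \<tau>, of z] by (simp add: u_def)
  have "(- 1) ^ N * (u ^ N / u ^ M) * phi M N (z + \<tau>) \<tau> = phi M N z \<tau>"
    unfolding phi_def n d power_mult_distrib using u0 by (simp add: field_simps)
  moreover have "u ^ N / u ^ M = e2pi (- (real N - real M) / 2) \<tau> * e2pi (- (real N - real M)) z"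
  proof -
    have un: "u ^ n = e2pi (real n * (- 1 / 2)) \<tau> * e2pi (real n * (- 1)) z" for n
      by (simp only: u_def power_mult_distrib e2pi_power)
    have "u ^ N / u ^ M = (e2pi (real N * (- 1 / 2)) \<tau> * e2pi (- (real M * (- 1 / 2))) \<tau>) * (e2pi (real N * (- 1)) z * e2pi (- (real M * (- 1))) z)"
      by (simp only: un divide_inverse inverse_mult_distrib e2pi_minus_left[symmetric] mult_ac)
    also have "\<dots> = e2pi (- (real N - real M) / 2) \<tau> * e2pi (- (real N - real M)) z"
      unfolding e2pi_add_left[symmetric] by (simp add: field_simps)
    finally show ?thesis .
  qed
  ultimately show ?thesis by (simp add: mult_ac)
qed

text \<open>The expansion below the real line is the one above it, transported by \<open>z \<mapsto> z + \<tau>\<close>; multiplication by \<open>\<zeta>^(-L)\<close> shifts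
the index.\<close>

lemma lower_strip_expansion:
  fixes M N :: nat
  assumes z: "- Im \<tau> < Im z" "Im z < 0"
  defines "L \<equiv> real N - real M"
  shows "((\<lambda>r. ((- 1) ^ N * e2pi (L / 2 + r) \<tau> * chi M N (r + L) \<tau>) * e2pi r z) has_sum phi M N z \<tau>) (exponents M N)"
proof -
  have \<tau>: "\<tau> \<in> upper_half_plane" using z by (simp add: upper_half_plane_def)
  have "((\<lambda>r. chi M N r \<tau> * e2pi r (z + \<tau>)) has_sum phi M N (z + \<tau>) \<tau>) (exponents M N)"
    by (rule chi_has_sum) (use z in auto)
  from has_sum_cmult_right[OF this, of "(- 1) ^ N * e2pi (- L / 2) \<tau> * e2pi (- L) z"]
  have "((\<lambda>r. (- 1) ^ N * e2pi (- L / 2) \<tau> * e2pi (- L) z * (chi M N r \<tau> * e2pi r (z + \<tau>))) has_sum phi M N z \<tau>) (exponents M N)"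
    unfolding L_def phi_add_tau[OF \<tau>, of M N z, symmetric] .
  moreover have "bij_betw (\<lambda>r. r + L) (exponents M N) (exponents M N)"
  proof (rule bij_betwI')
    have L: "L = of_int (int N - int M)" by (simp add: L_def)
    show "r + L \<in> exponents M N" if "r \<in> exponents M N" for r
      unfolding L by (rule exponents_add_int[OF that])
    show "\<exists>x\<in>exponents M N. r = x + L" if "r \<in> exponents M N" for r
      using exponents_add_int[OF that, of "- (int N - int M)"] unfolding L by (intro bexI) auto
  qed auto
  ultimately have sm: "((\<lambda>r. (- 1) ^ N * e2pi (- L / 2) \<tau> * e2pi (- L) z * (chi M N (r + L) \<tau> * e2pi (r + L) (z + \<tau>))) has_sum phi M N z \<tau>) (exponents M N)"
    by (subst has_sum_reindex_bij_betw)
  have "e2pi (- L / 2) \<tau> * e2pi (- L) z * e2pi (r + L) (z + \<tau>) = e2pi (L / 2 + r) \<tau> * e2pi r z" for r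
    unfolding e2pi_def exp_add[symmetric] by (rule arg_cong[of _ _ exp]) (simp add: field_simps)
  then have "(- 1) ^ N * chi M N (r + L) \<tau> * (e2pi (- L / 2) \<tau> * e2pi (- L) z * e2pi (r + L) (z + \<tau>))
      = (- 1) ^ N * chi M N (r + L) \<tau> * (e2pi (L / 2 + r) \<tau> * e2pi r z)" for r
    by (simp only:)
  then have eq: "(- 1) ^ N * e2pi (- L / 2) \<tau> * e2pi (- L) z * (chi M N (r + L) \<tau> * e2pi (r + L) (z + \<tau>))
      = ((- 1) ^ N * e2pi (L / 2 + r) \<tau> * chi M N (r + L) \<tau>) * e2pi r z" for r
    by (simp only: mult_ac)
  show ?thesis using sm by (subst (asm) has_sum_cong[OF eq])
qed

definition phi_residue :: "nat \<Rightarrow> nat \<Rightarrow> complex \<Rightarrow> real \<Rightarrow> complex" where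
  "phi_residue M N \<tau> r = 2 * of_real pi * \<i> * residue (\<lambda>z. phi M N z \<tau> * e2pi (- r) z) 0"

lemma phi_periodic:
  assumes r: "r \<in> exponents M N"
  shows "phi M N (z + 1) \<tau> * e2pi (- r) (z + 1) = phi M N z \<tau> * e2pi (- r) z"
proof -
  obtain n where n: "r = (real M - real N) / 2 + of_int n" using r by (auto simp: exponents_def)
  have "jacobi_theta (z + 1 + 1 / 2) \<tau> = - 1 * jacobi_theta (z + 1 / 2) \<tau>"
    using theta_add_1[of "z + 1 / 2" \<tau>] by (simp add: add_ac)
  moreover have "jacobi_theta (z + 1) \<tau> = - 1 * jacobi_theta z \<tau>" using theta_add_1 by simp
  ultimately have 1: "phi M N (z + 1) \<tau> = ((- 1) ^ M / (- 1) ^ N) * phi M N z \<tau>"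
    unfolding phi_def by (simp only: power_mult_distrib times_divide_times_eq)
  have "- r = real M * (- (1 / 2)) + real N * (1 / 2) + of_int (- n)" by (simp add: n field_simps)
  then have "e2pi (- r) 1 = e2pi (real M * (- (1 / 2))) 1 * e2pi (real N * (1 / 2)) 1 * e2pi (of_int (- n)) (of_int 1)"
    by (simp only: e2pi_add_left of_int_1)
  also have "\<dots> = (- 1) ^ M * (- 1) ^ N"
    unfolding e2pi_power[symmetric] e2pi_of_int e2pi_minus_left by (simp flip: minus_one_e2pi)
  finally have 2: "e2pi (- r) 1 = (- 1) ^ M * (- 1) ^ N" .
  have "((- 1) ^ M / (- 1) ^ N) * ((- 1) ^ M * (- 1) ^ N) = (1::complex)"
    by (cases "even M"; cases "even N") simp_all
  then show ?thesis unfolding 1 e2pi_add_right 2 by (simp add: mult_ac)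
qed

lemma contour_integral_shift:
  assumes "\<And>z. f (z + 1) = f z"
  shows "contour_integral (linepath (a + 1) (b + 1)) f = contour_integral (linepath a b) f"
proof -
  have "linepath (a + 1) (b + 1) x = linepath a b x + 1" for x
    by (simp add: linepath_def algebra_simps scaleR_conv_of_real)
  then show ?thesis using assms by (simp add: contour_integral_integral)
qed

text \<open>The residue theorem on the rectangle of width \<open>1\<close> and height \<open>Im \<tau>\<close> centred at the pole \<open>0\<close>. The vertical sides cancel
by periodicity; the lower and the upper side give Fourier coefficients in the two strips.\<close>

lemma chi_recurrence:
  assumes \<tau>: "\<tau> \<in> upper_half_plane" and r: "r \<in> exponents M N"
  defines "L \<equiv> real N - real M"
  shows "chi M N r \<tau> = (- 1) ^ N * e2pi (L / 2 + r) \<tau> * chi M N (r + L) \<tau> - phi_residue M N \<tau> r"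
proof -
  define y where "y = Im \<tau> / 2"
  have y: "0 < y" "y < Im \<tau>" using \<tau> by (auto simp: y_def upper_half_plane_def)
  define f where "f = (\<lambda>z. phi M N z \<tau> * e2pi (- r) z)"
  define a1 a2 a3 a4 where "a1 = Complex (- 1 / 2) (- y)" and "a2 = Complex (1 / 2) (- y)"
    and "a3 = Complex (1 / 2) y" and "a4 = Complex (- 1 / 2) y"
  have up: "contour_integral (linepath a4 a3) f = chi M N r \<tau>"
    using fourier_coefficient[OF chi_has_sum r, of y \<tau>] y by (simp add: f_def a3_def a4_def period_path_def)
  have low: "contour_integral (linepath a1 a2) f = (- 1) ^ N * e2pi (L / 2 + r) \<tau> * chi M N (r + L) \<tau>"
    using fourier_coefficient[OF lower_strip_expansion r, of "- y" \<tau>] y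
    by (simp add: f_def a1_def a2_def period_path_def L_def)
  \<comment> \<open>an open convex neighbourhood of the rectangle in which 0 is the only lattice point\<close>
  define S where "S = {z. Re z < 1} \<inter> {z. Re z > - 1} \<inter> ({z. Im z < Im \<tau>} \<inter> {z. Im z > - Im \<tau>})"
  have S: "open S" "connected S"
    unfolding S_def
    by (intro open_Int open_halfspace_Re_lt open_halfspace_Re_gt open_halfspace_Im_lt open_halfspace_Im_gt)
       (intro convex_connected convex_Int convex_halfspace_Re_lt convex_halfspace_Re_gt convex_halfspace_Im_lt convex_halfspace_Im_gt)
  have lat: "z = 0" if "z \<in> S" "z \<in> theta_lattice \<tau>" for z
  proof -
    obtain m n where z: "z = of_int m * \<tau> + of_int n"
      using \<open>z \<in> theta_lattice \<tau>\<close> by (auto simp: theta_lattice_def)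
    have "\<bar>of_int m * Im \<tau>\<bar> < 1 * Im \<tau>" using that(1) by (auto simp: S_def z abs_less_iff)
    then have "\<bar>of_int m :: real\<bar> < 1" using y by (simp add: abs_mult)
    then have m: "m = 0" by linarith
    then have "\<bar>of_int n :: real\<bar> < 1" using that(1) by (auto simp: S_def z abs_less_iff)
    then show "z = 0" using m z by simp
  qed
  have hol: "f holomorphic_on S - {0}"
  proof -
    have "(\<lambda>z. regular_part M N 0 1 z \<tau>) holomorphic_on S - {0}"
      by (rule holomorphic_on_subset[OF regular_part_holomorphic[OF \<tau>]]) (use lat in auto)
    then show ?thesis unfolding f_def phi_eq_regular_part[OF \<tau>] by (intro holomorphic_intros) auto
  qed
  have box: "cbox a1 a3 \<subseteq> S" using y by (auto simp: S_def a1_def a3_def in_cbox_complex_iff)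
  have img: "path_image (rectpath a1 a3) = cbox a1 a3 - box a1 a3"
    by (rule path_image_rectpath_cbox_minus_box) (use y in \<open>auto simp: a1_def a3_def\<close>)
  have zero: "0 \<in> box a1 a3" using y by (auto simp: a1_def a3_def in_box_complex_iff)
  have "contour_integral (rectpath a1 a3) f = 2 * pi * \<i> * (\<Sum>p\<in>{0}. winding_number (rectpath a1 a3) p * residue f p)"
  proof (rule Residue_theorem[OF S _ hol])
    show "path_image (rectpath a1 a3) \<subseteq> S - {0}" using img box zero by auto
    show "\<forall>z. z \<notin> S \<longrightarrow> winding_number (rectpath a1 a3) z = 0"
      using box by (intro allI impI winding_number_rectpath_outside) (use y in \<open>auto simp: a1_def a3_def\<close>)
  qed auto
  then have res: "contour_integral (rectpath a1 a3) f = phi_residue M N \<tau> r"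
    using winding_number_rectpath[OF zero] by (simp add: phi_residue_def f_def)
  have rect: "rectpath a1 a3 = linepath a1 a2 +++ linepath a2 a3 +++ linepath a3 a4 +++ linepath a4 a1"
    by (simp add: rectpath_def Let_def a1_def a2_def a3_def a4_def)
  have pi: "path_image (rectpath a1 a3) = closed_segment a1 a2 \<union> closed_segment a2 a3 \<union> closed_segment a3 a4 \<union> closed_segment a4 a1"
    unfolding rect by (simp add: path_image_join Un_assoc)
  have "continuous_on (path_image (rectpath a1 a3)) f"
    using img box zero by (intro holomorphic_on_imp_continuous_on holomorphic_on_subset[OF hol]) auto
  then have cont: "continuous_on (closed_segment a1 a2) f" "continuous_on (closed_segment a2 a3) f"
     "continuous_on (closed_segment a3 a4) f" "continuous_on (closed_segment a4 a1) f"
    unfolding pi by (auto elim!: continuous_on_subset)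
  note ci = cont[THEN contour_integrable_continuous_linepath]
  have "contour_integral (rectpath a1 a3) f = contour_integral (linepath a1 a2) f + (contour_integral (linepath a2 a3) f
       + (contour_integral (linepath a3 a4) f + contour_integral (linepath a4 a1) f))"
    unfolding rect using ci by (simp add: contour_integrable_joinI)
  moreover have "contour_integral (linepath a3 a4) f = - contour_integral (linepath a4 a3) f"
    by (rule contour_integral_reverse_linepath[OF cont(3)])
  moreover have "contour_integral (linepath a4 a1) f = - contour_integral (linepath a1 a4) f"
    by (rule contour_integral_reverse_linepath[OF cont(4)])
  moreover have "contour_integral (linepath (a1 + 1) (a4 + 1)) f = contour_integral (linepath a1 a4) f"
    by (rule contour_integral_shift) (simp add: f_def phi_periodic[OF r])
  moreover have "a1 + 1 = a2" "a4 + 1 = a3" by (simp_all add: a1_def a2_def a3_def a4_def complex_eq_iff)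
  ultimately have "phi_residue M N \<tau> r = contour_integral (linepath a1 a2) f - contour_integral (linepath a4 a3) f"
    unfolding res by simp
  then show ?thesis unfolding up low by simp
qed

lemma higher_deriv_e2pi: "(deriv ^^ k) (e2pi a) = (\<lambda>z. (2 * of_real pi * \<i> * of_real a) ^ k * e2pi a z)"
proof (induction k)
  case (Suc k)
  have "deriv (\<lambda>z. (2 * of_real pi * \<i> * of_real a) ^ k * e2pi a z) = (\<lambda>z. (2 * of_real pi * \<i> * of_real a) ^ Suc k * e2pi a z)"
    unfolding e2pi_def by (rule ext, rule DERIV_imp_deriv) (auto intro!: derivative_eq_intros)
  then show ?case by (simp only: funpow.simps o_def Suc.IH)
qed simp

text \<open>The residue at a pole of order \<open>N = m + 1\<close> is a Taylor coefficient of index \<open>m\<close>, and each derivative of \<open>\<zeta>^(-r)\<close> brings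
in a factor \<open>-2\<pi>ir\<close>; so the residue is a polynomial in \<open>r\<close> of degree at most \<open>m\<close>.\<close>

lemma phi_residue_eq:
  assumes \<tau>: "\<tau> \<in> upper_half_plane"
  shows "phi_residue M (Suc m) \<tau> r = 2 * of_real pi * \<i> *
     (\<Sum>i<Suc m. of_nat (m choose i) / fact m * laurent_coeff M (Suc m) i \<tau> * (- (2 * of_real pi * \<i>) * of_real r) ^ (m - i))"
proof -
  define R where "R = min 1 (Im \<tau>)"
  have R: "R > 0" using \<tau> by (simp add: R_def upper_half_plane_def)
  have hol: "(\<lambda>z. regular_part M (Suc m) 0 1 z \<tau>) holomorphic_on ball 0 R"
    unfolding R_def by (rule regular_part_holomorphic_ball[OF \<tau>])
  have "residue (\<lambda>z. phi M (Suc m) z \<tau> * e2pi (- r) z) 0 = residue (\<lambda>z. (regular_part M (Suc m) 0 1 z \<tau> * e2pi (- r) z) / z ^ Suc m) 0"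
    by (simp add: phi_eq_regular_part[OF \<tau>])
  also have "\<dots> = (deriv ^^ m) (\<lambda>z. regular_part M (Suc m) 0 1 z \<tau> * e2pi (- r) z) 0 / fact m"
    by (rule residue_holomorphic_over_power'[of "ball 0 R"]) (use R hol in \<open>auto intro!: holomorphic_intros\<close>)
  also have "(deriv ^^ m) (\<lambda>z. regular_part M (Suc m) 0 1 z \<tau> * e2pi (- r) z) 0
      = (\<Sum>i = 0..m. of_nat (m choose i) * (deriv ^^ i) (\<lambda>z. regular_part M (Suc m) 0 1 z \<tau>) 0 * (deriv ^^ (m - i)) (e2pi (- r)) 0)"
    by (rule higher_deriv_mult[OF hol, of "e2pi (- r)"]) (use R in \<open>auto intro!: holomorphic_intros\<close>)
  also have "\<dots> = (\<Sum>i<Suc m. of_nat (m choose i) * laurent_coeff M (Suc m) i \<tau> * (- (2 * of_real pi * \<i>) * of_real r) ^ (m - i))"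
    unfolding higher_deriv_e2pi laurent_coeff_def by (intro sum.cong) auto
  finally show ?thesis unfolding phi_residue_def by (simp only: sum_divide_distrib times_divide_eq_left)
qed

section \<open>Solving the recurrence\<close>

lemma chi_iterated:
  assumes \<tau>: "\<tau> \<in> upper_half_plane" and r: "r \<in> exponents M N"
  defines "L \<equiv> real N - real M"
  shows "chi M N r \<tau> = (- 1) ^ (N * K) * e2pi (real K * r + (real K)\<^sup>2 * L / 2) \<tau> * chi M N (r + real K * L) \<tau>
     - (\<Sum>n<K. (- 1) ^ (N * n) * e2pi (real n * r + (real n)\<^sup>2 * L / 2) \<tau> * phi_residue M N \<tau> (r + real n * L))"
proof (induction K)
  case (Suc K)
  have "r + real K * L = r + of_int (int K * (int N - int M))" by (simp add: L_def)
  then have rK: "r + real K * L \<in> exponents M N" using exponents_add_int[OF r] by metis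
  have e: "e2pi (real K * r + (real K)\<^sup>2 * L / 2) \<tau> * e2pi (L / 2 + (r + real K * L)) \<tau>
     = e2pi (real (Suc K) * r + (real (Suc K))\<^sup>2 * L / 2) \<tau>"
    unfolding e2pi_add_left[symmetric] by (rule arg_cong[of _ _ "\<lambda>a. e2pi a \<tau>"]) (simp add: field_simps power2_eq_square)
  have s: "r + real K * L + L = r + real (Suc K) * L" by (simp add: algebra_simps)
  have "(- 1) ^ (N * K) * e2pi (real K * r + (real K)\<^sup>2 * L / 2) \<tau> * chi M N (r + real K * L) \<tau>
     = (- 1) ^ (N * K) * (- 1) ^ N * (e2pi (real K * r + (real K)\<^sup>2 * L / 2) \<tau> * e2pi (L / 2 + (r + real K * L)) \<tau>) * chi M N (r + real K * L + L) \<tau>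
       - (- 1) ^ (N * K) * e2pi (real K * r + (real K)\<^sup>2 * L / 2) \<tau> * phi_residue M N \<tau> (r + real K * L)"
    unfolding chi_recurrence[OF \<tau> rK, folded L_def] by (simp add: algebra_simps)
  then have "(- 1) ^ (N * K) * e2pi (real K * r + (real K)\<^sup>2 * L / 2) \<tau> * chi M N (r + real K * L) \<tau>
     = (- 1) ^ (N * Suc K) * e2pi (real (Suc K) * r + (real (Suc K))\<^sup>2 * L / 2) \<tau> * chi M N (r + real (Suc K) * L) \<tau>
       - (- 1) ^ (N * K) * e2pi (real K * r + (real K)\<^sup>2 * L / 2) \<tau> * phi_residue M N \<tau> (r + real K * L)"
    unfolding e s by (simp add: power_add mult_ac)
  then show ?case using Suc.IH by simp
qed simp

text \<open>The terms of a convergent expansion are bounded, here at the point \<open>z = iy\<close>.\<close>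

lemma chi_bound:
  assumes "0 < y" "y < Im \<tau>"
  shows "\<exists>B. \<forall>r\<in>exponents M N. norm (chi M N r \<tau>) \<le> B * exp (2 * pi * r * y)"
proof -
  have "(\<lambda>r. chi M N r \<tau> * e2pi r (Complex 0 y)) summable_on exponents M N"
    using chi_has_sum[of "Complex 0 y" \<tau> M N] assms by (auto simp: summable_on_def)
  then have s: "(\<lambda>r. norm (chi M N r \<tau> * e2pi r (Complex 0 y))) summable_on exponents M N"
    by (simp only: summable_on_iff_abs_summable_on_complex)
  have "norm (chi M N r \<tau>) \<le> (\<Sum>\<^sub>\<infinity>r\<in>exponents M N. norm (chi M N r \<tau> * e2pi r (Complex 0 y))) * exp (2 * pi * r * y)"
    if "r \<in> exponents M N" for r
  proof -
    have "norm (chi M N r \<tau> * e2pi r (Complex 0 y)) \<le> (\<Sum>\<^sub>\<infinity>r\<in>exponents M N. norm (chi M N r \<tau> * e2pi r (Complex 0 y)))"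
      using finite_sum_le_infsum[OF s, of "{r}"] that by simp
    then have "norm (chi M N r \<tau> * e2pi r (Complex 0 y)) * exp (2 * pi * r * y)
      \<le> (\<Sum>\<^sub>\<infinity>r\<in>exponents M N. norm (chi M N r \<tau> * e2pi r (Complex 0 y))) * exp (2 * pi * r * y)"
      by (rule mult_right_mono) simp
    moreover have "norm (chi M N r \<tau> * e2pi r (Complex 0 y)) * exp (2 * pi * r * y) = norm (chi M N r \<tau>)"
      by (simp add: norm_mult norm_e2pi flip: exp_add)
    ultimately show ?thesis by simp
  qed
  then show ?thesis by blast
qed

lemma gaussian_beats_exponential:
  fixes \<alpha> \<beta> \<gamma> :: real
  assumes "\<gamma> > 0"
  shows "(\<lambda>n::nat. exp (\<alpha> + \<beta> * real n - \<gamma> * (real n)\<^sup>2)) \<longlonglongrightarrow> 0"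
  using assms by real_asymp

text \<open>\<open>\<chi>(r + KL)\<close> grows at most exponentially in \<open>K\<close>, whereas its factor in the iterated recurrence decays like
\<open>|q|^(K^2 L/2)\<close> because \<open>L > 0\<close>. Hence the remainder tends to \<open>0\<close>.\<close>

lemma chi_sums:
  assumes \<tau>: "\<tau> \<in> upper_half_plane" and r: "r \<in> exponents M N" and MN: "M < N"
  defines "L \<equiv> real N - real M"
  shows "(\<lambda>n. (- 1) ^ (N * n) * e2pi (real n * r + (real n)\<^sup>2 * L / 2) \<tau> * phi_residue M N \<tau> (r + real n * L)) sums (- chi M N r \<tau>)"
proof -
  have L: "L > 0" using MN by (simp add: L_def)
  define y where "y = Im \<tau> / 2"
  have y: "0 < y" "y < Im \<tau>" using \<tau> by (auto simp: y_def upper_half_plane_def)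
  obtain B where B: "\<And>r. r \<in> exponents M N \<Longrightarrow> norm (chi M N r \<tau>) \<le> B * exp (2 * pi * r * y)"
    using chi_bound[OF y] by blast
  define T where "T = (\<lambda>K. (- 1) ^ (N * K) * e2pi (real K * r + (real K)\<^sup>2 * L / 2) \<tau> * chi M N (r + real K * L) \<tau>)"
  have "norm (T K) \<le> B * exp (2 * pi * r * y + (2 * pi * L * y - 2 * pi * r * Im \<tau>) * real K - (pi * L * Im \<tau>) * (real K)\<^sup>2)" for K
  proof -
    have "r + real K * L = r + of_int (int K * (int N - int M))" by (simp add: L_def)
    then have rK: "r + real K * L \<in> exponents M N" using exponents_add_int[OF r] by metis
    have "norm (T K) = exp (- (2 * pi * (real K * r + (real K)\<^sup>2 * L / 2) * Im \<tau>)) * norm (chi M N (r + real K * L) \<tau>)"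
      by (simp add: T_def norm_mult norm_power norm_e2pi)
    also have "\<dots> \<le> exp (- (2 * pi * (real K * r + (real K)\<^sup>2 * L / 2) * Im \<tau>)) * (B * exp (2 * pi * (r + real K * L) * y))"
      by (intro mult_left_mono B rK) simp
    also have "\<dots> = B * (exp (- (2 * pi * (real K * r + (real K)\<^sup>2 * L / 2) * Im \<tau>)) * exp (2 * pi * (r + real K * L) * y))"
      by simp
    also have "exp (- (2 * pi * (real K * r + (real K)\<^sup>2 * L / 2) * Im \<tau>)) * exp (2 * pi * (r + real K * L) * y)
       = exp (2 * pi * r * y + (2 * pi * L * y - 2 * pi * r * Im \<tau>) * real K - (pi * L * Im \<tau>) * (real K)\<^sup>2)"
      unfolding exp_add[symmetric] by (rule arg_cong[of _ _ exp]) (simp add: algebra_simps)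
    finally show ?thesis .
  qed
  moreover have "(\<lambda>K. B * exp (2 * pi * r * y + (2 * pi * L * y - 2 * pi * r * Im \<tau>) * real K - (pi * L * Im \<tau>) * (real K)\<^sup>2)) \<longlonglongrightarrow> 0"
    using y L by (intro tendsto_mult_right_zero gaussian_beats_exponential) simp
  ultimately have "T \<longlonglongrightarrow> 0"
    by (intro Lim_null_comparison[of T]) (auto intro!: always_eventually)
  then have "(\<lambda>K. T K - chi M N r \<tau>) \<longlonglongrightarrow> 0 - chi M N r \<tau>" by (intro tendsto_intros)
  moreover have "T K - chi M N r \<tau> = (\<Sum>n<K. (- 1) ^ (N * n) * e2pi (real n * r + (real n)\<^sup>2 * L / 2) \<tau> * phi_residue M N \<tau> (r + real n * L))" for K
    using chi_iterated[OF \<tau> r, of K, folded L_def] by (simp add: T_def)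
  ultimately show ?thesis by (simp add: sums_def)
qed

lemma partial_theta_summable:
  assumes \<tau>: "\<tau> \<in> upper_half_plane" and c: "c > 0" and \<epsilon>: "\<epsilon> \<in> {1, - 1}"
  shows "summable (\<lambda>n. of_real (\<epsilon> ^ n * (real n + a) ^ k) * e2pi (c * (real n + a)\<^sup>2) \<tau>)"
proof (rule summable_norm_cancel)
  define b where "b = 2 * pi * c * Im \<tau>"
  have b: "b > 0" using \<tau> c by (simp add: b_def upper_half_plane_def)
  have "(\<lambda>n. \<bar>real n + a\<bar> ^ k * exp (- (b * (real n + a)\<^sup>2))) \<in> O(\<lambda>n. 1 / real n ^ 2)"
    using b by real_asymp
  then have "summable (\<lambda>n. \<bar>real n + a\<bar> ^ k * exp (- (b * (real n + a)\<^sup>2)))"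
    by (rule summable_comparison_test_bigo[rotated]) (use inverse_power_summable[of 2, where 'a = real] in \<open>simp add: field_simps\<close>)
  moreover have "norm (of_real (\<epsilon> ^ n * (real n + a) ^ k) * e2pi (c * (real n + a)\<^sup>2) \<tau>) = \<bar>real n + a\<bar> ^ k * exp (- (b * (real n + a)\<^sup>2))" for n
  proof -
    have "\<bar>\<epsilon>\<bar> = 1" using \<epsilon> by auto
    then show ?thesis by (simp add: norm_mult norm_e2pi abs_mult power_abs b_def mult_ac del: of_real_mult of_real_power)
  qed
  ultimately show "summable (\<lambda>n. norm (of_real (\<epsilon> ^ n * (real n + a) ^ k) * e2pi (c * (real n + a)\<^sup>2) \<tau>))"
    by simp
qed

theorem theorem1p1:
  fixes M N :: nat and r :: real
  assumes "N \<ge> 1" and "even M" and "M < N"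
    and "r \<in> exponents M N"
  shows "mixed_partial_theta_function (\<lambda>\<tau>. chi M N r \<tau>)"
proof -
  obtain m where N: "N = Suc m" using assms(1) by (cases N) auto
  define L where "L = real N - real M"
  have L: "L > 0" using assms(3) by (simp add: L_def)
  define a \<epsilon> where "a = r / L" and "\<epsilon> = (- 1 :: real) ^ N"
  have rat: "r \<in> \<rat>" "L \<in> \<rat>" using assms(4) by (auto simp: exponents_def L_def)
  have \<epsilon>: "\<epsilon> \<in> {1, - 1}" unfolding \<epsilon>_def by (cases "even N") auto
  define \<alpha> where "\<alpha> = (\<lambda>i. - (2 * of_real pi * \<i>) * (of_nat (m choose i) / fact m) * (- (2 * of_real pi * \<i>) * of_real L) ^ (m - i))"
  define P where "P = (\<lambda>i. partial_theta_series \<epsilon> a (L / 2) (m - i))"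
  have "chi M N r \<tau> = e2pi (- (r\<^sup>2 / (2 * L))) \<tau> * (\<Sum>i<N. \<alpha> i * laurent_coeff M N i \<tau> * P i \<tau>)" if \<tau>: "\<tau> \<in> upper_half_plane" for \<tau>
  proof -
    define t where "t = (\<lambda>i n. of_real (\<epsilon> ^ n * (real n + a) ^ (m - i)) * e2pi (L / 2 * (real n + a)\<^sup>2) \<tau>)"
    have "t i sums P i \<tau>" for i
      unfolding t_def P_def partial_theta_series_def
      by (rule summable_sums, rule partial_theta_summable[OF \<tau> _ \<epsilon>]) (use L in simp)
    then have "(\<lambda>n. \<Sum>i<N. \<alpha> i * laurent_coeff M N i \<tau> * t i n) sums (\<Sum>i<N. \<alpha> i * laurent_coeff M N i \<tau> * P i \<tau>)"
      by (intro sums_sum sums_mult)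
    from sums_mult[OF this, of "e2pi (- (r\<^sup>2 / (2 * L))) \<tau>"]
    have "(\<lambda>n. e2pi (- (r\<^sup>2 / (2 * L))) \<tau> * (\<Sum>i<N. \<alpha> i * laurent_coeff M N i \<tau> * t i n)) sums
       (e2pi (- (r\<^sup>2 / (2 * L))) \<tau> * (\<Sum>i<N. \<alpha> i * laurent_coeff M N i \<tau> * P i \<tau>))" .
    moreover have "e2pi (- (r\<^sup>2 / (2 * L))) \<tau> * (\<Sum>i<N. \<alpha> i * laurent_coeff M N i \<tau> * t i n)
       = - ((- 1) ^ (N * n) * e2pi (real n * r + (real n)\<^sup>2 * L / 2) \<tau> * phi_residue M N \<tau> (r + real n * L))" for n
    proof -
      have "- (r\<^sup>2 / (2 * L)) + L / 2 * (real n + a)\<^sup>2 = real n * r + (real n)\<^sup>2 * L / 2"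
        using L by (simp add: a_def field_simps power2_eq_square)
      then have e: "e2pi (- (r\<^sup>2 / (2 * L))) \<tau> * e2pi (L / 2 * (real n + a)\<^sup>2) \<tau> = e2pi (real n * r + (real n)\<^sup>2 * L / 2) \<tau>"
        by (simp flip: e2pi_add_left)
      have s: "complex_of_real (\<epsilon> ^ n) = (- 1) ^ (N * n)" by (simp add: \<epsilon>_def power_mult)
      \<comment> \<open>the residue is evaluated at \<open>r + nL = L (n + a)\<close>, which produces the powers of \<open>n + a\<close>\<close>
      have rn: "complex_of_real (r + real n * L) = of_real L * of_real (real n + a)"
        using L by (simp add: a_def field_simps flip: of_real_mult of_real_add)
      have at: "\<alpha> i * t i n = - ((- 1) ^ (N * n) * e2pi (L / 2 * (real n + a)\<^sup>2) \<tau> * (2 * of_real pi * \<i>) *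
          (of_nat (m choose i) / fact m * (- (2 * of_real pi * \<i>) * of_real (r + real n * L)) ^ (m - i)))" for i
        unfolding \<alpha>_def t_def of_real_mult s
        unfolding rn of_real_power power_mult_distrib by (simp add: mult_ac)
      have "\<alpha> i * laurent_coeff M N i \<tau> * t i n = - ((- 1) ^ (N * n) * e2pi (L / 2 * (real n + a)\<^sup>2) \<tau> * (2 * of_real pi * \<i>)) *
          (of_nat (m choose i) / fact m * laurent_coeff M N i \<tau> * (- (2 * of_real pi * \<i>) * of_real (r + real n * L)) ^ (m - i))" for i
      proof -
        have "\<alpha> i * laurent_coeff M N i \<tau> * t i n = \<alpha> i * t i n * laurent_coeff M N i \<tau>" by (simp only: mult_ac)
        then show ?thesis unfolding at by (simp only: mult_minus_left mult_minus_right mult_ac)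
      qed
      then have "(\<Sum>i<N. \<alpha> i * laurent_coeff M N i \<tau> * t i n) = - ((- 1) ^ (N * n) * e2pi (L / 2 * (real n + a)\<^sup>2) \<tau> * phi_residue M N \<tau> (r + real n * L))"
        unfolding N phi_residue_eq[OF \<tau>] by (simp only: sum_distrib_left[symmetric] mult.assoc minus_mult_left)
      then show ?thesis using e by (simp add: mult_ac)
    qed
    ultimately have "(\<lambda>n. - ((- 1) ^ (N * n) * e2pi (real n * r + (real n)\<^sup>2 * L / 2) \<tau> * phi_residue M N \<tau> (r + real n * L))) sums
       (e2pi (- (r\<^sup>2 / (2 * L))) \<tau> * (\<Sum>i<N. \<alpha> i * laurent_coeff M N i \<tau> * P i \<tau>))" by simp
    moreover have "(\<lambda>n. - ((- 1) ^ (N * n) * e2pi (real n * r + (real n)\<^sup>2 * L / 2) \<tau> * phi_residue M N \<tau> (r + real n * L))) sums (- (- chi M N r \<tau>))"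
      unfolding L_def by (rule sums_minus[OF chi_sums[OF \<tau> assms(4,3)]])
    ultimately show ?thesis using sums_unique2 by fastforce
  qed
  moreover have "quasimodular_form (laurent_coeff M N i) \<and> partial_theta_function (P i)" for i
  proof (rule conjI[OF laurent_coeff_quasimodular])
    have "a \<in> \<rat>" "L / 2 \<in> \<rat>" "L / 2 > 0" using rat L by (simp_all add: a_def)
    then show "partial_theta_function (P i)"
      unfolding partial_theta_function_def P_def using \<epsilon> by blast
  qed
  moreover have "- (r\<^sup>2 / (2 * L)) \<in> \<rat>" using rat by auto
  ultimately show ?thesis
    unfolding mixed_partial_theta_function_def
    by (intro bexI[of _ "- (r\<^sup>2 / (2 * L))"] exI[of _ N] exI[of _ \<alpha>] exI[of _ "laurent_coeff M N"] exI[of _ P]) auto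
qed

end
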